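(* Consider the system of conservation laws $\mathbf u_t+\sum_{k=1}^d \mathbf f^k(\mathbf u)_{x_k}=0$, $\mathbf u(\cdot,0)=\mathbf u_0$, equipped with a strictly convex entropy function $U$ and corresponding entropy flux functions $F^k$, $k=1,\dots,d$. Assume that the exact and approximate solutions have compact support inside the spatial domain $\Omega$. Let $\mathbf v^h\in\mathcal V^q$ be an approximate solution of the SC-DG scheme, i.e. $\mathcal B(\mathbf v^h,\mathbf w^h)=0$ for all $\mathbf w^h\in\mathcal V^q$. Then: (i) The scheme is conservative: $$\int_\Omega \mathbf u(\mathbf v^h(x,t^N_-))\,dx=\int_\Omega \mathbf u(\mathbf v^h(x,t^0_-))\,dx .$$ (ii) The scheme is entropy stable: with $\mathbf u^*(t^0_-):=\frac1{|\Omega|}\int_\Omega \mathbf u(\mathbf v^h(x,t^0_-))\,dx$, $$\int_\Omega U(\mathbf u^*(t^0_-))\,dx\le\int_\Omega U(\mathbf u(\mathbf v^h(x,t^N_-)))\,dx\le\int_\Omega U(\mathbf u(\mathbf v^h(x,t^0_-)))\,dx .$$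
   Context: **Conservation law.** $\mathbf u:\mathbb R^d\times[0,\infty)\to\mathbb R^m$, $d\in\{1,2,3\}$, with smooth fluxes $\mathbf f^k:\mathbb R^m\to\mathbb R^m$ and compactly supported initial data $\mathbf u_0$. An entropy pair $(U,F)$ consists of a (sufficiently smooth) convex $U:\mathbb R^m\to\mathbb R$ and $F^k:\mathbb R^m\to\mathbb R$ with $\partial_{\mathbf u}F^k=\partial_{\mathbf u}U\,\partial_{\mathbf u}\mathbf f^k$. The entropy variables are $\mathbf v=(U_{\mathbf u})^T$; $\mathbf u(\mathbf v)$ denotes the inverse map, $\mathbf f^k(\mathbf v)$ abbreviates $\mathbf f^k(\mathbf u(\mathbf v))$, $\mathbf u_{\mathbf v}$ is the (symmetric positive definite) Jacobian of $\mathbf u(\mathbf v)$ and $\mathbf v_{\mathbf u}$ its inverse. $\langle\cdot,\cdot\rangle$ is the Euclidean inner product of $\mathbb R^m$. **Mesh.** $\Omega\subset\mathbb R^d$ is a bounded domain containing the supports of the solutions on $[0,T]$ (so no boundary conditions enter). $0=t_0<\dots<t_N=T$, $I_n=[t_n,t_{n+1})$, $S_n=\Omega\times I_n$, $d'=d+1$. $\mathcal T_n$ is a subdivision of $S_n$ into disjoint convex cells $\kappa=K\times I_n$; $h=\sup_{\kappa,n}h_\kappa<\infty$, with $h_\kappa$ the diameter of $\kappa$, $\rho_\kappa$ its interior (inscribed) diameter, and $h/\rho_\kappa\le\sigma$ for all cells with $\sigma>0$ independent of $h$. $\sum_{\kappa,n}$ is the sum over all $n=0,\dots,N-1$ and all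 $\kappa\in\mathcal T_n$. $\mathcal V^q=\prod_n\mathcal V^q_n$, $\mathcal V_n^q=\{\mathbf w\in L_2(S_n)^m:\mathbf w|_\kappa\in\mathbb P_q(\kappa)^m\ \forall\kappa\in\mathcal T_n\}$, where $\mathbb P_q$ denotes polynomials of degree at most $q$. Traces: $\mathbf w_{n,\pm}(x)=\mathbf w(x,t_\pm^n)$ (limits at $t_n$ from above/below); $\mathbf w_{K,\pm}(x,t)=\lim_{\epsilon\downarrow0}\mathbf w(x\pm\epsilon\mathbf n,t)$ on $\partial K$ with outward unit normal $\mathbf n$; jumps $[\![\mathbf w]\!]=\mathbf w_+-\mathbf w_-$. **Scheme.** The SC-DG method is: find $\mathbf v^h\in\mathcal V^q$ with $\mathcal B(\mathbf v^h,\mathbf w^h):=\mathcal B_{DG}(\mathbf v^h,\mathbf w^h)+\mathcal B_{SC}(\mathbf v^h,\mathbf w^h)=0$ for all $\mathbf w^h\in\mathcal V^q$, where $\mathbf v^h_{0,-}=\mathbf v^h(\cdot,t^0_-)$ is a given suitable projection (e.g. $L_2$-projection) of $\mathbf v(\mathbf u_0)$, and $$\mathcal B_{DG}(\mathbf v^h,\mathbf w^h)=-\sum_{\kappa,n}\int_{I_n}\int_K\Big(\langle\mathbf u(\mathbf v^h),\mathbf w^h_t\rangle+\sum_{k=1}^d\langle\mathbf f^k(\mathbf v^h),\mathbf w^h_{x_k}\rangle\Big)dx\,dt+\sum_{\kappa,n}\int_K\Big(\langle\mathbf u(\mathbf v^h_{n+1,-}),\mathbf w^h_{n+1,-}\rangle-\langle\mathbf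 u(\mathbf v^h_{n,-}),\mathbf w^h_{n,+}\rangle\Big)dx+\sum_{\kappa,n}\int_{I_n}\int_{\partial K}\langle\hat{\mathbf f}(\mathbf v^h),\mathbf w^h_{K,-}\rangle\,ds\,dt .$$ The numerical flux is consistent and conservative and has the form $\hat{\mathbf f}(\mathbf v^h)=\mathbf f^\star(\mathbf v^h)-\frac12D(\mathbf v^h)(\mathbf v^h_{K,+}-\mathbf v^h_{K,-})$ with entropy conservative flux $\mathbf f^\star(\mathbf v^h)=\int_0^1\sum_k n_k\mathbf f^k(\mathbf v^h_{K,-}+\theta'[\![\mathbf v^h_K]\!])\,d\theta'$ and $D(\mathbf v^h)=D(\mathbf v^h_{K,-},\mathbf v^h_{K,+};\mathbf n)$ a symmetric positive definite matrix satisfying $c\langle\mathbf w,\mathbf w\rangle\le\langle\mathbf w,D(\mathbf v^h)\mathbf w\rangle\le C\langle\mathbf w,\mathbf w\rangle$ with $c,C>0$ independent of $\mathbf v^h$. The shock capturing term is $$\mathcal B_{SC}(\mathbf v^h,\mathbf w^h)=\sum_{\kappa,n}\int_{I_n}\int_K\varepsilon_\kappa\Big(\langle\mathbf w^h_t,\tilde{\mathbf u}_{\mathbf v}\mathbf v^h_t\rangle+\sum_{k=1}^d\langle\mathbf w^h_{x_k},\tilde{\mathbf u}_{\mathbf v}\mathbf v^h_{x_k}\rangle\Big)dx\,dt,\qquad \varepsilon_\kappa=\frac{h^{\alpha_1}C_1^{SC}\,\overline{\mathrm{Res}}_\kappa+h^{\alpha_2}C_2^{SC}\,\overline{\mathrm{BRes}}_\kappa}{\overline{\nabla\mathbf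 v}_\kappa+h^\theta},$$ with constants $C_1^{SC},C_2^{SC}>0$, $\alpha_1\in(0,2)$, $\alpha_2>0$, $\theta\ge\max\{\frac{d'}2-\frac{\alpha_1}2,\frac{d'}2-\alpha_2\}$, $\tilde{\mathbf u}_{\mathbf v}=\mathbf u_{\mathbf v}(\tilde{\mathbf v}_\kappa)$, $\tilde{\mathbf v}_\kappa=\frac1{|\kappa|}\int_\kappa\mathbf v^h$, $\mathrm{Res}=\mathbf u(\mathbf v^h)_t+\sum_k\mathbf f^k(\mathbf v^h)_{x_k}$ and $$\overline{\mathrm{Res}}_\kappa^2=\int_{I_n}\int_K\langle\mathrm{Res},\mathbf v_{\mathbf u}(\mathbf v^h)\mathrm{Res}\rangle\,dx\,dt,\quad \overline{\nabla\mathbf v}_\kappa^2=\int_{I_n}\int_K\Big(\langle\mathbf v^h_t,\tilde{\mathbf u}_{\mathbf v}\mathbf v^h_t\rangle+\sum_k\langle\mathbf v^h_{x_k},\tilde{\mathbf u}_{\mathbf v}\mathbf v^h_{x_k}\rangle\Big)dx\,dt,$$ $$\overline{\mathrm{BRes}}_\kappa^2=\int_K|[\![\mathbf u(\mathbf v^h_n)]\!]|^2dx+\int_{I_n}\int_{\partial K}\Big(\big|\mathbf f^\star(\mathbf v^h)-\textstyle\sum_k n_k\mathbf f^k(\mathbf v^h_{K,-})\big|^2+\big|\tfrac12D(\mathbf v^h)[\![\mathbf v^h_K]\!]\big|^2\Big)ds\,dt .$$ Here $t^N_-$ and $t^0_-$ denote the limits from below at $t_N=T$ and $t_0=0$; the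 value at $t^0_-$ is the projected initial datum. *)

theory Defs
  imports "HOL-Analysis.Analysis"
begin

section \<open>Derivatives and polynomials\<close>

text \<open>Functions of space and time are curried: \<open>w x t\<close>.\<close>

definition dt :: "('a \<Rightarrow> real \<Rightarrow> 'b::real_normed_vector) \<Rightarrow> 'a \<Rightarrow> real \<Rightarrow> 'b" where
  "dt w x t = vector_derivative (\<lambda>s. w x s) (at t)"

definition dx :: "'d \<Rightarrow> (real^'d \<Rightarrow> real \<Rightarrow> 'b::real_normed_vector) \<Rightarrow> real^'d \<Rightarrow> real \<Rightarrow> 'b" where
  "dx k w x t = vector_derivative (\<lambda>s. w (x + s *\<^sub>R axis k 1) t) (at 0)"

definition C1 :: "('a::euclidean_space \<Rightarrow> 'b::real_normed_vector) \<Rightarrow> bool" where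
  "C1 g \<longleftrightarrow> (\<forall>x. g differentiable (at x)) \<and>
     (\<forall>b\<in>Basis. continuous_on UNIV (\<lambda>x. frechet_derivative g (at x) b))"

definition multi_indices :: "nat \<Rightarrow> ('a::euclidean_space \<Rightarrow> nat) set" where
  "multi_indices q = {\<alpha> \<in> Basis \<rightarrow>\<^sub>E UNIV. (\<Sum>b\<in>Basis. \<alpha> b) \<le> q}"

text \<open>Polynomials of total degree at most \<open>q\<close> on a Euclidean space, with vector-valued
  coefficients.\<close>

definition polys :: "nat \<Rightarrow> ('a::euclidean_space \<Rightarrow> 'b::real_vector) set" where
  "polys q = {p. \<exists>c. \<forall>z. p z = (\<Sum>\<alpha>\<in>multi_indices q. (\<Prod>b\<in>Basis. (z \<bullet> b) ^ \<alpha> b) *\<^sub>R c \<alpha>)}"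


section \<open>Conservation law and entropy\<close>

definition strictly_convex :: "('a::real_vector \<Rightarrow> real) \<Rightarrow> bool" where
  "strictly_convex g \<longleftrightarrow>
     (\<forall>x y s. x \<noteq> y \<longrightarrow> 0 < s \<longrightarrow> s < 1 \<longrightarrow>
        g ((1 - s) *\<^sub>R x + s *\<^sub>R y) < (1 - s) * g x + s * g y)"

definition sym_pos_def :: "real^'m^'m \<Rightarrow> bool" where
  "sym_pos_def A \<longleftrightarrow> transpose A = A \<and> (\<forall>w. w \<noteq> 0 \<longrightarrow> w \<bullet> (A *v w) > 0)"

definition entropy_var :: "(real^'m \<Rightarrow> real) \<Rightarrow> real^'m \<Rightarrow> real^'m" where
  "entropy_var U u = (\<chi> i. frechet_derivative U (at u) (axis i 1))"

definition cons_var :: "(real^'m \<Rightarrow> real) \<Rightarrow> real^'m \<Rightarrow> real^'m" where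
  "cons_var U = inv (entropy_var U)"

definition jac_uv :: "(real^'m \<Rightarrow> real) \<Rightarrow> real^'m \<Rightarrow> real^'m^'m" where
  "jac_uv U v = jacobian (cons_var U) (at v)"

definition jac_vu :: "(real^'m \<Rightarrow> real) \<Rightarrow> real^'m \<Rightarrow> real^'m^'m" where
  "jac_vu U v = matrix_inv (jac_uv U v)"

text \<open>The map \<open>u \<mapsto> v\<close> is required to be a bijection of the whole of \<open>\<real>\<^sup>m\<close>, since the scheme evaluates
  the inverse map at arbitrary piecewise polynomials.\<close>

definition strictly_convex_entropy :: "(real^'m \<Rightarrow> real) \<Rightarrow> bool" where
  "strictly_convex_entropy U \<longleftrightarrow>
     strictly_convex U \<and> (\<forall>u. U differentiable (at u)) \<and> C1 (entropy_var U) \<and>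
     bij (entropy_var U) \<and>
     (\<forall>v. cons_var U differentiable (at v) \<and> sym_pos_def (jac_uv U v))"

definition entropy_pair ::
  "('d \<Rightarrow> real^'m \<Rightarrow> real^'m) \<Rightarrow> (real^'m \<Rightarrow> real) \<Rightarrow> ('d \<Rightarrow> real^'m \<Rightarrow> real) \<Rightarrow> bool" where
  "entropy_pair f U F \<longleftrightarrow>
     (\<forall>k u. F k differentiable (at u) \<and>
        frechet_derivative (F k) (at u) =
          frechet_derivative U (at u) \<circ> frechet_derivative (f k) (at u))"

definition weak_solution ::
  "('d \<Rightarrow> real^'m \<Rightarrow> real^'m) \<Rightarrow> real \<Rightarrow> (real^'d \<Rightarrow> real^'m) \<Rightarrow> (real^'d \<Rightarrow> real \<Rightarrow> real^'m) \<Rightarrow> bool" where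
  "weak_solution f T u0 u \<longleftrightarrow>
     (\<forall>C. compact C \<longrightarrow>
        set_integrable lebesgue C u0 \<and>
        set_integrable lebesgue (C \<times> {0..<T}) (\<lambda>(x, t). u x t) \<and>
        (\<forall>k. set_integrable lebesgue (C \<times> {0..<T}) (\<lambda>(x, t). f k (u x t)))) \<and>
     (\<forall>\<phi>. C1 (\<lambda>(x, t). \<phi> x t :: real) \<and>
          (\<exists>C. compact C \<and> C \<subseteq> UNIV \<times> {..<T} \<and> (\<forall>x t. (x, t) \<notin> C \<longrightarrow> \<phi> x t = 0)) \<longrightarrow>
        (LINT t:{0..<T}|lebesgue. LINT x|lebesgue.
            dt \<phi> x t *\<^sub>R u x t + (\<Sum>k\<in>UNIV. dx k \<phi> x t *\<^sub>R f k (u x t)))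
        + (LINT x|lebesgue. \<phi> x 0 *\<^sub>R u0 x) = 0)"

definition supported_inside :: "'a::topological_space set \<Rightarrow> real set \<Rightarrow> ('a \<Rightarrow> real \<Rightarrow> 'b::zero) \<Rightarrow> bool" where
  "supported_inside \<Omega> I g \<longleftrightarrow>
     (\<exists>C. compact C \<and> C \<subseteq> \<Omega> \<and> (\<forall>t\<in>I. \<forall>x. x \<notin> C \<longrightarrow> g x t = 0))"


section \<open>Integration over the boundary of a convex body\<close>

text \<open>The outward unit normal of a convex body is unique at almost every boundary point; at the
  remaining points it is set to \<open>0\<close>.\<close>

definition outward_normal :: "'a::euclidean_space set \<Rightarrow> 'a \<Rightarrow> 'a" where
  "outward_normal K x =
     (if \<exists>!n. norm n = 1 \<and> (\<forall>y\<in>K. (y - x) \<bullet> n \<le> 0)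
      then THE n. norm n = 1 \<and> (\<forall>y\<in>K. (y - x) \<bullet> n \<le> 0) else 0)"

definition radial_projection :: "'a::euclidean_space set \<Rightarrow> 'a \<Rightarrow> 'a \<Rightarrow> 'a" where
  "radial_projection K c x = (THE y. y \<in> frontier K \<and> (\<exists>s\<ge>0. y = c + s *\<^sub>R (x - c)))"

text \<open>Surface integral over \<open>\<partial>K\<close> for a bounded convex set \<open>K\<close> with nonempty interior. The library
  has no surface measure, so the surface element is read off from volumes of cones: for \<open>c\<close> in the
  interior, the cone with apex \<open>c\<close> over a boundary element \<open>ds\<close> at \<open>y\<close> with unit normal \<open>n\<close> has
  height \<open>(y - c) \<bullet> n\<close> and volume \<open>((y - c) \<bullet> n) ds / d\<close>, where \<open>d\<close> is the dimension. Hence the image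
  of Lebesgue measure on \<open>K\<close> under the radial projection from \<open>c\<close> has density \<open>((y - c) \<bullet> n) / d\<close> with
  respect to the \<open>(d-1)\<close>-dimensional surface measure on \<open>\<partial>K\<close>, and dividing by this density gives the
  surface integral. The result does not depend on \<open>c\<close>. For \<open>d = 1\<close> it is the sum over the two
  end points, see \<open>surface_integral_interval\<close> below.\<close>

definition surface_integral :: "'a::euclidean_space set \<Rightarrow> ('a \<Rightarrow> real) \<Rightarrow> real" where
  "surface_integral K g =
     (let c = (SOME c. c \<in> interior K); p = radial_projection K c
      in LINT x:K|lebesgue. DIM('a) / ((p x - c) \<bullet> outward_normal K (p x)) * g (p x))"

lemma surface_integral_interval:
  fixes a b :: real
  assumes "a < b"
  shows "surface_integral {a..b} g = g a + g b"
proof -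
  define c where "c = (SOME c. c \<in> interior {a..b})"
  have "c \<in> interior {a..b}"
    unfolding c_def by (rule someI[of _ "(a + b) / 2"]) (use assms in simp)
  then have c: "a < c" "c < b"
    by auto
  have fr: "frontier {a..b} = {a, b}"
    using assms frontier_cbox[of a b] by (auto simp: frontier_def)
  have pb: "radial_projection {a..b} c x = b" if "c < x" for x
    unfolding radial_projection_def fr
  proof (rule the_equality)
    have "b = c + ((b - c) / (x - c)) *\<^sub>R (x - c)" and "(b - c) / (x - c) \<ge> 0"
      using c that by simp_all
    then show "b \<in> {a, b} \<and> (\<exists>s\<ge>0. b = c + s *\<^sub>R (x - c))"
      by blast
    show "y = b" if y: "y \<in> {a, b} \<and> (\<exists>s\<ge>0. y = c + s *\<^sub>R (x - c))" for y
    proof -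
      from y obtain s where s: "s \<ge> 0" "y = c + s *\<^sub>R (x - c)"
        by blast
      have "s * (x - c) \<ge> 0"
        using s(1) \<open>c < x\<close> by simp
      then have "y \<ge> c"
        using s(2) by simp
      then have "y \<noteq> a"
        using c by linarith
      then show ?thesis
        using y by blast
    qed
  qed
  have pa: "radial_projection {a..b} c x = a" if "x < c" for x
    unfolding radial_projection_def fr
  proof (rule the_equality)
    have "((c - a) / (c - x)) * (x - c) = - (((c - a) / (c - x)) * (c - x))"
      by (metis minus_diff_eq mult_minus_right)
    also have "\<dots> = - (c - a)"
      using that by simp
    finally have "((c - a) / (c - x)) * (x - c) = - (c - a)" .
    then have "a = c + ((c - a) / (c - x)) *\<^sub>R (x - c)" and "(c - a) / (c - x) \<ge> 0"
      using c that by simp_all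
    then show "a \<in> {a, b} \<and> (\<exists>s\<ge>0. a = c + s *\<^sub>R (x - c))"
      by blast
    show "y = a" if y: "y \<in> {a, b} \<and> (\<exists>s\<ge>0. y = c + s *\<^sub>R (x - c))" for y
    proof -
      from y obtain s where s: "s \<ge> 0" "y = c + s *\<^sub>R (x - c)"
        by blast
      have "s * (x - c) \<le> 0"
        using s(1) \<open>x < c\<close> by (simp add: mult_nonneg_nonpos)
      then have "y \<le> c"
        using s(2) by simp
      then have "y \<noteq> b"
        using c by linarith
      then show ?thesis
        using y by blast
    qed
  qed
  have uniq_b: "n = 1" if "norm n = 1" "\<forall>y\<in>{a..b}. (y - b) \<bullet> n \<le> 0" for n :: real
  proof -
    have "(a - b) * n \<le> 0"
      using that(2) assms by auto
    with assms have "n \<ge> 0"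
      by (simp add: mult_le_0_iff)
    with that(1) show ?thesis by simp
  qed
  have uniq_a: "n = -1" if "norm n = 1" "\<forall>y\<in>{a..b}. (y - a) \<bullet> n \<le> 0" for n :: real
  proof -
    have "(b - a) * n \<le> 0"
      using that(2) assms by auto
    with assms have "n \<le> 0"
      by (simp add: mult_le_0_iff)
    with that(1) show ?thesis by simp
  qed
  have val_b: "norm (1::real) = 1 \<and> (\<forall>y\<in>{a..b}. (y - b) \<bullet> 1 \<le> 0)"
    and val_a: "norm (-1::real) = 1 \<and> (\<forall>y\<in>{a..b}. (y - a) \<bullet> (-1) \<le> 0)"
    by auto
  have nb: "outward_normal {a..b} b = 1"
  proof -
    have ex1: "\<exists>!n. norm n = 1 \<and> (\<forall>y\<in>{a..b}. (y - b) \<bullet> n \<le> 0)"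
      using val_b uniq_b by blast
    show ?thesis
      unfolding outward_normal_def if_P[OF ex1] by (rule the1_equality[OF ex1 val_b])
  qed
  have na: "outward_normal {a..b} a = -1"
  proof -
    have ex1: "\<exists>!n. norm n = 1 \<and> (\<forall>y\<in>{a..b}. (y - a) \<bullet> n \<le> 0)"
      using val_a uniq_a by blast
    show ?thesis
      unfolding outward_normal_def if_P[OF ex1] by (rule the1_equality[OF ex1 val_a])
  qed
  let ?G = "\<lambda>x. 1 / ((radial_projection {a..b} c x - c) \<bullet>
      outward_normal {a..b} (radial_projection {a..b} c x)) * g (radial_projection {a..b} c x)"
  have Ga: "(?G has_integral g a) {a..c}"
  proof (rule has_integral_spike[where S = "{c}"])
    show "((\<lambda>x. g a / (c - a)) has_integral g a) {a..c}"
      using has_integral_const_real[of "g a / (c - a)" a c] c by simp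
  qed (use c in \<open>auto simp: pa na\<close>)
  have Gb: "(?G has_integral g b) {c..b}"
  proof (rule has_integral_spike[where S = "{c}"])
    show "((\<lambda>x. g b / (b - c)) has_integral g b) {c..b}"
      using has_integral_const_real[of "g b / (b - c)" c b] c by simp
  qed (use c in \<open>auto simp: pb nb\<close>)
  have abs_a: "?G absolutely_integrable_on {a..c}"
  proof (rule absolutely_integrable_spike[where S = "{c}"])
    show "(\<lambda>x. g a / (c - a)) absolutely_integrable_on {a..c}"
      by (intro absolutely_integrable_continuous_real continuous_intros)
  qed (use c in \<open>auto simp: pa na\<close>)
  have abs_b: "?G absolutely_integrable_on {c..b}"
  proof (rule absolutely_integrable_spike[where S = "{c}"])
    show "(\<lambda>x. g b / (b - c)) absolutely_integrable_on {c..b}"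
      by (intro absolutely_integrable_continuous_real continuous_intros)
  qed (use c in \<open>auto simp: pb nb\<close>)
  have "?G absolutely_integrable_on {a..c} \<union> {c..b}"
    using abs_a abs_b by (rule set_integrable_Un) auto
  moreover have "{a..c} \<union> {c..b} = {a..b}"
    using c by auto
  ultimately have "(LINT x:{a..b}|lebesgue. ?G x) = integral {a..b} ?G"
    by (simp add: set_lebesgue_integral_eq_integral(2))
  also have "\<dots> = g a + g b"
    using has_integral_combine[OF _ _ Ga Gb] c by (intro integral_unique) simp
  finally show ?thesis
    unfolding surface_integral_def Let_def c_def[symmetric] by simp
qed


section \<open>Mesh and trial space\<close>

definition inner_diameter :: "'a::metric_space set \<Rightarrow> real" where
  "inner_diameter S = Sup {2 * r |r x. 0 \<le> r \<and> ball x r \<subseteq> S}"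

text \<open>The slab \<open>n\<close> is \<open>\<Omega> \<times> [tt n, tt (n+1))\<close>, and its space-time cells are \<open>K \<times> [tt n, tt (n+1))\<close> for
  \<open>K \<in> \<T> n\<close>.\<close>

definition st_cell :: "(nat \<Rightarrow> real) \<Rightarrow> nat \<Rightarrow> (real^'d) set \<Rightarrow> ((real^'d) \<times> real) set" where
  "st_cell tt n K = K \<times> {tt n..<tt (Suc n)}"

definition mesh_size :: "nat \<Rightarrow> (nat \<Rightarrow> real) \<Rightarrow> (nat \<Rightarrow> (real^'d) set set) \<Rightarrow> real" where
  "mesh_size N tt \<T> = (SUP (n, K)\<in>Sigma {..<N} \<T>. diameter (st_cell tt n K))"

text \<open>The cells of a slab are disjoint and cover \<open>\<Omega>\<close> up to the boundaries of cells. Both open cells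
  and a genuine partition of \<open>\<Omega>\<close> are allowed. The bound \<open>h / \<rho> \<le> \<sigma>\<close> is multiplied out; as \<open>h > 0\<close>,
  it makes every \<open>\<rho>\<close> positive.\<close>

definition st_mesh ::
  "(real^'d) set \<Rightarrow> real \<Rightarrow> nat \<Rightarrow> (nat \<Rightarrow> real) \<Rightarrow> (nat \<Rightarrow> (real^'d) set set) \<Rightarrow> real \<Rightarrow> bool" where
  "st_mesh \<Omega> T N tt \<T> \<sigma> \<longleftrightarrow>
     N > 0 \<and> tt 0 = 0 \<and> tt N = T \<and> (\<forall>n<N. tt n < tt (Suc n)) \<and>
     (\<forall>n<N. finite (\<T> n) \<and> disjoint (\<T> n) \<and> (\<forall>K\<in>\<T> n. convex K \<and> K \<subseteq> \<Omega>) \<and>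
            \<Omega> \<subseteq> (\<Union>K\<in>\<T> n. closure K)) \<and>
     \<sigma> > 0 \<and> (\<forall>n<N. \<forall>K\<in>\<T> n. mesh_size N tt \<T> \<le> \<sigma> * inner_diameter (st_cell tt n K))"

text \<open>Only the restrictions of \<open>w\<close> to the cells matter; its values elsewhere are unconstrained.\<close>

definition DG_space ::
  "nat \<Rightarrow> nat \<Rightarrow> (nat \<Rightarrow> real) \<Rightarrow> (nat \<Rightarrow> (real^'d) set set) \<Rightarrow> (real^'d \<Rightarrow> real \<Rightarrow> real^'m) set" where
  "DG_space q N tt \<T> =
     {w. \<forall>n<N. \<forall>K\<in>\<T> n. \<exists>p\<in>polys q. \<forall>(x, t)\<in>st_cell tt n K. w x t = p (x, t)}"

definition spatial_DG_space :: "nat \<Rightarrow> (real^'d) set set \<Rightarrow> (real^'d \<Rightarrow> real^'m) set" where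
  "spatial_DG_space q M = {w. \<forall>K\<in>M. \<exists>p\<in>polys q. \<forall>x\<in>K. w x = p x}"

definition projection_onto_DG ::
  "nat \<Rightarrow> (real^'d) set set \<Rightarrow> ((real^'d \<Rightarrow> real^'m) \<Rightarrow> (real^'d \<Rightarrow> real^'m)) \<Rightarrow> bool" where
  "projection_onto_DG q M P \<longleftrightarrow>
     (\<forall>g. P g \<in> spatial_DG_space q M) \<and>
     (\<forall>g\<in>spatial_DG_space q M. \<forall>K\<in>M. \<forall>x\<in>K. P g x = g x)"

text \<open>Traces in time. For the discrete solution, the trace from below at \<open>n = 0\<close> is the given
  initial datum \<open>v0\<close>.\<close>

definition trace_above :: "(nat \<Rightarrow> real) \<Rightarrow> ('a \<Rightarrow> real \<Rightarrow> 'b::t2_space) \<Rightarrow> nat \<Rightarrow> 'a \<Rightarrow> 'b" where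
  "trace_above tt w n x = Lim (at_right (tt n)) (w x)"

definition trace_below :: "(nat \<Rightarrow> real) \<Rightarrow> ('a \<Rightarrow> real \<Rightarrow> 'b::t2_space) \<Rightarrow> nat \<Rightarrow> 'a \<Rightarrow> 'b" where
  "trace_below tt w n x = Lim (at_left (tt n)) (w x)"

definition sol_below ::
  "(nat \<Rightarrow> real) \<Rightarrow> ('a \<Rightarrow> 'b::t2_space) \<Rightarrow> ('a \<Rightarrow> real \<Rightarrow> 'b) \<Rightarrow> nat \<Rightarrow> 'a \<Rightarrow> 'b" where
  "sol_below tt v0 v n x = (if n = 0 then v0 x else trace_below tt v n x)"

text \<open>Traces on \<open>\<partial>K\<close>. On the part of \<open>\<partial>K\<close> that lies on \<open>\<partial>\<Omega>\<close> the outer trace takes the values of \<open>w\<close>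
  outside \<open>\<Omega>\<close>; for a discrete solution with support inside \<open>\<Omega>\<close> this is the state with \<open>u = 0\<close>.\<close>

definition inner_trace ::
  "(real^'d) set \<Rightarrow> (real^'d \<Rightarrow> real \<Rightarrow> 'b::t2_space) \<Rightarrow> real^'d \<Rightarrow> real \<Rightarrow> 'b" where
  "inner_trace K w x t = Lim (at_right 0) (\<lambda>e. w (x - e *\<^sub>R outward_normal K x) t)"

definition outer_trace ::
  "(real^'d) set \<Rightarrow> (real^'d \<Rightarrow> real \<Rightarrow> 'b::t2_space) \<Rightarrow> real^'d \<Rightarrow> real \<Rightarrow> 'b" where
  "outer_trace K w x t = Lim (at_right 0) (\<lambda>e. w (x + e *\<^sub>R outward_normal K x) t)"


section \<open>Numerical flux\<close>

definition flux_dot :: "('d::finite \<Rightarrow> real^'m \<Rightarrow> real^'m) \<Rightarrow> real^'m \<Rightarrow> real^'d \<Rightarrow> real^'m" where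
  "flux_dot f u n = (\<Sum>k\<in>UNIV. (n $ k) *\<^sub>R f k u)"

definition ec_flux ::
  "('d \<Rightarrow> real^'m \<Rightarrow> real^'m) \<Rightarrow> (real^'m \<Rightarrow> real) \<Rightarrow> real^'m \<Rightarrow> real^'m \<Rightarrow> real^'d \<Rightarrow> real^'m" where
  "ec_flux f U a b n = (LINT s:{0..1}|lebesgue. flux_dot f (cons_var U (a + s *\<^sub>R (b - a))) n)"

definition num_flux ::
  "('d \<Rightarrow> real^'m \<Rightarrow> real^'m) \<Rightarrow> (real^'m \<Rightarrow> real) \<Rightarrow> (real^'m \<Rightarrow> real^'m \<Rightarrow> real^'d \<Rightarrow> real^'m^'m) \<Rightarrow>
   real^'m \<Rightarrow> real^'m \<Rightarrow> real^'d \<Rightarrow> real^'m" where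
  "num_flux f U D a b n = ec_flux f U a b n - (1/2) *\<^sub>R (D a b n *v (b - a))"

definition consistent_flux ::
  "('d \<Rightarrow> real^'m \<Rightarrow> real^'m) \<Rightarrow> (real^'m \<Rightarrow> real) \<Rightarrow>
   (real^'m \<Rightarrow> real^'m \<Rightarrow> real^'d \<Rightarrow> real^'m) \<Rightarrow> bool" where
  "consistent_flux f U fh \<longleftrightarrow>
     (\<forall>a n. norm n = 1 \<longrightarrow> fh a a n = flux_dot f (cons_var U a) n)"

definition conservative_flux :: "(real^'m \<Rightarrow> real^'m \<Rightarrow> real^'d \<Rightarrow> real^'m) \<Rightarrow> bool" where
  "conservative_flux fh \<longleftrightarrow> (\<forall>a b n. norm n = 1 \<longrightarrow> fh a b n = - fh b a (- n))"

text \<open>Measurability of \<open>D\<close> is needed for the boundary integrals to make sense.\<close>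

definition admissible_diffusion :: "(real^'m \<Rightarrow> real^'m \<Rightarrow> real^'d \<Rightarrow> real^'m^'m) \<Rightarrow> bool" where
  "admissible_diffusion D \<longleftrightarrow>
     (\<lambda>(a, b, n). D a b n) \<in> borel_measurable borel \<and>
     (\<forall>a b n. norm n = 1 \<longrightarrow> sym_pos_def (D a b n)) \<and>
     (\<exists>c>0. \<exists>C>0. \<forall>a b n w. norm n = 1 \<longrightarrow>
        c * (w \<bullet> w) \<le> w \<bullet> (D a b n *v w) \<and> w \<bullet> (D a b n *v w) \<le> C * (w \<bullet> w))"


section \<open>The SC-DG scheme\<close>

definition B_DG ::
  "('d \<Rightarrow> real^'m \<Rightarrow> real^'m) \<Rightarrow> (real^'m \<Rightarrow> real) \<Rightarrow> (real^'m \<Rightarrow> real^'m \<Rightarrow> real^'d \<Rightarrow> real^'m^'m) \<Rightarrow>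
   nat \<Rightarrow> (nat \<Rightarrow> real) \<Rightarrow> (nat \<Rightarrow> (real^'d) set set) \<Rightarrow> (real^'d \<Rightarrow> real^'m) \<Rightarrow>
   (real^'d \<Rightarrow> real \<Rightarrow> real^'m) \<Rightarrow> (real^'d \<Rightarrow> real \<Rightarrow> real^'m) \<Rightarrow> real" where
  "B_DG f U D N tt \<T> v0 v w =
     - (\<Sum>n<N. \<Sum>K\<in>\<T> n. LINT t:{tt n..<tt (Suc n)}|lebesgue. LINT x:K|lebesgue.
          cons_var U (v x t) \<bullet> dt w x t
          + (\<Sum>k\<in>UNIV. f k (cons_var U (v x t)) \<bullet> dx k w x t))
     + (\<Sum>n<N. \<Sum>K\<in>\<T> n. LINT x:K|lebesgue.
          cons_var U (sol_below tt v0 v (Suc n) x) \<bullet> trace_below tt w (Suc n) x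
          - cons_var U (sol_below tt v0 v n x) \<bullet> trace_above tt w n x)
     + (\<Sum>n<N. \<Sum>K\<in>\<T> n. LINT t:{tt n..<tt (Suc n)}|lebesgue.
          surface_integral K (\<lambda>x.
            num_flux f U D (inner_trace K v x t) (outer_trace K v x t) (outward_normal K x)
            \<bullet> inner_trace K w x t))"

definition cell_mean ::
  "(nat \<Rightarrow> real) \<Rightarrow> (real^'d \<Rightarrow> real \<Rightarrow> real^'m) \<Rightarrow> nat \<Rightarrow> (real^'d) set \<Rightarrow> real^'m" where
  "cell_mean tt v n K =
     (1 / measure lebesgue (st_cell tt n K)) *\<^sub>R (LINT (x, t):st_cell tt n K|lebesgue. v x t)"

definition frozen_jac ::
  "(real^'m \<Rightarrow> real) \<Rightarrow> (nat \<Rightarrow> real) \<Rightarrow> (real^'d \<Rightarrow> real \<Rightarrow> real^'m) \<Rightarrow> nat \<Rightarrow> (real^'d) set \<Rightarrow>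
   real^'m^'m" where
  "frozen_jac U tt v n K = jac_uv U (cell_mean tt v n K)"

definition Res ::
  "('d \<Rightarrow> real^'m \<Rightarrow> real^'m) \<Rightarrow> (real^'m \<Rightarrow> real) \<Rightarrow> (real^'d \<Rightarrow> real \<Rightarrow> real^'m) \<Rightarrow>
   real^'d \<Rightarrow> real \<Rightarrow> real^'m" where
  "Res f U v x t = dt (\<lambda>x t. cons_var U (v x t)) x t
     + (\<Sum>k\<in>UNIV. dx k (\<lambda>x t. f k (cons_var U (v x t))) x t)"

definition Res_bar ::
  "('d \<Rightarrow> real^'m \<Rightarrow> real^'m) \<Rightarrow> (real^'m \<Rightarrow> real) \<Rightarrow> (nat \<Rightarrow> real) \<Rightarrow>
   (real^'d \<Rightarrow> real \<Rightarrow> real^'m) \<Rightarrow> nat \<Rightarrow> (real^'d) set \<Rightarrow> real" where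
  "Res_bar f U tt v n K =
     sqrt (LINT t:{tt n..<tt (Suc n)}|lebesgue. LINT x:K|lebesgue.
       Res f U v x t \<bullet> (jac_vu U (v x t) *v Res f U v x t))"

definition grad_bar ::
  "(real^'m \<Rightarrow> real) \<Rightarrow> (nat \<Rightarrow> real) \<Rightarrow> (real^'d \<Rightarrow> real \<Rightarrow> real^'m) \<Rightarrow> nat \<Rightarrow> (real^'d) set \<Rightarrow> real" where
  "grad_bar U tt v n K =
     sqrt (LINT t:{tt n..<tt (Suc n)}|lebesgue. LINT x:K|lebesgue.
       dt v x t \<bullet> (frozen_jac U tt v n K *v dt v x t)
       + (\<Sum>k\<in>UNIV. dx k v x t \<bullet> (frozen_jac U tt v n K *v dx k v x t)))"

definition BRes_bar ::
  "('d \<Rightarrow> real^'m \<Rightarrow> real^'m) \<Rightarrow> (real^'m \<Rightarrow> real) \<Rightarrow> (real^'m \<Rightarrow> real^'m \<Rightarrow> real^'d \<Rightarrow> real^'m^'m) \<Rightarrow>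
   (nat \<Rightarrow> real) \<Rightarrow> (real^'d \<Rightarrow> real^'m) \<Rightarrow> (real^'d \<Rightarrow> real \<Rightarrow> real^'m) \<Rightarrow> nat \<Rightarrow> (real^'d) set \<Rightarrow> real"
  where
  "BRes_bar f U D tt v0 v n K =
     sqrt ((LINT x:K|lebesgue.
              (norm (cons_var U (trace_above tt v n x) - cons_var U (sol_below tt v0 v n x)))\<^sup>2)
         + (LINT t:{tt n..<tt (Suc n)}|lebesgue. surface_integral K (\<lambda>x.
              let a = inner_trace K v x t; b = outer_trace K v x t; n = outward_normal K x in
              (norm (ec_flux f U a b n - flux_dot f (cons_var U a) n))\<^sup>2
              + (norm ((1/2) *\<^sub>R (D a b n *v (b - a))))\<^sup>2)))"

definition sc_viscosity ::
  "('d \<Rightarrow> real^'m \<Rightarrow> real^'m) \<Rightarrow> (real^'m \<Rightarrow> real) \<Rightarrow> (real^'m \<Rightarrow> real^'m \<Rightarrow> real^'d \<Rightarrow> real^'m^'m) \<Rightarrow>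
   nat \<Rightarrow> (nat \<Rightarrow> real) \<Rightarrow> (nat \<Rightarrow> (real^'d) set set) \<Rightarrow>
   real \<Rightarrow> real \<Rightarrow> real \<Rightarrow> real \<Rightarrow> real \<Rightarrow> (real^'d \<Rightarrow> real^'m) \<Rightarrow>
   (real^'d \<Rightarrow> real \<Rightarrow> real^'m) \<Rightarrow> nat \<Rightarrow> (real^'d) set \<Rightarrow> real" where
  "sc_viscosity f U D N tt \<T> c\<^sub>1 c\<^sub>2 \<alpha>\<^sub>1 \<alpha>\<^sub>2 \<theta> v0 v n K =
     (mesh_size N tt \<T> powr \<alpha>\<^sub>1 * c\<^sub>1 * Res_bar f U tt v n K
      + mesh_size N tt \<T> powr \<alpha>\<^sub>2 * c\<^sub>2 * BRes_bar f U D tt v0 v n K)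
     / (grad_bar U tt v n K + mesh_size N tt \<T> powr \<theta>)"

definition B_SC ::
  "('d \<Rightarrow> real^'m \<Rightarrow> real^'m) \<Rightarrow> (real^'m \<Rightarrow> real) \<Rightarrow> (real^'m \<Rightarrow> real^'m \<Rightarrow> real^'d \<Rightarrow> real^'m^'m) \<Rightarrow>
   nat \<Rightarrow> (nat \<Rightarrow> real) \<Rightarrow> (nat \<Rightarrow> (real^'d) set set) \<Rightarrow>
   real \<Rightarrow> real \<Rightarrow> real \<Rightarrow> real \<Rightarrow> real \<Rightarrow> (real^'d \<Rightarrow> real^'m) \<Rightarrow>
   (real^'d \<Rightarrow> real \<Rightarrow> real^'m) \<Rightarrow> (real^'d \<Rightarrow> real \<Rightarrow> real^'m) \<Rightarrow> real" where
  "B_SC f U D N tt \<T> c\<^sub>1 c\<^sub>2 \<alpha>\<^sub>1 \<alpha>\<^sub>2 \<theta> v0 v w =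
     (\<Sum>n<N. \<Sum>K\<in>\<T> n. LINT t:{tt n..<tt (Suc n)}|lebesgue. LINT x:K|lebesgue.
        sc_viscosity f U D N tt \<T> c\<^sub>1 c\<^sub>2 \<alpha>\<^sub>1 \<alpha>\<^sub>2 \<theta> v0 v n K *
          (dt w x t \<bullet> (frozen_jac U tt v n K *v dt v x t)
           + (\<Sum>k\<in>UNIV. dx k w x t \<bullet> (frozen_jac U tt v n K *v dx k v x t))))"

definition SCDG_solution ::
  "('d \<Rightarrow> real^'m \<Rightarrow> real^'m) \<Rightarrow> (real^'m \<Rightarrow> real) \<Rightarrow> (real^'m \<Rightarrow> real^'m \<Rightarrow> real^'d \<Rightarrow> real^'m^'m) \<Rightarrow>
   nat \<Rightarrow> nat \<Rightarrow> (nat \<Rightarrow> real) \<Rightarrow> (nat \<Rightarrow> (real^'d) set set) \<Rightarrow>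
   real \<Rightarrow> real \<Rightarrow> real \<Rightarrow> real \<Rightarrow> real \<Rightarrow> (real^'d \<Rightarrow> real^'m) \<Rightarrow>
   (real^'d \<Rightarrow> real \<Rightarrow> real^'m) \<Rightarrow> bool" where
  "SCDG_solution f U D q N tt \<T> c\<^sub>1 c\<^sub>2 \<alpha>\<^sub>1 \<alpha>\<^sub>2 \<theta> v0 v \<longleftrightarrow>
     v \<in> DG_space q N tt \<T> \<and>
     (\<forall>w\<in>DG_space q N tt \<T>.
        B_DG f U D N tt \<T> v0 v w + B_SC f U D N tt \<T> c\<^sub>1 c\<^sub>2 \<alpha>\<^sub>1 \<alpha>\<^sub>2 \<theta> v0 v w = 0)"

end

theory Submission
  imports Defs
begin

text \<open>Testing the scheme with constants and with \<open>v\<close> itself reduces the theorem to three facts. In time, the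
  convexity of \<open>U\<close> makes the jump at \<open>t n\<close> dissipate entropy. The shock capturing term is nonnegative. In space,
  \<open>f k\<close> is the gradient of a potential \<open>psi k\<close> with respect to the entropy variables, so the volume term of a cell is
  a divergence; what remains of the numerical flux on a face is seen from the two neighbouring cells with
  opposite normals and adds up to the jump tested with the diffusion matrix, or to zero for constants.

  The boundary terms need a divergence theorem for surface integrals that are defined through volumes of cones.
  With \<open>\<gamma>\<close> the gauge of a convex cell at the apex \<open>c\<close>, the density of the surface integral times a normal
  component is the dimension times a partial derivative of \<open>\<gamma>\<close>, which exists almost everywhere by an averaging argument.
  The two cones over a common face are related by an affine map fixing the face, whose determinant
  is the ratio of their heights; hence the surface integrals over the face agree.\<close>

section \<open>Volume scaling of linear maps\<close>

text \<open>Two obstacles shape the boundary part. \<open>D\<close> is merely Borel, so the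
  remainder of the numerical flux on a face is a bounded Borel function, to which no divergence
  theorem applies; the transfer between the two cones is therefore proved for arbitrary Borel
  integrands. And a surface integral sees the boundary only through radial projections of points of
  the cell, so "almost everywhere on a face" has to mean almost everywhere in a cone, and null sets
  have to be carried between cones as well.

  On the outer boundary both traces are \<open>ev 0\<close>, where the flux is \<open>f k 0\<close>
  and not zero. The subtracted field is normalised to cancel it: \<open>f k 0 \<bullet> e\<close>
  for constants, \<open>psi k\<close> shifted by \<open>F k 0\<close> for the entropy. Such
  constants are free, since only jumps and derivatives of the field enter elsewhere.

  In time, the Legendre transform \<open>phi\<close> of the entropy integrates the volume term
  exactly; what is left at a time level is the gap between \<open>U\<close> and its tangent. The
  lower bound is Jensen's inequality about the mean of the final state, which conservation
  identifies with the initial mean.\<close>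

text \<open>Both integrands are coupled by the substitution \<open>y \<mapsto> x + y\<close>, so that each of the two translation
  invariances can be used once.\<close>

lemma lborel_translation_invariant_unique:
  fixes \<nu> :: "'a::euclidean_space measure"
  assumes sf: "sigma_finite_measure \<nu>" and sets: "sets \<nu> = sets borel"
    and inv: "\<And>a. distr \<nu> borel (\<lambda>x. x + a) = \<nu>"
    and f[measurable]: "f \<in> borel_measurable borel" and g[measurable]: "g \<in> borel_measurable borel"
  shows "(\<integral>\<^sup>+x. f x \<partial>\<nu>) * (\<integral>\<^sup>+x. g x \<partial>lborel) = (\<integral>\<^sup>+x. g x \<partial>\<nu>) * (\<integral>\<^sup>+x. f x \<partial>lborel)"
proof -
  interpret \<nu>: sigma_finite_measure \<nu> by (rule sf)
  interpret P: pair_sigma_finite lborel \<nu> ..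
  note sets[measurable_cong]
  have shift: "(\<integral>\<^sup>+x. h (x + a) \<partial>\<nu>) = (\<integral>\<^sup>+x. h x \<partial>\<nu>)" if [measurable]: "h \<in> borel_measurable borel" for h :: "'a \<Rightarrow> ennreal" and a
    by (subst (2) inv[of a, symmetric]) (simp add: nn_integral_distr)
  have lshift: "(\<integral>\<^sup>+x. h (a + x) \<partial>lborel) = (\<integral>\<^sup>+x. h x \<partial>lborel)" if [measurable]: "h \<in> borel_measurable borel" for h :: "'a \<Rightarrow> ennreal" and a
    by (subst (2) lborel_distr_plus[of a, symmetric]) (simp add: nn_integral_distr)
  have refl: "(\<integral>\<^sup>+y. f (x - y) \<partial>lborel) = (\<integral>\<^sup>+y. f y \<partial>lborel)" for x
    by (subst (2) lborel_affine[of "-1" x]) (auto simp: density_1 nn_integral_distr)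
  have "(\<integral>\<^sup>+x. f x \<partial>\<nu>) * (\<integral>\<^sup>+x. g x \<partial>lborel) = (\<integral>\<^sup>+x. (\<integral>\<^sup>+y. f x * g y \<partial>lborel) \<partial>\<nu>)"
    by (simp add: nn_integral_cmult nn_integral_multc)
  also have "\<dots> = (\<integral>\<^sup>+x. (\<integral>\<^sup>+y. f x * g (x + y) \<partial>lborel) \<partial>\<nu>)"
    by (simp add: nn_integral_cmult lshift)
  also have "\<dots> = (\<integral>\<^sup>+y. (\<integral>\<^sup>+x. f x * g (x + y) \<partial>\<nu>) \<partial>lborel)"
    by (rule P.Fubini') measurable
  also have "\<dots> = (\<integral>\<^sup>+y. (\<integral>\<^sup>+x. f (x - y) * g x \<partial>\<nu>) \<partial>lborel)"
  proof (rule nn_integral_cong)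
    fix y
    show "(\<integral>\<^sup>+x. f x * g (x + y) \<partial>\<nu>) = (\<integral>\<^sup>+x. f (x - y) * g x \<partial>\<nu>)"
      using shift[of "\<lambda>x. f (x - y) * g x" y] by simp
  qed
  also have "\<dots> = (\<integral>\<^sup>+x. (\<integral>\<^sup>+y. f (x - y) * g x \<partial>lborel) \<partial>\<nu>)"
    by (rule P.Fubini'[symmetric]) measurable
  also have "\<dots> = (\<integral>\<^sup>+x. g x \<partial>\<nu>) * (\<integral>\<^sup>+x. f x \<partial>lborel)"
    by (simp add: nn_integral_multc nn_integral_cmult refl) (simp only: mult.commute)
  finally show ?thesis .
qed

text \<open>This is the absolute value of the determinant. As a volume factor it is multiplicative
  for a reason that involves no matrices, and a factorisation into simple maps then computes
  it.\<close>

definition linear_scale :: "('a::euclidean_space \<Rightarrow> 'a) \<Rightarrow> real" where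
  "linear_scale L = measure lborel (L ` box 0 One)"

lemma linear_image_borel:
  fixes L :: "'a::euclidean_space \<Rightarrow> 'a"
  assumes "linear L" "inj L" and X: "X \<in> sets borel"
  shows "L ` X \<in> sets borel" "inv L \<in> borel \<rightarrow>\<^sub>M borel" "linear (inv L)" "L ` X = inv L -` X"
proof -
  have b: "bij L"
    using assms linear_injective_imp_surjective by (auto simp: bij_def)
  show l: "linear (inv L)"
    using assms linear_injective_isomorphism[OF assms(1,2)] by (metis inj_imp_inv_eq isomorphism_expand pointfree_idE)
  show m: "inv L \<in> borel \<rightarrow>\<^sub>M borel"
    using l by (intro borel_measurable_continuous_onI linear_continuous_on) (simp add: linear_conv_bounded_linear)
  show eq: "L ` X = inv L -` X"
    using b by (simp add: bij_vimage_eq_inv_image bij_imp_bij_inv inv_inv_eq)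
  show "L ` X \<in> sets borel"
    using measurable_sets[OF m X] unfolding eq by simp
qed

text \<open>The pushforward of Lebesgue measure under \<open>inv L\<close> assigns to a set the
  volume of its image under \<open>L\<close>. Linearity makes it translation invariant, hence a
  multiple of Lebesgue measure, and the unit box fixes the factor. The factor is positive because
  the image of the open box is open and nonempty.\<close>

lemma emeasure_linear_image:
  fixes L :: "'a::euclidean_space \<Rightarrow> 'a"
  assumes L: "linear L" "inj L" and X: "X \<in> sets borel"
  shows "emeasure lborel (L ` X) = ennreal (linear_scale L) * emeasure lborel X"
    and "linear_scale L > 0"
proof -
  note m[measurable] = linear_image_borel(2)[OF L X]
  let ?\<nu> = "distr lborel borel (inv L)"
  have b: "bij L"
    using L linear_injective_imp_surjective by (auto simp: bij_def)
  have em: "emeasure ?\<nu> Y = emeasure lborel (L ` Y)" if "Y \<in> sets borel" for Y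
    using that linear_image_borel(4)[OF L that] by (simp add: emeasure_distr)
  have bnd: "emeasure lborel (L ` box (-(real i *\<^sub>R One)) (real i *\<^sub>R One)) \<noteq> \<infinity>" for i
    using L by (intro emeasure_bounded_finite[THEN less_imp_neq] bounded_linear_image bounded_box) (simp add: linear_conv_bounded_linear)
  have sf: "sigma_finite_measure ?\<nu>"
  proof (standard, intro exI conjI)
    show "countable (range (\<lambda>i. box (-(real i *\<^sub>R One)) (real i *\<^sub>R One) :: 'a set))"
      by simp
    show "\<Union> (range (\<lambda>i. box (-(real i *\<^sub>R One)) (real i *\<^sub>R One) :: 'a set)) = space ?\<nu>"
      using UN_box_eq_UNIV by auto
  qed (use em bnd in auto)
  have inv: "distr ?\<nu> borel (\<lambda>x. x + a) = ?\<nu>" for a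
  proof -
    have "inv L x + a = inv L (L a + x)" for x
      using L b linear_image_borel(3)[OF L X] by (simp add: linear_add inv_f_f)
    then have "distr ?\<nu> borel (\<lambda>x. x + a) = distr (distr lborel borel ((+) (L a))) borel (inv L)"
      by (simp add: distr_distr o_def)
    also have "\<dots> = ?\<nu>"
      by (simp add: lborel_distr_plus)
    finally show ?thesis .
  qed
  have 1: "emeasure lborel (L ` X) * emeasure lborel (box 0 One :: 'a set) = emeasure lborel (L ` box 0 One) * emeasure lborel X"
    using lborel_translation_invariant_unique[OF sf _ inv, of "indicator X" "indicator (box 0 One)"] X
    by (simp add: em)
  have 2: "emeasure lborel (L ` box 0 One) = ennreal (linear_scale L)"
    unfolding linear_scale_def using L
    by (intro emeasure_eq_ennreal_measure emeasure_bounded_finite[THEN less_imp_neq, simplified] bounded_linear_image bounded_box) (simp_all add: linear_conv_bounded_linear)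
  have 3: "emeasure lborel (box 0 One :: 'a set) = 1"
    by (simp add: emeasure_lborel_box_eq)
  show "emeasure lborel (L ` X) = ennreal (linear_scale L) * emeasure lborel X"
    using 1 2 3 by simp
  have "open (L ` box 0 One)"
    using L bij_is_surj[OF b] by (intro open_surjective_linear_image open_box)
  moreover have "L ` box 0 One \<noteq> {}"
    by (simp add: box_eq_empty)
  ultimately have "emeasure lborel (L ` box 0 One) \<noteq> 0"
    using open_not_negligible[of "L ` box 0 One"] by (auto simp: negligible_iff_null_sets null_sets_def)
  then show "linear_scale L > 0"
    using 2 by (metis ennreal_eq_0_iff linorder_not_less)
qed

text \<open>The factor is common to all sets, so a single test set of positive finite volume
  identifies it. Isometries are tested on the ball, which they preserve, and the other maps on the
  box.\<close>

lemma linear_scale_eqI: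
  fixes L :: "'a::euclidean_space \<Rightarrow> 'a"
  assumes L: "linear L" "inj L" and X: "X \<in> sets borel" "emeasure lborel X \<noteq> 0" "emeasure lborel X \<noteq> \<infinity>"
    and eq: "emeasure lborel (L ` X) = ennreal k * emeasure lborel X" and k: "k \<ge> 0"
  shows "linear_scale L = k"
proof -
  have "ennreal (linear_scale L) * emeasure lborel X = ennreal k * emeasure lborel X"
    using emeasure_linear_image[OF L X(1)] eq by simp
  moreover obtain r where r: "emeasure lborel X = ennreal r" "r > 0"
    using X(2,3) by (cases "emeasure lborel X") (auto simp: less_le)
  ultimately have "ennreal (linear_scale L * r) = ennreal (k * r)"
    using k by (simp add: ennreal_mult'')
  then show ?thesis
    using emeasure_linear_image(2)[OF L X(1)] k r by simp
qed

lemma linear_scale_compose: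
  fixes L M :: "'a::euclidean_space \<Rightarrow> 'a"
  assumes L: "linear L" "inj L" and M: "linear M" "inj M"
  shows "linear_scale (L \<circ> M) = linear_scale L * linear_scale M"
proof (rule linear_scale_eqI)
  let ?X = "box 0 One :: 'a set"
  have X: "?X \<in> sets borel" by simp
  show "linear (L \<circ> M)" "inj (L \<circ> M)"
    using L M by (auto intro: linear_compose inj_compose)
  have "emeasure lborel (L ` (M ` ?X)) = ennreal (linear_scale L) * (ennreal (linear_scale M) * emeasure lborel ?X)"
    using emeasure_linear_image(1)[OF L linear_image_borel(1)[OF M X]] emeasure_linear_image(1)[OF M X] by simp
  then show "emeasure lborel ((L \<circ> M) ` ?X) = ennreal (linear_scale L * linear_scale M) * emeasure lborel ?X"
    using emeasure_linear_image(2)[OF L X] emeasure_linear_image(2)[OF M X]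
    by (simp add: image_comp ennreal_mult mult.assoc)
  show "linear_scale L * linear_scale M \<ge> 0"
    using emeasure_linear_image(2)[OF L X] emeasure_linear_image(2)[OF M X] by simp
qed (simp_all add: emeasure_lborel_box_eq)

lemma linear_scale_orthogonal:
  fixes L :: "'a::euclidean_space \<Rightarrow> 'a"
  assumes L: "orthogonal_transformation L"
  shows "linear_scale L = 1"
proof (rule linear_scale_eqI[where X = "ball 0 1"])
  show "linear L" "inj L"
    using L by (auto simp: orthogonal_transformation_linear orthogonal_transformation_inj)
  have "L ` ball 0 1 = ball 0 1"
    using image_orthogonal_transformation_ball[OF L, of 0 1] L by (simp add: orthogonal_transformation_linear linear_0)
  then show "emeasure lborel (L ` ball 0 1) = ennreal 1 * emeasure lborel (ball (0::'a) 1)" by simp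
  show "emeasure lborel (ball (0::'a) 1) \<noteq> 0"
    using open_not_negligible[of "ball (0::'a) 1"] by (auto simp: negligible_iff_null_sets null_sets_def)
  show "emeasure lborel (ball (0::'a) 1) \<noteq> \<infinity>"
    using emeasure_bounded_finite[of "ball (0::'a) 1"] by simp
qed simp_all

text \<open>The identity plus a rank one map, with determinant \<open>1 + w \<bullet> m\<close>. The
  linear part of \<open>face_map\<close> has this form, with \<open>m\<close> the normal of the
  face.\<close>

definition rank_one_map :: "'a::real_inner \<Rightarrow> 'a \<Rightarrow> 'a \<Rightarrow> 'a" where
  "rank_one_map m w y = y + (y \<bullet> m) *\<^sub>R w"

lemma linear_rank_one_map: "linear (rank_one_map m w)"
  by (rule linearI) (simp_all add: rank_one_map_def inner_simps algebra_simps)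

lemma rank_one_map_compose:
  "rank_one_map m w \<circ> rank_one_map m w' = rank_one_map m (w' + (1 + w' \<bullet> m) *\<^sub>R w)"
  by (rule ext) (simp add: rank_one_map_def inner_simps algebra_simps)

lemma inj_rank_one_map:
  fixes m :: "'a::euclidean_space"
  assumes "1 + w \<bullet> m \<noteq> 0"
  shows "inj (rank_one_map m w)"
proof (rule injI)
  fix x y assume eq: "rank_one_map m w x = rank_one_map m w y"
  then have "rank_one_map m w x \<bullet> m = rank_one_map m w y \<bullet> m" by simp
  then have "(x \<bullet> m) * (1 + w \<bullet> m) = (y \<bullet> m) * (1 + w \<bullet> m)"
    by (simp add: rank_one_map_def inner_simps algebra_simps)
  then have "x \<bullet> m = y \<bullet> m" using assms by simp
  then show "x = y" using eq by (simp add: rank_one_map_def)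
qed

text \<open>Conjugation by the reflection along \<open>m\<close> inverts a shear, so its scale equals its own inverse.\<close>

lemma linear_scale_shear:
  fixes m :: "'a::euclidean_space"
  assumes m: "norm m = 1" and w: "w \<bullet> m = 0"
  shows "linear_scale (rank_one_map m w) = 1"
proof -
  let ?R = "rank_one_map m (- 2 *\<^sub>R m)"
  have mm: "m \<bullet> m = 1" using m by (simp add: norm_eq_1)
  have lin: "linear (rank_one_map m u)" for u by (rule linear_rank_one_map)
  have RR: "?R \<circ> ?R = id"
    by (rule ext) (simp add: rank_one_map_def inner_simps mm algebra_simps)
  have "orthogonal_transformation ?R"
    unfolding orthogonal_transformation_def
    by (auto simp: lin rank_one_map_def inner_simps mm inner_commute algebra_simps)
  then have sR: "linear_scale ?R = 1" and iR: "inj ?R"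
    by (auto simp: linear_scale_orthogonal orthogonal_transformation_inj)
  have iw: "inj (rank_one_map m w)" "inj (rank_one_map m (-w))"
    using w by (auto intro!: inj_rank_one_map)
  have conj: "?R \<circ> (rank_one_map m w \<circ> ?R) = rank_one_map m (-w)"
    by (rule ext) (simp add: rank_one_map_def inner_simps mm w algebra_simps)
  have 1: "linear_scale (rank_one_map m (-w)) = linear_scale (rank_one_map m w)"
    unfolding conj[symmetric] using iw iR
    by (simp add: linear_scale_compose lin sR linear_compose inj_compose del: scaleR_minus_left)
  have "rank_one_map m w \<circ> rank_one_map m (-w) = id"
    unfolding rank_one_map_compose using w by (auto simp: rank_one_map_def)
  then have "linear_scale (rank_one_map m w) * linear_scale (rank_one_map m (-w)) = linear_scale (id :: 'a \<Rightarrow> 'a)"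
    using linear_scale_compose[OF lin iw(1) lin iw(2)] by simp
  also have "\<dots> = 1"
    by (rule linear_scale_orthogonal) (simp add: orthogonal_transformation_def linear_id)
  finally have "(linear_scale (rank_one_map m w))\<^sup>2 = 1"
    using 1 by (simp add: power2_eq_square)
  then show ?thesis
    using emeasure_linear_image(2)[OF lin iw(1), of "{}"] by (simp add: power2_eq_1_iff)
qed

text \<open>An orthogonal map takes a coordinate axis to \<open>m\<close>, and conjugation by it
  leaves the scale unchanged; what remains is a stretch of one coordinate.\<close>

lemma linear_scale_stretch:
  fixes m :: "real^'d"
  assumes m: "norm m = 1" and a: "1 + a \<noteq> 0"
  shows "linear_scale (rank_one_map m (a *\<^sub>R m)) = \<bar>1 + a\<bar>"
proof -
  \<comment> \<open>Any coordinate serves; index types are nonempty, so \<open>undefined\<close>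
    names one.\<close>
  define k :: 'd where "k = undefined"
  have mm: "m \<bullet> m = 1" using m by (simp add: norm_eq_1)
  obtain B where B: "orthogonal_transformation B" "B (axis k (1::real)) = m"
    by (rule orthogonal_transformation_exists_1[OF norm_axis_1[of k] m])
  let ?S = "rank_one_map (axis k 1) (a *\<^sub>R axis k (1::real))"
  have lin: "linear (rank_one_map u v)" for u v :: "real^'d" by (rule linear_rank_one_map)
  have iB: "inj B" and lB: "linear B" and sB: "linear_scale B = 1"
    using B by (auto simp: linear_scale_orthogonal orthogonal_transformation_inj orthogonal_transformation_linear)
  have inj: "inj ?S" "inj (rank_one_map m (a *\<^sub>R m))"
    using a by (auto intro!: inj_rank_one_map simp: mm inner_axis_axis)
  have conj: "rank_one_map m (a *\<^sub>R m) \<circ> B = B \<circ> ?S"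
  proof (rule ext)
    fix y
    have "B y \<bullet> m = y \<bullet> axis k 1"
      using B by (metis orthogonal_transformation_def)
    then show "(rank_one_map m (a *\<^sub>R m) \<circ> B) y = (B \<circ> ?S) y"
      using B lB by (simp add: rank_one_map_def linear_add linear_cmul)
  qed
  have "linear_scale (rank_one_map m (a *\<^sub>R m)) = linear_scale ?S"
    using linear_scale_compose[OF lin inj(2) lB iB] linear_scale_compose[OF lB iB lin inj(1)] conj sB by simp
  also have "\<dots> = \<bar>1 + a\<bar>"
  proof (rule linear_scale_eqI[OF lin inj(1), where X = "box 0 One"])
    have "?S = (\<lambda>x. \<chi> j. (if j = k then 1 + a else 1) * x $ j)"
      by (simp add: rank_one_map_def fun_eq_iff vec_eq_iff inner_axis) (auto simp: axis_def algebra_simps)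
    then have "measure lebesgue (?S ` box 0 One) = \<bar>\<Prod>j\<in>UNIV. if j = k then 1 + a else 1\<bar> * measure lebesgue (box 0 One :: (real^'d) set)"
      by (simp add: measure_stretch)
    then have 1: "measure lborel (?S ` box 0 One) = \<bar>1 + a\<bar>"
      using linear_image_borel(1)[OF lin inj(1)] by (simp add: measure_lborel_box_eq)
    have "emeasure lborel (?S ` box 0 One) < \<infinity>"
      using lin by (intro emeasure_bounded_finite bounded_linear_image bounded_box) (simp add: linear_conv_bounded_linear)
    then have "emeasure lborel (?S ` box 0 One) = ennreal (measure lborel (?S ` box 0 One))"
      by (intro emeasure_eq_ennreal_measure) auto
    then show "emeasure lborel (?S ` box 0 One) = ennreal \<bar>1 + a\<bar> * emeasure lborel (box 0 One :: (real^'d) set)"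
      using 1 by (simp add: emeasure_lborel_box_eq)
  qed (simp_all add: emeasure_lborel_box_eq)
  finally show ?thesis .
qed

text \<open>Stretch along \<open>m\<close> by the normal part of \<open>w\<close>, then shear by the
  tangential part. The shear meets \<open>y \<bullet> m\<close> after the stretch has multiplied it
  by \<open>1 + w \<bullet> m\<close>, hence the quotient in \<open>?w\<close>.\<close>

lemma linear_scale_rank_one_map:
  fixes m :: "real^'d"
  assumes m: "norm m = 1" and w: "1 + w \<bullet> m \<noteq> 0"
  shows "linear_scale (rank_one_map m w) = \<bar>1 + w \<bullet> m\<bar>"
proof -
  let ?a = "w \<bullet> m"
  let ?w = "(1 / (1 + ?a)) *\<^sub>R (w - ?a *\<^sub>R m)"
  have mm: "m \<bullet> m = 1" using m by (simp add: norm_eq_1)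
  have w0: "?w \<bullet> m = 0" by (simp add: inner_simps mm)
  have "rank_one_map m w = rank_one_map m ?w \<circ> rank_one_map m (?a *\<^sub>R m)"
    unfolding rank_one_map_compose using w by (simp add: mm)
  then show ?thesis
    using linear_scale_compose[OF linear_rank_one_map inj_rank_one_map linear_rank_one_map inj_rank_one_map, of ?w m "?a *\<^sub>R m" m] w w0 mm
      linear_scale_shear[OF m w0] linear_scale_stretch[OF m w]
    by simp
qed

lemma lborel_integral_affine_image:
  fixes L :: "'a::euclidean_space \<Rightarrow> 'a" and h :: "'a \<Rightarrow> real"
  assumes L: "linear L" "inj L" and h[measurable]: "h \<in> borel_measurable borel"
  shows "(LINT x|lborel. h x) = linear_scale L * (LINT x|lborel. h (a + L x))"
proof -
  have [measurable]: "L \<in> borel \<rightarrow>\<^sub>M borel"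
    using L(1) by (intro borel_measurable_continuous_onI linear_continuous_on) (simp add: linear_conv_bounded_linear)
  have pos: "linear_scale L > 0"
    using emeasure_linear_image(2)[OF L, of "{}"] by simp
  have b: "bij L"
    using L linear_injective_imp_surjective by (auto simp: bij_def)
  have d: "lborel = density (distr lborel borel L) (\<lambda>_. ennreal (linear_scale L))"
  proof (rule lborel_eqI)
    fix l u :: 'a assume le: "\<And>b. b \<in> Basis \<Longrightarrow> l \<bullet> b \<le> u \<bullet> b"
    have "L ` (L -` box l u) = box l u"
      using b by (simp add: bij_is_surj surj_image_vimage_eq)
    then have "emeasure lborel (box l u) = ennreal (linear_scale L) * emeasure lborel (L -` box l u)"
      using emeasure_linear_image(1)[OF L, of "L -` box l u"] measurable_sets[of L borel borel "box l u"] by simp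
    then show "emeasure (density (distr lborel borel L) (\<lambda>_. ennreal (linear_scale L))) (box l u) = (\<Prod>b\<in>Basis. (u - l) \<bullet> b)"
      using le by (simp add: emeasure_density_const emeasure_distr emeasure_lborel_box_eq)
  qed simp
  have "(LINT x|lborel. h x) = (LINT x|lborel. h (a + x))"
    by (subst lborel_distr_plus[of a, symmetric]) (simp add: integral_distr)
  also have "\<dots> = linear_scale L * (LINT x|lborel. h (a + L x))"
    by (subst d) (use pos in \<open>simp add: integral_density integral_distr\<close>)
  finally show ?thesis .
qed

section \<open>The gauge of a convex body\<close>

lemma lborel_integral_shift:
  fixes h :: "'a::euclidean_space \<Rightarrow> real"
  assumes [measurable]: "h \<in> borel_measurable borel"
  shows "(LINT x|lborel. h (x + a)) = (LINT x|lborel. h x)"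
  by (subst (2) lborel_distr_plus[of a, symmetric]) (simp add: integral_distr add.commute)

lemma integrable_bounded_support:
  fixes h :: "'a::euclidean_space \<Rightarrow> real"
  assumes "h \<in> borel_measurable borel" "bounded S"
    and "\<And>x. x \<in> S \<Longrightarrow> \<bar>h x\<bar> \<le> B" and "\<And>x. x \<notin> S \<Longrightarrow> h x = 0"
  shows "integrable lborel h"
proof -
  obtain R where R: "S \<subseteq> ball 0 R"
    using bounded_subset_ballD[OF assms(2)] by blast
  show ?thesis
  proof (rule integrableI_bounded_set[where A = "ball 0 R" and B = "max 0 B"])
    show "emeasure lborel (ball 0 R :: 'a set) < \<infinity>"
      using emeasure_bounded_finite[of "ball (0::'a) R"] by simp
    have "norm (h x) \<le> max 0 B" for x
      using assms(3,4)[of x] by (cases "x \<in> S") auto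
    then show "AE x in lborel. x \<in> ball 0 R \<longrightarrow> norm (h x) \<le> max 0 B" by simp
    show "AE x in lborel. x \<notin> ball 0 R \<longrightarrow> h x = 0"
    proof (rule AE_I2, rule impI)
      fix x :: 'a assume "x \<notin> ball 0 R"
      then show "h x = 0" using R assms(4)[of x] by blast
    qed
  qed (use assms in auto)
qed

lemma integrable_continuous_bounded_support:
  fixes h :: "'a::euclidean_space \<Rightarrow> real"
  assumes "continuous_on UNIV h" "bounded S" and "\<And>x. x \<notin> S \<Longrightarrow> h x = 0"
  shows "integrable lborel h"
proof -
  have "compact (h ` closure S)"
    using assms by (intro compact_continuous_image) (auto intro: continuous_on_subset simp: compact_closure)
  then obtain B where "\<And>y. y \<in> h ` closure S \<Longrightarrow> norm y \<le> B"
    using compact_imp_bounded bounded_iff by metis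
  then show ?thesis
    using assms closure_subset[of S]
    by (intro integrable_bounded_support[of h S B] borel_measurable_continuous_onI) auto
qed

section \<open>Supporting hyperplanes and smooth boundary points\<close>

definition supporting_normal :: "'a::euclidean_space set \<Rightarrow> 'a \<Rightarrow> 'a \<Rightarrow> bool" where
  "supporting_normal K x n \<longleftrightarrow> norm n = 1 \<and> (\<forall>y\<in>K. (y - x) \<bullet> n \<le> 0)"

definition smooth_at :: "'a::euclidean_space set \<Rightarrow> 'a \<Rightarrow> bool" where
  "smooth_at K x \<longleftrightarrow> (\<exists>!n. supporting_normal K x n)"

lemma outward_normal_supporting:
  "smooth_at K x \<Longrightarrow> supporting_normal K x (outward_normal K x)"
  using theI'[of "supporting_normal K x"]
  unfolding smooth_at_def outward_normal_def supporting_normal_def by simp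

lemma outward_normal_eqI:
  "smooth_at K x \<Longrightarrow> supporting_normal K x n \<Longrightarrow> outward_normal K x = n"
  using outward_normal_supporting unfolding smooth_at_def by blast

lemma outward_normal_not_smooth:
  "\<not> smooth_at K x \<Longrightarrow> outward_normal K x = 0"
  unfolding smooth_at_def outward_normal_def supporting_normal_def by simp

lemma supporting_normal_exists:
  fixes K :: "'a::euclidean_space set"
  assumes "convex K" "x \<in> frontier K"
  obtains n where "supporting_normal K x n"
proof -
  have "\<exists>a. a \<noteq> 0 \<and> (\<forall>y\<in>closure K. a \<bullet> x \<le> a \<bullet> y)"
  proof (cases "x \<in> rel_interior K")
    case False
    have "x \<in> closure K" using assms(2) by (simp add: frontier_def)
    from supporting_hyperplane_relative_frontier[OF assms(1) this False]
    show ?thesis by metis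
  next
    \<comment> \<open>A frontier point in the relative interior forces the interior to be empty.
      \<open>K\<close> then lies in a hyperplane, whose normal supports \<open>K\<close> at each of
      its points.\<close>
    case True
    then have "interior K = {}"
      using assms(2) rel_interior_nonempty_interior[of K] by (auto simp: frontier_def)
    then obtain a b where a: "a \<noteq> 0" "K \<subseteq> {x. a \<bullet> x = b}"
      using empty_interior_subset_hyperplane[OF assms(1)] by metis
    then have "closure K \<subseteq> {x. a \<bullet> x = b}"
      by (intro closure_minimal) (auto simp: closed_hyperplane)
    moreover have "x \<in> closure K" using assms(2) by (simp add: frontier_def)
    ultimately have "\<forall>y\<in>closure K. a \<bullet> x \<le> a \<bullet> y"
      by (metis (mono_tags, lifting) mem_Collect_eq order_refl subsetD)
    then show ?thesis using a by blast
  qed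
  then obtain a where a: "a \<noteq> 0" "\<And>y. y \<in> closure K \<Longrightarrow> a \<bullet> x \<le> a \<bullet> y" by blast
  have "supporting_normal K x (- (1 / norm a) *\<^sub>R a)"
    unfolding supporting_normal_def
    using a closure_subset[of K] by (auto simp: inner_simps inner_commute divide_simps)
  then show ?thesis by (rule that)
qed

section \<open>Gauge, polar body and radial projection about an interior apex\<close>

locale convex_body =
  fixes K :: "'a::euclidean_space set" and c :: 'a
  assumes convex: "convex K" and bounded: "bounded K" and center: "c \<in> interior K"
begin

definition inradius :: real where
  "inradius = (SOME r. r > 0 \<and> cball c r \<subseteq> K)"

lemma inradius: "inradius > 0" "cball c inradius \<subseteq> K"
proof -
  have "\<exists>r. r > 0 \<and> cball c r \<subseteq> K"
    using center by (simp add: mem_interior_cball)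
  then show "inradius > 0" "cball c inradius \<subseteq> K"
    unfolding inradius_def by (metis (mono_tags, lifting) someI_ex)+
qed

definition polar :: "'a set" where
  "polar = {m. \<forall>z\<in>K. (z - c) \<bullet> m \<le> 1}"

text \<open>The Minkowski gauge of \<open>closure K\<close> about \<open>c\<close>, written as the
  support function of the polar body. As a supremum of affine functions it is convex at once, and
  the bound \<open>1 / inradius\<close> on \<open>polar\<close> becomes its Lipschitz
  constant.\<close>

definition gauge_fun :: "'a \<Rightarrow> real" where
  "gauge_fun x = (SUP m\<in>polar. (x - c) \<bullet> m)"

lemma zero_polar: "0 \<in> polar" by (simp add: polar_def)

text \<open>The inscribed ball contains the point at distance \<open>inradius\<close> from
  \<open>c\<close> in the direction of \<open>m\<close>; there the defining inequality of
  \<open>polar\<close> is the bound.\<close>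

lemma norm_polar: "m \<in> polar \<Longrightarrow> norm m \<le> 1 / inradius"
proof (cases "m = 0")
  case True then show ?thesis using inradius by simp
next
  case False
  assume m: "m \<in> polar"
  have "c + (inradius / norm m) *\<^sub>R m \<in> K"
    using inradius False by (intro subsetD[OF inradius(2)]) (auto simp: dist_norm)
  then have "inradius / norm m * (m \<bullet> m) \<le> 1"
    using m by (auto simp: polar_def inner_simps)
  then have "inradius * norm m \<le> 1"
    using False by (simp add: power2_norm_eq_inner[symmetric] power2_eq_square)
  then show ?thesis using inradius by (simp add: field_simps)
qed

lemma gauge_bdd: "bdd_above ((\<lambda>m. (x - c) \<bullet> m) ` polar)"
proof (rule bdd_aboveI2)
  fix m assume "m \<in> polar"
  then show "(x - c) \<bullet> m \<le> norm (x - c) * (1 / inradius)"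
    using norm_polar[of m] norm_cauchy_schwarz[of "x - c" m]
    by (meson mult_left_mono norm_ge_zero order_trans)
qed

lemma gauge_ge: "m \<in> polar \<Longrightarrow> (x - c) \<bullet> m \<le> gauge_fun x"
  unfolding gauge_fun_def by (rule cSUP_upper) (auto intro: gauge_bdd)

lemma gauge_le: "(\<And>m. m \<in> polar \<Longrightarrow> (x - c) \<bullet> m \<le> b) \<Longrightarrow> gauge_fun x \<le> b"
  unfolding gauge_fun_def using zero_polar by (intro cSUP_least) auto

lemma gauge_nonneg: "gauge_fun x \<ge> 0"
  using gauge_ge[OF zero_polar, of x] by simp

lemma gauge_lipschitz: "gauge_fun x \<le> gauge_fun y + norm (x - y) / inradius"
proof (rule gauge_le)
  fix m assume m: "m \<in> polar"
  have "(x - y) \<bullet> m \<le> norm (x - y) * (1 / inradius)"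
    using norm_polar[OF m] norm_cauchy_schwarz[of "x - y" m]
    by (meson mult_left_mono norm_ge_zero order_trans)
  then show "(x - c) \<bullet> m \<le> gauge_fun y + norm (x - y) / inradius"
    using gauge_ge[OF m, of y] by (simp add: inner_simps)
qed

lemma gauge_lipschitz_abs: "\<bar>gauge_fun x - gauge_fun y\<bar> \<le> norm (x - y) / inradius"
  using gauge_lipschitz[of x y] gauge_lipschitz[of y x] by (simp add: norm_minus_commute abs_le_iff)

lemma gauge_continuous: "continuous_on S gauge_fun"
proof -
  have "(1 / inradius)-lipschitz_on UNIV gauge_fun"
    using inradius gauge_lipschitz_abs by (intro lipschitz_onI) (auto simp: dist_norm)
  then show ?thesis
    using lipschitz_on_continuous_on continuous_on_subset by blast
qed

lemma gauge_measurable [measurable]: "gauge_fun \<in> borel_measurable borel"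
  by (intro borel_measurable_continuous_onI gauge_continuous)

lemma gauge_center [simp]: "gauge_fun c = 0"
  using gauge_le[of c 0] gauge_nonneg[of c] by simp

lemma gauge_scale_le: "s \<ge> 0 \<Longrightarrow> gauge_fun (c + s *\<^sub>R (x - c)) \<le> s * gauge_fun x"
  by (rule gauge_le) (simp add: gauge_ge mult_left_mono)

lemma gauge_scale:
  assumes "s \<ge> 0"
  shows "gauge_fun (c + s *\<^sub>R (x - c)) = s * gauge_fun x"
proof (cases "s = 0")
  case False
  with assms have s: "s > 0" by simp
  have "gauge_fun (c + (1 / s) *\<^sub>R (c + s *\<^sub>R (x - c) - c)) \<le> (1 / s) * gauge_fun (c + s *\<^sub>R (x - c))"
    using s by (intro gauge_scale_le) simp
  then have "s * gauge_fun x \<le> gauge_fun (c + s *\<^sub>R (x - c))"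
    using s by (simp add: field_simps)
  then show ?thesis
    using gauge_scale_le[OF assms, of x] by simp
qed simp

lemma gauge_convex:
  assumes "0 \<le> u" "u \<le> 1"
  shows "gauge_fun ((1 - u) *\<^sub>R x + u *\<^sub>R y) \<le> (1 - u) * gauge_fun x + u * gauge_fun y"
proof (rule gauge_le)
  fix m assume m: "m \<in> polar"
  have "(1 - u) *\<^sub>R x + u *\<^sub>R y - c = (1 - u) *\<^sub>R (x - c) + u *\<^sub>R (y - c)"
    by (simp add: algebra_simps)
  then have "((1 - u) *\<^sub>R x + u *\<^sub>R y - c) \<bullet> m = (1 - u) * ((x - c) \<bullet> m) + u * ((y - c) \<bullet> m)"
    by (simp only: inner_add_left inner_scaleR_left)
  also have "\<dots> \<le> (1 - u) * gauge_fun x + u * gauge_fun y"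
    using assms gauge_ge[OF m] by (intro add_mono mult_left_mono) auto
  finally show "((1 - u) *\<^sub>R x + u *\<^sub>R y - c) \<bullet> m \<le> (1 - u) * gauge_fun x + u * gauge_fun y" .
qed

lemma polar_closure: "m \<in> polar \<Longrightarrow> z \<in> closure K \<Longrightarrow> (z - c) \<bullet> m \<le> 1"
proof -
  assume m: "m \<in> polar" and z: "z \<in> closure K"
  have "closed {z. (z - c) \<bullet> m \<le> 1}"
    by (intro closed_Collect_le continuous_intros)
  then have "closure K \<subseteq> {z. (z - c) \<bullet> m \<le> 1}"
    using m by (intro closure_minimal) (auto simp: polar_def)
  then show ?thesis using z by blast
qed

text \<open>The bipolar theorem: a hyperplane separates an outer point from the closure, and its
  normal, scaled so that the hyperplane has level \<open>1\<close> as seen from \<open>c\<close>,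
  belongs to \<open>polar\<close>. The separating vector \<open>a\<close> points inwards, so the
  divisor \<open>b - a \<bullet> c\<close> is negative and turns it outwards.\<close>

lemma closure_iff_gauge: "x \<in> closure K \<longleftrightarrow> gauge_fun x \<le> 1"
proof
  assume "x \<in> closure K"
  then show "gauge_fun x \<le> 1" by (intro gauge_le polar_closure)
next
  assume g: "gauge_fun x \<le> 1"
  show "x \<in> closure K"
  proof (rule ccontr)
    assume "x \<notin> closure K"
    then obtain a b where ab: "a \<bullet> x < b" "\<And>z. z \<in> closure K \<Longrightarrow> a \<bullet> z > b"
      using separating_hyperplane_closed_point[of "closure K" x] convex by (auto simp: convex_closure)
    have "c \<in> closure K" using center interior_subset closure_subset by blast
    then have b: "a \<bullet> c > b" using ab by blast
    define m where "m = (1 / (b - a \<bullet> c)) *\<^sub>R a"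
    have "m \<in> polar"
      unfolding polar_def
    proof (intro CollectI ballI)
      fix z assume "z \<in> K"
      then have "a \<bullet> z > b" using ab closure_subset by blast
      then show "(z - c) \<bullet> m \<le> 1"
        using b unfolding m_def by (simp add: inner_simps inner_commute divide_simps)
    qed
    then have "(x - c) \<bullet> m \<le> 1" using gauge_ge[of m x] g by simp
    then show False
      using ab(1) b unfolding m_def by (simp add: inner_simps inner_commute divide_simps split: if_splits)
  qed
qed

text \<open>The set where the gauge is below \<open>1\<close> is open and lies in the closure, and
  convexity equates the interiors of \<open>closure K\<close> and \<open>K\<close>. Conversely an
  interior point can be moved away from \<open>c\<close> by a factor \<open>1 + s\<close> without
  leaving \<open>K\<close>, and homogeneity turns this into strict inequality.\<close>

lemma interior_iff_gauge: "x \<in> interior K \<longleftrightarrow> gauge_fun x < 1"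
proof
  assume "gauge_fun x < 1"
  moreover have "open {x. gauge_fun x < 1}"
    by (intro open_Collect_less gauge_continuous continuous_intros)
  moreover have "{x. gauge_fun x < 1} \<subseteq> closure K"
    by (auto simp: closure_iff_gauge)
  ultimately have "x \<in> interior (closure K)"
    by (intro interiorI[of "{x. gauge_fun x < 1}"]) auto
  then show "x \<in> interior K" by (simp add: convex_interior_closure convex)
next
  assume x: "x \<in> interior K"
  then obtain r where r: "r > 0" "cball x r \<subseteq> K" by (auto simp: mem_interior_cball)
  define s where "s = r / (norm (x - c) + 1)"
  have s: "s > 0" using r by (simp add: s_def add_nonneg_pos)
  have "norm (s *\<^sub>R (x - c)) \<le> r"
    using r by (simp add: s_def divide_simps add_nonneg_pos)
  then have "x + s *\<^sub>R (x - c) \<in> cball x r"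
    by (simp add: dist_norm)
  then have "x + s *\<^sub>R (x - c) \<in> closure K"
    using r closure_subset by blast
  moreover have "x + s *\<^sub>R (x - c) = c + (1 + s) *\<^sub>R (x - c)"
    by (simp add: algebra_simps)
  ultimately have "(1 + s) * gauge_fun x \<le> 1"
    using closure_iff_gauge gauge_scale[of "1 + s" x] s by simp
  moreover have "(1 + s) * gauge_fun x \<ge> (1 + s) * 1" if "gauge_fun x \<ge> 1"
    using that s by (intro mult_left_mono) auto
  ultimately show "gauge_fun x < 1"
    using s by (smt (verit))
qed

lemma frontier_iff_gauge: "x \<in> frontier K \<longleftrightarrow> gauge_fun x = 1"
  by (auto simp: frontier_def closure_iff_gauge interior_iff_gauge)

text \<open>If the gauge vanished at \<open>x\<close>, homogeneity would put the whole ray from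
  \<open>c\<close> through \<open>x\<close> into the bounded closure.\<close>

lemma gauge_pos:
  assumes "x \<noteq> c" shows "gauge_fun x > 0"
proof (rule ccontr)
  assume "\<not> gauge_fun x > 0"
  then have g: "gauge_fun x = 0" using gauge_nonneg[of x] by simp
  obtain B where B: "B > 0" "\<And>z. z \<in> closure K \<Longrightarrow> norm z \<le> B"
    using bounded_closure[OF bounded] bounded_pos by metis
  define s where "s = (B + norm c + 1) / norm (x - c)"
  have s: "s \<ge> 0" "s * norm (x - c) = B + norm c + 1" using B assms by (auto simp: s_def)
  have "c + s *\<^sub>R (x - c) \<in> closure K"
    using closure_iff_gauge gauge_scale[OF s(1), of x] g by simp
  then have "norm (c + s *\<^sub>R (x - c)) \<le> B" by (rule B)
  then have "norm (s *\<^sub>R (x - c)) \<le> B + norm c"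
    by (smt (verit) norm_diff_ineq add.commute)
  then show False using s by simp
qed

lemma radial_projection_eq:
  assumes "x \<noteq> c"
  shows "radial_projection K c x = c + (1 / gauge_fun x) *\<^sub>R (x - c)"
  unfolding radial_projection_def
proof (rule the_equality)
  have g: "gauge_fun x > 0" by (rule gauge_pos[OF assms])
  show "c + (1 / gauge_fun x) *\<^sub>R (x - c) \<in> frontier K \<and> (\<exists>s\<ge>0. c + (1 / gauge_fun x) *\<^sub>R (x - c) = c + s *\<^sub>R (x - c))"
    using g gauge_scale[of "1 / gauge_fun x" x] by (auto simp: frontier_iff_gauge intro!: exI[of _ "1 / gauge_fun x"])
  fix y assume y: "y \<in> frontier K \<and> (\<exists>s\<ge>0. y = c + s *\<^sub>R (x - c))"
  then obtain s where s: "s \<ge> 0" "y = c + s *\<^sub>R (x - c)" by blast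
  then have "s * gauge_fun x = 1" using y gauge_scale[OF s(1), of x] by (simp add: frontier_iff_gauge)
  then have "s = 1 / gauge_fun x" using g by (simp add: field_simps)
  then show "y = c + (1 / gauge_fun x) *\<^sub>R (x - c)" using s by simp
qed

lemma radial_projection_frontier: "x \<noteq> c \<Longrightarrow> radial_projection K c x \<in> frontier K"
  using gauge_pos[of x] gauge_scale[of "1 / gauge_fun x" x] by (simp add: radial_projection_eq frontier_iff_gauge)

lemma supporting_normal_ge_inradius:
  assumes "supporting_normal K y n"
  shows "(y - c) \<bullet> n \<ge> inradius"
proof -
  have n: "norm n = 1" using assms by (simp add: supporting_normal_def)
  then have "c + inradius *\<^sub>R n \<in> K"
    using inradius by (intro subsetD[OF inradius(2)]) (auto simp: dist_norm)
  then have "(c + inradius *\<^sub>R n - y) \<bullet> n \<le> 0" using assms by (simp add: supporting_normal_def)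
  then show ?thesis using n by (simp add: inner_simps norm_eq_1)
qed

text \<open>A supporting normal divided by its height \<open>(y - c) \<bullet> n\<close> belongs to
  \<open>polar\<close>. Since the inequality is an equality on the ray through \<open>y\<close>
  (\<open>supporting_normal_gauge_eq\<close>), the quotient is a subgradient of the gauge along that
  ray.\<close>

lemma supporting_normal_gauge_le:
  assumes n: "supporting_normal K y n"
  shows "(z - c) \<bullet> n \<le> gauge_fun z * ((y - c) \<bullet> n)"
proof -
  have pos: "(y - c) \<bullet> n > 0" using supporting_normal_ge_inradius[OF n] inradius by simp
  have "(1 / ((y - c) \<bullet> n)) *\<^sub>R n \<in> polar"
    unfolding polar_def
  proof (intro CollectI ballI)
    fix z assume "z \<in> K"
    then have "(z - y) \<bullet> n \<le> 0" using n by (simp add: supporting_normal_def)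
    then have "(z - c) \<bullet> n \<le> (y - c) \<bullet> n" by (simp add: inner_simps)
    then show "(z - c) \<bullet> ((1 / ((y - c) \<bullet> n)) *\<^sub>R n) \<le> 1" using pos by simp
  qed
  from gauge_ge[OF this, of z] show ?thesis using pos by (simp add: divide_simps)
qed

lemma supporting_normal_gauge_eq:
  assumes "x \<noteq> c"
  shows "(x - c) \<bullet> n = gauge_fun x * ((radial_projection K c x - c) \<bullet> n)"
  using gauge_pos[OF assms] by (simp add: radial_projection_eq[OF assms])

section \<open>One-sided derivatives of the gauge and uniqueness of normals\<close>

definition quotient :: "'a \<Rightarrow> 'a \<Rightarrow> real \<Rightarrow> real" where
  "quotient e x s = (gauge_fun (x + s *\<^sub>R e) - gauge_fun x) / s"

text \<open>The one-sided derivative. Convexity makes the quotients decrease as \<open>s\<close>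
  decreases, so the infimum is the limit and exists at every point.\<close>

definition dir_deriv :: "'a \<Rightarrow> 'a \<Rightarrow> real" where
  "dir_deriv e x = (INF s\<in>{0<..}. quotient e x s)"

lemma quotient_abs: "\<bar>quotient e x s\<bar> \<le> norm e / inradius"
proof (cases "s = 0")
  case False
  then show ?thesis
    using gauge_lipschitz_abs[of "x + s *\<^sub>R e" x] inradius
    by (simp add: quotient_def abs_divide divide_simps) (simp add: mult.commute)
qed (use inradius in \<open>simp add: quotient_def\<close>)

lemma quotient_mono:
  assumes "0 < s" "s \<le> s'"
  shows "quotient e x s \<le> quotient e x s'"
proof -
  have eq: "(1 - s / s') *\<^sub>R x + (s / s') *\<^sub>R (x + s' *\<^sub>R e) = x + s *\<^sub>R e"
    using assms by (simp add: algebra_simps)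
  have "gauge_fun (x + s *\<^sub>R e) \<le> (1 - s / s') * gauge_fun x + (s / s') * gauge_fun (x + s' *\<^sub>R e)"
    using gauge_convex[of "s / s'" x "x + s' *\<^sub>R e"] assms unfolding eq by simp
  then have "gauge_fun (x + s *\<^sub>R e) - gauge_fun x \<le> (s / s') * (gauge_fun (x + s' *\<^sub>R e) - gauge_fun x)"
    by (simp add: algebra_simps)
  then show ?thesis using assms by (simp add: quotient_def field_simps)
qed

lemma quotient_bdd: "bdd_below (quotient e x ` {0<..})"
  using quotient_abs[of e x] by (intro bdd_belowI2[where m = "- (norm e / inradius)"]) (auto simp: abs_le_iff minus_le_iff)

lemma dir_deriv_le: "s > 0 \<Longrightarrow> dir_deriv e x \<le> quotient e x s"
  unfolding dir_deriv_def by (rule cINF_lower[OF quotient_bdd]) simp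

lemma dir_deriv_ge: "(\<And>s. s > 0 \<Longrightarrow> b \<le> quotient e x s) \<Longrightarrow> b \<le> dir_deriv e x"
  unfolding dir_deriv_def by (intro cINF_greatest) auto

lemma dir_deriv_abs: "\<bar>dir_deriv e x\<bar> \<le> norm e / inradius"
  using dir_deriv_le[of 1 e x] dir_deriv_ge[of "- (norm e / inradius)" e x] quotient_abs[of e x]
  by (smt (verit))

lemma quotient_tendsto: "(quotient e x \<longlongrightarrow> dir_deriv e x) (at_right 0)"
proof (rule order_tendstoI)
  fix a assume "a < dir_deriv e x"
  then show "\<forall>\<^sub>F s in at_right 0. a < quotient e x s"
    using dir_deriv_le[of _ e x] by (force simp: eventually_at_right_field intro!: exI[of _ 1])
next
  fix a assume a: "dir_deriv e x < a"
  obtain s where s: "s > 0" "quotient e x s < a"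
    using a unfolding dir_deriv_def by (subst (asm) cINF_less_iff[OF _ quotient_bdd]) auto
  then have "\<forall>y>0. y < s \<longrightarrow> quotient e x y < a"
    using quotient_mono[of _ s e x] by force
  then show "\<forall>\<^sub>F s in at_right 0. quotient e x s < a"
    using s(1) by (auto simp: eventually_at_right_field)
qed

lemma inverse_Suc_at_right: "filterlim (\<lambda>j. inverse (real (Suc j))) (at_right 0) sequentially"
  using LIMSEQ_inverse_real_of_nat by (auto simp: filterlim_at intro!: always_eventually)

lemma quotient_LIMSEQ: "(\<lambda>j. quotient e x (inverse (real (Suc j)))) \<longlonglongrightarrow> dir_deriv e x"
  by (rule filterlim_compose[OF quotient_tendsto inverse_Suc_at_right])

lemma quotient_measurable [measurable]: "(\<lambda>x. quotient e x s) \<in> borel_measurable borel"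
  unfolding quotient_def by measurable

lemma dir_deriv_measurable [measurable]: "dir_deriv e \<in> borel_measurable borel"
  by (rule borel_measurable_LIMSEQ_real[OF quotient_LIMSEQ]) measurable

text \<open>The gauge is homogeneous of degree one about \<open>c\<close>, so its derivatives are
  constant on rays. This is what makes the shell integrals of \<open>divergence_gauge\<close>
  explicit.\<close>

lemma dir_deriv_scale:
  assumes "r > 0"
  shows "dir_deriv e (c + r *\<^sub>R (x - c)) = dir_deriv e x"
proof (rule tendsto_unique[OF _ quotient_tendsto])
  have eq: "quotient e (c + r *\<^sub>R (x - c)) s = quotient e x (s / r)" for s
  proof -
    have "c + r *\<^sub>R (x - c) + s *\<^sub>R e = c + r *\<^sub>R ((x + (s / r) *\<^sub>R e) - c)"
      using assms by (simp add: algebra_simps)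
    then have "quotient e (c + r *\<^sub>R (x - c)) s = (r * gauge_fun (x + (s / r) *\<^sub>R e) - r * gauge_fun x) / s"
      unfolding quotient_def by (simp only: gauge_scale[OF less_imp_le[OF assms]])
    then show ?thesis
      using assms by (simp add: quotient_def right_diff_distrib[symmetric]) (simp add: mult.commute)
  qed
  have "filterlim (\<lambda>s. s / r) (at_right 0) (at_right 0)"
    unfolding filterlim_at using assms
    by (auto intro!: tendsto_eq_intros simp: eventually_at_right_field intro!: exI[of _ 1])
  then show "(quotient e (c + r *\<^sub>R (x - c)) \<longlongrightarrow> dir_deriv e x) (at_right 0)"
    unfolding eq by (rule filterlim_compose[OF quotient_tendsto])
qed simp

lemma dir_deriv_add_nonneg: "dir_deriv e x + dir_deriv (- e) x \<ge> 0"
proof -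
  have "0 \<le> quotient e x s + quotient (- e) x s" if "s > 0" for s
  proof -
    have "(1 - 1/2) *\<^sub>R (x + s *\<^sub>R e) + (1/2) *\<^sub>R (x + s *\<^sub>R (- e)) = x"
      by (simp add: algebra_simps flip: scaleR_add_left)
    then have "2 * gauge_fun x \<le> gauge_fun (x + s *\<^sub>R e) + gauge_fun (x + s *\<^sub>R (- e))"
      using gauge_convex[of "1/2" "x + s *\<^sub>R e" "x + s *\<^sub>R (- e)"] by simp
    then show ?thesis using that by (simp add: quotient_def add_divide_distrib[symmetric])
  qed
  then have "0 \<le> (\<lambda>j. quotient e x (inverse (real (Suc j))) + quotient (- e) x (inverse (real (Suc j)))) j" for j
    by simp
  then show ?thesis
    by (intro LIMSEQ_le_const[OF tendsto_add[OF quotient_LIMSEQ quotient_LIMSEQ]]) auto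
qed

lemma AE_not_frontier: "AE x in lborel. x \<notin> frontier K"
proof -
  have "frontier K \<in> null_sets lebesgue"
    using negligible_convex_frontier[OF convex] by (simp add: negligible_iff_null_sets)
  then have "AE x in lebesgue. x \<notin> frontier K" by (rule AE_not_in)
  then show ?thesis by (simp add: AE_completion_iff)
qed

text \<open>The second differences of the truncated gauge have integral zero, whereas their limit, the gap
  between the one-sided derivatives, is nonnegative.\<close>

lemma AE_dir_deriv_add:
  "AE x in lborel. x \<in> interior K \<longrightarrow> dir_deriv e x + dir_deriv (- e) x = 0"
proof -
  \<comment> \<open>Subtracting \<open>1\<close> makes the truncation vanish outside
    \<open>closure K\<close>, so that it is integrable and translations keep its integral. Inside
    \<open>K\<close> it differs from the gauge by a constant only.\<close>
  define \<eta> where "\<eta> x = min (gauge_fun x) 1 - 1" for x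
  define u where "u j x = (let s = inverse (real (Suc j)) in (\<eta> (x + s *\<^sub>R e) - \<eta> x) / s + (\<eta> (x + s *\<^sub>R (- e)) - \<eta> x) / s)" for j x
  define W where "W x = indicator (interior K) x * (dir_deriv e x + dir_deriv (- e) x)" for x
  have \<eta>c: "continuous_on S \<eta>" for S
    unfolding \<eta>_def by (intro continuous_intros gauge_continuous)
  have [measurable]: "\<eta> \<in> borel_measurable borel"
    by (intro borel_measurable_continuous_onI \<eta>c)
  have \<eta>0: "\<eta> x = 0" if "x \<notin> closure K" for x
    using that by (simp add: \<eta>_def closure_iff_gauge)
  have int: "integrable lborel (\<lambda>x. \<eta> (x + a))" for a
  proof (rule integrable_continuous_bounded_support)
    show "continuous_on UNIV (\<lambda>x. \<eta> (x + a))"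
      by (intro continuous_on_compose2[OF \<eta>c[of UNIV]] continuous_intros) auto
    show "bounded ((\<lambda>x. x - a) ` closure K)"
      using bounded_translation_minus[OF bounded_closure[OF bounded]] by simp
    fix x assume "x \<notin> (\<lambda>x. x - a) ` closure K"
    then have "x + a \<notin> closure K" by (metis add_diff_cancel image_eqI)
    then show "\<eta> (x + a) = 0" by (rule \<eta>0)
  qed
  have uint: "(LINT x|lborel. u j x) = 0" for j
  proof -
    define s where "s = inverse (real (Suc j))"
    have i0: "integrable lborel \<eta>" using int[of 0] by simp
    have "(LINT x|lborel. (\<eta> (x + a) - \<eta> x) / s) = 0" for a
      using int[of a] i0 lborel_integral_shift[of \<eta> a] by simp
    then show ?thesis
      unfolding u_def Let_def s_def[symmetric]
      using int[of "s *\<^sub>R e"] int[of "s *\<^sub>R (- e)"] i0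
      by (subst Bochner_Integration.integral_add)
         (auto intro!: integrable_divide_zero Bochner_Integration.integrable_diff simp del: scaleR_minus_right integral_divide_zero)
  qed
  have \<eta>lip: "\<bar>\<eta> x - \<eta> y\<bar> \<le> norm (x - y) / inradius" for x y
    using gauge_lipschitz_abs[of x y] by (auto simp: \<eta>_def min_def)
  obtain R where R: "\<And>z. z \<in> closure K \<Longrightarrow> norm z \<le> R"
    using bounded_closure[OF bounded] bounded_iff by metis
  \<comment> \<open>Outside this ball none of \<open>x\<close> and its two translates reaches
    \<open>closure K\<close>, because the step is at most \<open>1\<close>.\<close>
  let ?w = "\<lambda>x::'a. indicator (ball 0 (R + norm e + 1)) x * (2 * norm e / inradius)"
  have bnd: "norm (u j x) \<le> ?w x" for j x
  proof -
    define s where "s = inverse (real (Suc j))"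
    have s: "0 < s" "s \<le> 1" by (auto simp: s_def inverse_le_1_iff)
    have u: "u j x = (\<eta> (x + s *\<^sub>R e) - \<eta> x) / s + (\<eta> (x + s *\<^sub>R (- e)) - \<eta> x) / s"
      by (simp add: u_def s_def Let_def)
    show ?thesis
    proof (cases "norm x < R + norm e + 1")
      case True
      have "\<bar>(\<eta> (x + s *\<^sub>R e') - \<eta> x) / s\<bar> \<le> norm e' / inradius" for e'
        using \<eta>lip[of "x + s *\<^sub>R e'" x] s inradius by (simp add: abs_divide field_simps)
      from add_mono[OF this[of e] this[of "- e"]] have "\<bar>u j x\<bar> \<le> norm e / inradius + norm (- e) / inradius"
        unfolding u by (rule order_trans[OF abs_triangle_ineq])
      then show ?thesis using True by simp
    next
      case False
      have "x + s *\<^sub>R e' \<notin> closure K" if "norm e' \<le> norm e" for e'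
      proof
        assume "x + s *\<^sub>R e' \<in> closure K"
        then have "norm (x + s *\<^sub>R e') \<le> R" by (rule R)
        moreover have "norm (s *\<^sub>R e') \<le> norm e" using s that by (simp add: mult_le_one mult_mono' order_trans[OF mult_right_mono[of s 1 "norm e'"]])
        ultimately show False using False norm_triangle_sub[of x "- (s *\<^sub>R e')"] by simp
      qed
      from this[of e] this[of "- e"] this[of 0] show ?thesis
        using \<eta>0 inradius by (simp add: u)
    qed
  qed
  have lim: "AE x in lborel. (\<lambda>j. u j x) \<longlonglongrightarrow> W x"
    using AE_not_frontier
  proof eventually_elim
    fix x assume xf: "x \<notin> frontier K"
    have tz: "(\<lambda>j. x + inverse (real (Suc j)) *\<^sub>R e') \<longlonglongrightarrow> x" for e'
      using tendsto_add[OF tendsto_const tendsto_scaleR[OF LIMSEQ_inverse_real_of_nat tendsto_const[of e']], of x] by simp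
    show "(\<lambda>j. u j x) \<longlonglongrightarrow> W x"
    proof (cases "x \<in> interior K")
      case True
      have ev: "\<forall>\<^sub>F j in sequentially. x + inverse (real (Suc j)) *\<^sub>R e' \<in> interior K" for e'
        using topological_tendstoD[OF tz open_interior True] .
      have "\<forall>\<^sub>F j in sequentially. quotient e x (inverse (real (Suc j))) + quotient (- e) x (inverse (real (Suc j))) = u j x"
        using ev[of e] ev[of "- e"]
      proof eventually_elim
        case (elim j)
        then show ?case using True
          by (simp add: u_def \<eta>_def quotient_def Let_def interior_iff_gauge min_def)
      qed
      from Lim_transform_eventually[OF tendsto_add[OF quotient_LIMSEQ quotient_LIMSEQ] this]
      show ?thesis using True by (simp add: W_def)
    next
      case False
      then have x: "x \<in> - closure K" using xf by (simp add: frontier_def)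
      have ev: "\<forall>\<^sub>F j in sequentially. x + inverse (real (Suc j)) *\<^sub>R e' \<in> - closure K" for e'
        by (rule topological_tendstoD[OF tz _ x]) (simp add: open_Compl)
      have "\<forall>\<^sub>F j in sequentially. 0 = u j x"
        using ev[of e] ev[of "- e"]
      proof eventually_elim
        case (elim j)
        then show ?case using x by (simp add: u_def Let_def \<eta>0)
      qed
      from Lim_transform_eventually[OF tendsto_const this] show ?thesis using False by (simp add: W_def)
    qed
  qed
  have um: "u j \<in> borel_measurable lborel" for j unfolding u_def Let_def by measurable
  have Wm: "W \<in> borel_measurable lborel" unfolding W_def by measurable
  have wi: "integrable lborel ?w"
  proof (rule integrable_bounded_support[where S = "ball 0 (R + norm e + 1)" and B = "2 * norm e / inradius"])
    show "?w \<in> borel_measurable borel"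
      by (intro borel_measurable_times borel_measurable_indicator borel_measurable_const) simp
  qed (use inradius in \<open>simp_all add: indicator_def del: mem_ball\<close>)
  have bnd': "AE x in lborel. norm (u j x) \<le> ?w x" for j using bnd by simp
  have "(\<lambda>j. LINT x|lborel. u j x) \<longlonglongrightarrow> (LINT x|lborel. W x)"
    by (rule integral_dominated_convergence[OF Wm um wi lim bnd'])
  then have "(LINT x|lborel. W x) = 0"
    using uint by (simp add: LIMSEQ_const_iff)
  moreover have "integrable lborel W"
    by (rule integrable_dominated_convergence[OF Wm um wi lim bnd'])
  moreover have "AE x in lborel. 0 \<le> W x"
    using dir_deriv_add_nonneg by (simp add: W_def)
  ultimately have "AE x in lborel. W x = 0"
    using integral_nonneg_eq_0_iff_AE by blast
  then show ?thesis by (auto simp: W_def)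
qed

text \<open>The finitely many coordinate directions suffice: the partial derivatives of the gauge
  determine a supporting normal completely, as \<open>regular_smooth\<close> shows.\<close>

definition regular :: "'a \<Rightarrow> bool" where
  "regular x \<longleftrightarrow> (\<forall>b\<in>Basis. dir_deriv b x + dir_deriv (- b) x = 0)"

lemma AE_regular: "AE x in lborel. x \<in> interior K \<longrightarrow> regular x"
proof -
  have "AE x in lborel. \<forall>b\<in>Basis. x \<in> interior K \<longrightarrow> dir_deriv b x + dir_deriv (- b) x = 0"
    by (rule AE_finite_allI) (auto intro: AE_dir_deriv_add)
  then show ?thesis by eventually_elim (simp add: regular_def)
qed

text \<open>A subgradient bounds every difference quotient from below, hence also their
  infimum.\<close>

lemma supporting_normal_le_dir_deriv:
  assumes x: "x \<noteq> c" and n: "supporting_normal K (radial_projection K c x) n"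
  shows "(n \<bullet> e) / ((radial_projection K c x - c) \<bullet> n) \<le> dir_deriv e x"
proof (rule dir_deriv_ge)
  fix s :: real assume s: "s > 0"
  let ?h = "(radial_projection K c x - c) \<bullet> n"
  have h: "?h > 0" using supporting_normal_ge_inradius[OF n] inradius by simp
  have "(x + s *\<^sub>R e - c) \<bullet> n \<le> gauge_fun (x + s *\<^sub>R e) * ?h"
    by (rule supporting_normal_gauge_le[OF n])
  moreover have "(x + s *\<^sub>R e - c) \<bullet> n = gauge_fun x * ?h + s * (n \<bullet> e)"
    using supporting_normal_gauge_eq[OF x, of n] by (simp add: inner_simps inner_commute)
  ultimately have "s * (n \<bullet> e) \<le> (gauge_fun (x + s *\<^sub>R e) - gauge_fun x) * ?h"
    by (simp add: algebra_simps)
  then show "(n \<bullet> e) / ?h \<le> quotient e x s"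
    using s h by (simp add: quotient_def divide_simps mult.commute)
qed

text \<open>The subgradient inequality for \<open>b\<close> and for \<open>- b\<close> bounds the
  component from both sides; at a regular point the two bounds coincide.\<close>

lemma regular_normal:
  assumes x: "x \<noteq> c" and r: "regular x" and b: "b \<in> Basis" and n: "supporting_normal K (radial_projection K c x) n"
  shows "(n \<bullet> b) / ((radial_projection K c x - c) \<bullet> n) = dir_deriv b x"
  using supporting_normal_le_dir_deriv[OF x n, of b] supporting_normal_le_dir_deriv[OF x n, of "- b"] r b
  by (force simp: regular_def)

text \<open>Two supporting normals, each divided by its height, have the same components, namely the
  derivatives of the gauge. Being unit vectors, they then have the same height and are
  equal.\<close>

lemma regular_smooth:
  assumes x: "x \<noteq> c" and r: "regular x"
  shows "smooth_at K (radial_projection K c x)"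
proof -
  let ?p = "radial_projection K c x"
  obtain n where n: "supporting_normal K ?p n"
    using supporting_normal_exists[OF convex radial_projection_frontier[OF x]] by blast
  moreover have "n1 = n2" if n1: "supporting_normal K ?p n1" and n2: "supporting_normal K ?p n2" for n1 n2
  proof -
    let ?h1 = "(?p - c) \<bullet> n1" and ?h2 = "(?p - c) \<bullet> n2"
    have h: "?h1 > 0" "?h2 > 0"
      using supporting_normal_ge_inradius[OF n1] supporting_normal_ge_inradius[OF n2] inradius by auto
    have eq: "(1 / ?h1) *\<^sub>R n1 = (1 / ?h2) *\<^sub>R n2"
      by (rule euclidean_eqI) (use regular_normal[OF x r _ n1] regular_normal[OF x r _ n2] in simp)
    then have "norm ((1 / ?h1) *\<^sub>R n1) = norm ((1 / ?h2) *\<^sub>R n2)" by simp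
    then have "?h1 = ?h2" using h n1 n2 by (simp add: supporting_normal_def)
    then show "n1 = n2" using eq h by simp
  qed
  ultimately show ?thesis unfolding smooth_at_def by blast
qed

end

section \<open>The divergence theorem on a convex body\<close>

text \<open>Completeness of Lebesgue measure. The integrands of the scheme are built from limits and
  choices; almost everywhere equality with an explicit function settles their measurability.\<close>

lemma lebesgue_measurable_cong_AE:
  fixes f g :: "'a::euclidean_space \<Rightarrow> 'b::topological_space"
  assumes g: "g \<in> borel_measurable lebesgue" and eq: "AE x in lebesgue. f x = g x"
  shows "f \<in> borel_measurable lebesgue"
proof (rule measurableI)
  fix A :: "'b set" assume "A \<in> sets borel"
  then have s: "g -` A \<inter> space lebesgue \<in> sets lebesgue" by (rule measurable_sets[OF g])
  show "f -` A \<inter> space lebesgue \<in> sets lebesgue"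
    by (rule completion.in_sets_AE[OF _ s]) (use eq in \<open>auto elim!: eventually_mono\<close>)
qed simp

lemma convex_interior_lborel:
  fixes K :: "'a::euclidean_space set"
  assumes "convex K"
  shows "AE x in lborel. x \<in> K \<longleftrightarrow> x \<in> interior K"
proof -
  have "frontier K \<in> null_sets lebesgue"
    using negligible_convex_frontier[OF assms] by (simp add: negligible_iff_null_sets)
  then have "AE x in lebesgue. x \<notin> frontier K" by (rule AE_not_in)
  then have "AE x in lborel. x \<notin> frontier K" by (simp add: AE_completion_iff)
  then show ?thesis
    by eventually_elim (use interior_subset closure_subset in \<open>auto simp: frontier_def\<close>)
qed

text \<open>The frontier of a convex set is null, so a cell may be replaced by its interior and the
  integrand by a Borel representative. This is the passage from the integrals of the scheme to
  \<open>lborel\<close>.\<close>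

lemma set_integral_lebesgue_convex:
  fixes K :: "'a::euclidean_space set" and f :: "'a \<Rightarrow> 'b::euclidean_space"
  assumes "convex K" and g[measurable]: "g \<in> borel_measurable borel"
    and eq: "AE x in lborel. x \<in> interior K \<longrightarrow> f x = g x"
  shows "(LINT x:K|lebesgue. f x) = (LINT x|lborel. indicator (interior K) x *\<^sub>R g x)"
    and "set_integrable lebesgue K f \<longleftrightarrow> integrable lborel (\<lambda>x. indicator (interior K) x *\<^sub>R g x)"
proof -
  let ?g = "\<lambda>x. indicator (interior K) x *\<^sub>R g x"
  have [measurable]: "interior K \<in> sets borel" by simp
  have gm: "?g \<in> borel_measurable lborel" by measurable
  then have gm': "?g \<in> borel_measurable lebesgue" by (rule measurable_completion)
  have "AE x in lborel. indicator K x *\<^sub>R f x = ?g x"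
    using eq convex_interior_lborel[OF assms(1)]
    by eventually_elim (auto simp: indicator_def)
  then have AE: "AE x in lebesgue. indicator K x *\<^sub>R f x = ?g x" by (rule AE_completion)
  note fm = lebesgue_measurable_cong_AE[OF gm' AE]
  show "(LINT x:K|lebesgue. f x) = (LINT x|lborel. ?g x)"
    unfolding set_lebesgue_integral_def integral_completion[OF gm, symmetric]
    by (rule integral_cong_AE[OF fm gm' AE])
  show "set_integrable lebesgue K f \<longleftrightarrow> integrable lborel ?g"
    unfolding set_integrable_def integrable_cong_AE[OF fm gm' AE] by (rule integrable_completion[OF gm])
qed

lemma continuous_compact_bound:
  fixes f :: "'a::euclidean_space \<Rightarrow> real"
  assumes "continuous_on UNIV f" "bounded S"
  obtains M where "M > 0" "\<And>x. x \<in> S \<Longrightarrow> \<bar>f x\<bar> \<le> M"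
proof -
  have "compact (f ` closure S)"
    using assms by (intro compact_continuous_image) (auto intro: continuous_on_subset simp: compact_closure)
  then obtain B where "B > 0" "\<And>y. y \<in> f ` closure S \<Longrightarrow> norm y \<le> B"
    using compact_imp_bounded bounded_pos by metis
  then show ?thesis using closure_subset[of S] by (intro that[of B]) auto
qed

lemma directional_MVT:
  fixes g g' :: "'a::real_normed_vector \<Rightarrow> real"
  assumes gd: "\<And>x. ((\<lambda>s. g (x + s *\<^sub>R e)) has_real_derivative g' x) (at 0)" and s: "s > 0"
  obtains t where "0 < t" "t < s" "g (x + s *\<^sub>R e) - g x = s * g' (x + t *\<^sub>R e)"
proof -
  have der: "((\<lambda>t. g (x + t *\<^sub>R e)) has_real_derivative g' (x + t *\<^sub>R e)) (at t)" for t
  proof -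
    have "((\<lambda>s. g (x + (s + t) *\<^sub>R e)) has_real_derivative g' (x + t *\<^sub>R e)) (at 0)"
      using gd[of "x + t *\<^sub>R e"] by (simp add: algebra_simps)
    then show ?thesis using DERIV_shift[of "\<lambda>s. g (x + s *\<^sub>R e)" "g' (x + t *\<^sub>R e)" 0 t] by simp
  qed
  have "\<exists>z>0. z < s \<and> g (x + s *\<^sub>R e) - g (x + 0 *\<^sub>R e) = (s - 0) * g' (x + z *\<^sub>R e)"
    by (rule MVT2[OF s]) (rule der)
  then show ?thesis using that by auto
qed

section \<open>Tent functions over dilates of the body and integration by parts\<close>

context convex_body
begin

lemma norm_le_gauge:
  obtains R where "R > 0" "\<And>x. norm (x - c) \<le> R * gauge_fun x"
proof -
  obtain B where B: "B > 0" "\<And>z. z \<in> closure K \<Longrightarrow> norm z \<le> B"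
    using bounded_closure[OF bounded] bounded_pos by metis
  have "norm (x - c) \<le> (B + norm c) * gauge_fun x" for x
  proof (cases "x = c")
    case False
    then have "radial_projection K c x \<in> closure K"
      using radial_projection_frontier by (simp add: frontier_def)
    then have "norm (radial_projection K c x - c) \<le> B + norm c"
      using B(2) norm_triangle_ineq4 order_trans by (metis add_right_mono)
    moreover have "x - c = gauge_fun x *\<^sub>R (radial_projection K c x - c)"
      using gauge_pos[OF False] by (simp add: radial_projection_eq[OF False])
    then have "norm (x - c) = gauge_fun x * norm (radial_projection K c x - c)"
      using gauge_nonneg[of x] by (metis abs_of_nonneg norm_scaleR)
    ultimately show ?thesis
      using gauge_nonneg[of x] by (metis mult.commute mult_left_mono)
  qed simp
  then show ?thesis using B by (intro that[of "B + norm c"]) (auto intro: add_pos_nonneg)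
qed

lemma bounded_gauge: "bounded {x. gauge_fun x \<le> a}"
proof -
  obtain R where R: "R > 0" "\<And>x. norm (x - c) \<le> R * gauge_fun x" by (rule norm_le_gauge) blast
  have "{x. gauge_fun x \<le> a} \<subseteq> cball c (R * a)"
  proof
    fix x assume "x \<in> {x. gauge_fun x \<le> a}"
    then have "R * gauge_fun x \<le> R * a" using R by (intro mult_left_mono) auto
    then show "x \<in> cball c (R * a)" using R(2)[of x] by (simp add: dist_norm norm_minus_commute)
  qed
  then show ?thesis using bounded_cball bounded_subset by blast
qed

text \<open>The level set is contained in the frontier of \<open>K\<close> dilated by
  \<open>a\<close> about \<open>c\<close>, and the frontier of a convex set is negligible.\<close>

lemma AE_gauge_neq:
  assumes "a > 0"
  shows "AE x in lborel. gauge_fun x \<noteq> a"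
proof -
  have "{x. gauge_fun x = a} \<subseteq> (+) (c - a *\<^sub>R c) ` ((*\<^sub>R) a ` frontier K)"
  proof
    fix x assume "x \<in> {x. gauge_fun x = a}"
    then have "c + (1 / a) *\<^sub>R (x - c) \<in> frontier K"
      using assms gauge_scale[of "1 / a" x] by (simp add: frontier_iff_gauge)
    moreover have "x = (c - a *\<^sub>R c) + a *\<^sub>R (c + (1 / a) *\<^sub>R (x - c))"
      using assms by (simp add: algebra_simps)
    ultimately show "x \<in> (+) (c - a *\<^sub>R c) ` ((*\<^sub>R) a ` frontier K)" by blast
  qed
  moreover have "negligible ((+) (c - a *\<^sub>R c) ` ((*\<^sub>R) a ` frontier K))"
    by (intro negligible_translation negligible_differentiable_image_negligible negligible_convex_frontier[OF convex])
      (auto intro!: linear_imp_differentiable_on simp: linear_scaleR)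
  ultimately have "{x. gauge_fun x = a} \<in> null_sets lebesgue"
    using negligible_subset by (auto simp: negligible_iff_null_sets[symmetric])
  then have "AE x in lebesgue. x \<notin> {x. gauge_fun x = a}" by (rule AE_not_in)
  then show ?thesis by (simp add: AE_completion_iff)
qed

text \<open>A Lipschitz function supported in the dilate of the body by \<open>a\<close>, falling
  with the gauge. Scaled differences of two tents serve as cutoff functions for the body in
  \<open>divergence_gauge\<close>.\<close>

definition tent :: "real \<Rightarrow> 'a \<Rightarrow> real" where
  "tent a x = max 0 (a - gauge_fun x)"

lemma tent_continuous: "continuous_on S (tent a)"
  unfolding tent_def by (intro continuous_intros gauge_continuous)

lemma tent_measurable [measurable]: "tent a \<in> borel_measurable borel"
  by (intro borel_measurable_continuous_onI tent_continuous)

lemma tent_lipschitz: "\<bar>tent a x - tent a y\<bar> \<le> norm (x - y) / inradius"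
  using gauge_lipschitz_abs[of x y] by (auto simp: tent_def max_def)

text \<open>An integration by parts: translation invariance moves the difference quotient from \<open>g\<close> to the
  compactly supported tent, whose difference quotients converge almost everywhere.\<close>

lemma tent_identity:
  fixes g g' :: "'a \<Rightarrow> real"
  assumes gd: "\<And>x. ((\<lambda>s. g (x + s *\<^sub>R e)) has_real_derivative g' x) (at 0)"
    and gc: "continuous_on UNIV g" and g'c: "continuous_on UNIV g'" and a: "a > 0"
  shows "(LINT x|lborel. tent a x * g' x) = (LINT x|lborel. indicator {x. gauge_fun x < a} x * (dir_deriv e x * g x))"
proof -
  define s where "s j = inverse (real (Suc j))" for j
  have s: "0 < s j" "s j \<le> 1" for j by (auto simp: s_def inverse_le_1_iff)
  have s0: "s \<longlonglongrightarrow> 0" unfolding s_def by (rule LIMSEQ_inverse_real_of_nat)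
  \<comment> \<open>A translation by at most \<open>norm e\<close> changes the gauge by at most
    \<open>norm e / inradius\<close>, so \<open>Z\<close> contains every point where a translate of
    the tent in question is nonzero.\<close>
  define Z where "Z = {x. gauge_fun x \<le> a + norm e / inradius}"
  have bZ: "bounded Z" unfolding Z_def by (rule bounded_gauge)
  have Zm[measurable]: "Z \<in> sets borel" unfolding Z_def by measurable
  have inZ: "x \<in> Z" if "tent a (x + t *\<^sub>R e) \<noteq> 0" "\<bar>t\<bar> \<le> 1" for x t
  proof -
    have "gauge_fun x \<le> gauge_fun (x + t *\<^sub>R e) + norm (- (t *\<^sub>R e)) / inradius"
      using gauge_lipschitz[of x "x + t *\<^sub>R e"] by simp
    also have "norm (- (t *\<^sub>R e)) / inradius \<le> norm e / inradius"
      using that(2) inradius by (intro divide_right_mono) (auto intro: mult_left_le_one_le)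
    also have "gauge_fun (x + t *\<^sub>R e) < a" using that(1) by (auto simp: tent_def max_def split: if_splits)
    finally show ?thesis by (simp add: Z_def)
  qed
  have inZ0: "x \<in> Z" if "tent a x \<noteq> 0" for x using inZ[of x 0] that by simp
  obtain M where M: "M > 0" "\<And>x. x \<in> Z \<Longrightarrow> \<bar>g x\<bar> \<le> M" using continuous_compact_bound[OF gc bZ] by metis
  obtain M' where M': "M' > 0" "\<And>x. x \<in> Z \<Longrightarrow> \<bar>g' x\<bar> \<le> M'" using continuous_compact_bound[OF g'c bZ] by metis
  have [measurable]: "g \<in> borel_measurable borel" "g' \<in> borel_measurable borel"
    using gc g'c by (auto intro: borel_measurable_continuous_onI)
  define A where "A j x = tent a x * ((g x - g (x - s j *\<^sub>R e)) / s j)" for j x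
  define B where "B j x = (tent a x - tent a (x + s j *\<^sub>R e)) / s j * g x" for j x
  have AB: "(LINT x|lborel. A j x) = (LINT x|lborel. B j x)" for j
  proof -
    have i1: "integrable lborel (\<lambda>x. tent a x * g x)"
      by (rule integrable_continuous_bounded_support[OF _ bZ]) (use inZ0 in \<open>auto intro!: continuous_intros gc tent_continuous\<close>)
    have i2: "integrable lborel (\<lambda>x. tent a x * g (x - s j *\<^sub>R e))"
      by (rule integrable_continuous_bounded_support[OF _ bZ])
        (use inZ0 in \<open>auto intro!: continuous_intros tent_continuous continuous_on_compose2[OF gc]\<close>)
    have i3: "integrable lborel (\<lambda>x. tent a (x + s j *\<^sub>R e) * g x)"
      by (rule integrable_continuous_bounded_support[OF _ bZ])
        (use inZ[of _ "s j"] s[of j] in \<open>auto intro!: continuous_intros gc continuous_on_compose2[OF tent_continuous[of UNIV]]\<close>)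
    have sh: "(LINT x|lborel. tent a (x + s j *\<^sub>R e) * g x) = (LINT x|lborel. tent a x * g (x - s j *\<^sub>R e))"
      using lborel_integral_shift[of "\<lambda>x. tent a x * g (x - s j *\<^sub>R e)" "s j *\<^sub>R e"] by simp
    have "(LINT x|lborel. A j x) = (LINT x|lborel. (tent a x * g x - tent a x * g (x - s j *\<^sub>R e)) / s j)"
      by (simp add: A_def right_diff_distrib)
    also have "\<dots> = (LINT x|lborel. (tent a x * g x - tent a (x + s j *\<^sub>R e) * g x) / s j)"
      using i1 i2 i3 sh by simp
    also have "\<dots> = (LINT x|lborel. B j x)"
      by (simp add: B_def left_diff_distrib)
    finally show ?thesis .
  qed
  have limA: "(\<lambda>j. LINT x|lborel. A j x) \<longlonglongrightarrow> (LINT x|lborel. tent a x * g' x)"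
  proof (rule integral_dominated_convergence[where w = "\<lambda>x. indicator Z x * (a * M')"])
    show "A j \<in> borel_measurable lborel" for j unfolding A_def by measurable
    show "integrable lborel (\<lambda>x. indicator Z x * (a * M'))"
      by (rule integrable_bounded_support[OF _ bZ, where B = "a * M'"]) (use a M' in auto)
    show "AE x in lborel. (\<lambda>j. A j x) \<longlonglongrightarrow> tent a x * g' x"
    proof (rule AE_I2)
      fix x
      have "(\<lambda>h. (g (x + h *\<^sub>R e) - g x) / h) \<midarrow>0\<rightarrow> g' x"
        using gd[of x] by (simp add: DERIV_def)
      moreover have "filterlim (\<lambda>j. - s j) (at 0) sequentially"
        unfolding filterlim_at using tendsto_minus[OF s0] s by (auto simp: less_imp_neq[symmetric])
      ultimately have "(\<lambda>j. (g (x + (- s j) *\<^sub>R e) - g x) / (- s j)) \<longlonglongrightarrow> g' x"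
        by (rule filterlim_compose)
      moreover have "(g (x + (- s j) *\<^sub>R e) - g x) / (- s j) = (g x - g (x - s j *\<^sub>R e)) / s j" for j
        by (simp add: minus_divide_left)
      ultimately have "(\<lambda>j. (g x - g (x - s j *\<^sub>R e)) / s j) \<longlonglongrightarrow> g' x" by simp
      then show "(\<lambda>j. A j x) \<longlonglongrightarrow> tent a x * g' x" unfolding A_def by (intro tendsto_intros)
    qed
    show "AE x in lborel. norm (A j x) \<le> indicator Z x * (a * M')" for j
    proof (rule AE_I2)
      fix x
      show "norm (A j x) \<le> indicator Z x * (a * M')"
      proof (cases "tent a x = 0")
        case False
        have "tent a x \<le> a" "tent a x \<ge> 0" using gauge_nonneg[of x] a by (auto simp: tent_def)
        obtain t where t: "0 < t" "t < s j" "g (x - s j *\<^sub>R e + s j *\<^sub>R e) - g (x - s j *\<^sub>R e) = s j * g' (x - s j *\<^sub>R e + t *\<^sub>R e)"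
          by (rule directional_MVT[OF gd s(1)])
        have x: "x - s j *\<^sub>R e + t *\<^sub>R e \<in> Z"
          using False t s[of j] by (intro inZ[of _ "s j - t"]) (auto simp: algebra_simps)
        have "\<bar>(g x - g (x - s j *\<^sub>R e)) / s j\<bar> \<le> M'"
          using t M'(2)[OF x] s[of j] by simp
        then have "\<bar>tent a x\<bar> * \<bar>(g x - g (x - s j *\<^sub>R e)) / s j\<bar> \<le> a * M'"
          using \<open>tent a x \<le> a\<close> \<open>tent a x \<ge> 0\<close> by (intro mult_mono) auto
        then show ?thesis using inZ0[OF False] by (simp add: A_def abs_mult)
      qed (use a M' in \<open>simp add: A_def indicator_def\<close>)
    qed
  qed measurable
  have limB: "(\<lambda>j. LINT x|lborel. B j x) \<longlonglongrightarrow> (LINT x|lborel. indicator {x. gauge_fun x < a} x * (dir_deriv e x * g x))"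
  proof (rule integral_dominated_convergence[where w = "\<lambda>x. indicator Z x * (norm e / inradius * M)"])
    show "B j \<in> borel_measurable lborel" for j unfolding B_def by measurable
    show "integrable lborel (\<lambda>x. indicator Z x * (norm e / inradius * M))"
      by (rule integrable_bounded_support[OF _ bZ, where B = "norm e / inradius * M"]) (use inradius M in auto)
    show "AE x in lborel. (\<lambda>j. B j x) \<longlonglongrightarrow> indicator {x. gauge_fun x < a} x * (dir_deriv e x * g x)"
      \<comment> \<open>On the level set itself the tent has a kink, and the limit would depend on
        the sign of the derivative of the gauge.\<close>
      using AE_gauge_neq[OF a]
    proof eventually_elim
      fix x assume ne: "gauge_fun x \<noteq> a"
      have tz: "(\<lambda>j. x + s j *\<^sub>R e) \<longlonglongrightarrow> x"
        using tendsto_add[OF tendsto_const tendsto_scaleR[OF s0 tendsto_const[of e]], of x] by simp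
      have "isCont gauge_fun x" using gauge_continuous[of UNIV] by (simp add: continuous_on_eq_continuous_at)
      then have gz: "(\<lambda>j. gauge_fun (x + s j *\<^sub>R e)) \<longlonglongrightarrow> gauge_fun x"
        by (rule isCont_tendsto_compose[OF _ tz])
      show "(\<lambda>j. B j x) \<longlonglongrightarrow> indicator {x. gauge_fun x < a} x * (dir_deriv e x * g x)"
      proof (cases "gauge_fun x < a")
        case True
        have "\<forall>\<^sub>F j in sequentially. quotient e x (s j) * g x = B j x"
          using order_tendstoD(2)[OF gz True]
          by eventually_elim (use True in \<open>simp add: B_def tent_def quotient_def\<close>)
        from Lim_transform_eventually[OF tendsto_mult[OF quotient_LIMSEQ[folded s_def] tendsto_const] this]
        show ?thesis using True by simp
      next
        case False
        then have "gauge_fun x > a" using ne by simp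
        have "\<forall>\<^sub>F j in sequentially. 0 = B j x"
          using order_tendstoD(1)[OF gz \<open>gauge_fun x > a\<close>]
          by eventually_elim (use \<open>gauge_fun x > a\<close> in \<open>simp add: B_def tent_def\<close>)
        from Lim_transform_eventually[OF tendsto_const this] show ?thesis using False by simp
      qed
    qed
    show "AE x in lborel. norm (B j x) \<le> indicator Z x * (norm e / inradius * M)" for j
    proof (rule AE_I2)
      fix x
      show "norm (B j x) \<le> indicator Z x * (norm e / inradius * M)"
      proof (cases "x \<in> Z")
        case True
        have "\<bar>tent a x - tent a (x + s j *\<^sub>R e)\<bar> \<le> s j * norm e / inradius"
          using tent_lipschitz[of a x "x + s j *\<^sub>R e"] s[of j] by simp
        then have "\<bar>(tent a x - tent a (x + s j *\<^sub>R e)) / s j\<bar> \<le> norm e / inradius"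
          using s[of j] by (simp add: abs_divide field_simps)
        then have "\<bar>(tent a x - tent a (x + s j *\<^sub>R e)) / s j\<bar> * \<bar>g x\<bar> \<le> norm e / inradius * M"
          using M(2)[OF True] inradius by (intro mult_mono) auto
        then show ?thesis using True by (simp add: B_def abs_mult)
      next
        case False
        then have "tent a x = 0" "tent a (x + s j *\<^sub>R e) = 0" using inZ0[of x] inZ[of x "s j"] s[of j] by auto
        then show ?thesis using False by (simp add: B_def)
      qed
    qed
  qed measurable
  show ?thesis using LIMSEQ_unique[OF limA] limB AB by simp
qed

end

section \<open>The divergence theorem in cone form\<close>

context convex_body
begin

text \<open>An explicit and hence visibly Borel form of \<open>radial_projection\<close>. At
  \<open>x = c\<close> the quotient \<open>1 / 0\<close> is \<open>0\<close> and the value is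
  \<open>c\<close>, whereas the description in \<open>radial_projection\<close> has no witness
  there.\<close>

definition rproj :: "'a \<Rightarrow> 'a" where
  "rproj x = c + (1 / gauge_fun x) *\<^sub>R (x - c)"

lemma rproj_eq: "x \<noteq> c \<Longrightarrow> radial_projection K c x = rproj x"
  by (simp add: rproj_def radial_projection_eq)

lemma rproj_measurable [measurable]: "rproj \<in> borel \<rightarrow>\<^sub>M borel"
  unfolding rproj_def by measurable

lemma rproj_scale: "r > 0 \<Longrightarrow> rproj (c + r *\<^sub>R (x - c)) = rproj x"
  using gauge_scale[of r x] by (simp add: rproj_def)

lemma rproj_closure: "rproj x \<in> closure K"
proof (cases "x = c")
  case True
  then show ?thesis using center interior_subset closure_subset by (auto simp: rproj_def)
next
  case False
  then show ?thesis using radial_projection_frontier[OF False] by (simp add: rproj_eq frontier_def)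
qed

lemma AE_not_center: "AE x in lborel. x \<noteq> c"
  by (rule AE_lborel_singleton)

text \<open>For an integrand that is constant on rays from \<open>c\<close>, the dilation about
  \<open>c\<close> contributes its volume factor and nothing else.\<close>

lemma scaled_body_integral:
  fixes H :: "'a \<Rightarrow> real"
  assumes [measurable]: "H \<in> borel_measurable borel" and r: "r > 0"
    and H: "\<And>x s. s > 0 \<Longrightarrow> H (c + s *\<^sub>R (x - c)) = H x"
  shows "(LINT x|lborel. indicator {x. gauge_fun x < r} x * H x) = r ^ DIM('a) * (LINT x|lborel. indicator {x. gauge_fun x < 1} x * H x)"
proof -
  let ?T = "\<lambda>x. (c - r *\<^sub>R c) + r *\<^sub>R x"
  have T: "?T x = c + r *\<^sub>R (x - c)" for x by (simp add: algebra_simps)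
  have "(LINT x|lborel. indicator {x. gauge_fun x < r} x * H x)
      = (LINT x|density (distr lborel borel ?T) (\<lambda>_. \<bar>r\<bar> ^ DIM('a)). indicator {x. gauge_fun x < r} x * H x)"
    using lborel_affine[of r "c - r *\<^sub>R c"] r by simp
  also have "\<dots> = r ^ DIM('a) * (LINT x|lborel. indicator {x. gauge_fun x < r} (?T x) * H (?T x))"
    using r by (subst integral_density) (simp_all add: integral_distr ennreal_power[symmetric])
  also have "(\<lambda>x. indicator {x. gauge_fun x < r} (?T x) * H (?T x)) = (\<lambda>x. indicator {x. gauge_fun x < 1} x * H x)"
    unfolding T using r gauge_scale[of r] by (auto simp: H indicator_def)
  finally show ?thesis .
qed

lemma integrable_on_body:
  fixes H :: "'a \<Rightarrow> real"
  assumes [measurable]: "H \<in> borel_measurable borel" and "r \<le> 1" and "\<And>x. gauge_fun x < 1 \<Longrightarrow> \<bar>H x\<bar> \<le> M"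
  shows "integrable lborel (\<lambda>x. indicator {x. gauge_fun x < r} x * H x)"
proof (rule integrable_bounded_support[where S = "{x. gauge_fun x \<le> 1}" and B = "max 0 M"])
  show "\<bar>indicator {x. gauge_fun x < r} x * H x\<bar> \<le> max 0 M" for x
    using assms(2) assms(3)[of x] by (auto simp: indicator_def)
qed (use assms(2) in \<open>auto simp: bounded_gauge indicator_def\<close>)

text \<open>The difference of two tents, divided by the gap \<open>\<epsilon>\<close>, tends to the indicator of the body. On the shell
  between them \<open>g\<close> may be replaced by its value at the radial projection, and the remaining integrand is
  homogeneous of degree \<open>0\<close>, so the shell contributes \<open>(1 - (1 - \<epsilon>) ^ d) / \<epsilon>\<close> times the integral over the body.\<close>

lemma divergence_gauge:
  fixes g g' :: "'a \<Rightarrow> real"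
  assumes gd: "\<And>x. ((\<lambda>s. g (x + s *\<^sub>R e)) has_real_derivative g' x) (at 0)"
    and gc: "continuous_on UNIV g" and g'c: "continuous_on UNIV g'"
  shows "(LINT x|lborel. indicator (interior K) x * g' x)
       = DIM('a) * (LINT x|lborel. indicator (interior K) x * (dir_deriv e x * g (rproj x)))"
proof -
  define d where "d = DIM('a)"
  \<comment> \<open>The second \<open>Suc\<close> keeps \<open>\<epsilon> j\<close> below
    \<open>1\<close>, so that the inner tent has positive height.\<close>
  define \<epsilon> where "\<epsilon> j = inverse (real (Suc (Suc j)))" for j
  have \<epsilon>: "0 < \<epsilon> j" "\<epsilon> j < 1" for j by (auto simp: \<epsilon>_def inverse_less_1_iff)
  have \<epsilon>0: "\<epsilon> \<longlonglongrightarrow> 0" unfolding \<epsilon>_def using LIMSEQ_Suc[OF LIMSEQ_inverse_real_of_nat] .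
  let ?I = "\<lambda>r x. indicator {x. gauge_fun x < r} x :: real"
  let ?S = "\<lambda>j x. ?I 1 x - ?I (1 - \<epsilon> j) x"
  have int: "interior K = {x. gauge_fun x < 1}" by (auto simp: interior_iff_gauge)
  have bK: "bounded (closure K)" using bounded bounded_closure by blast
  have sub: "gauge_fun x < 1 \<Longrightarrow> x \<in> closure K" for x by (simp add: closure_iff_gauge)
  obtain M where M: "M > 0" "\<And>x. x \<in> closure K \<Longrightarrow> \<bar>g x\<bar> \<le> M" using continuous_compact_bound[OF gc bK] by metis
  obtain M' where M': "M' > 0" "\<And>x. x \<in> closure K \<Longrightarrow> \<bar>g' x\<bar> \<le> M'" using continuous_compact_bound[OF g'c bK] by metis
  obtain R where R: "R > 0" "\<And>x. norm (x - c) \<le> R * gauge_fun x" by (rule norm_le_gauge) blast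
  have [measurable]: "g \<in> borel_measurable borel" "g' \<in> borel_measurable borel"
    using gc g'c by (auto intro: borel_measurable_continuous_onI)
  define L where "L = norm e / inradius"
  have L: "\<bar>dir_deriv e x\<bar> \<le> L" "L \<ge> 0" for x using dir_deriv_abs[of e x] inradius by (auto simp: L_def)
  define V where "V = (LINT x|lborel. ?I 1 x * 1)"
  define J where "J = (LINT x|lborel. ?I 1 x * (dir_deriv e x * g (rproj x)))"
  define X where "X j = (LINT x|lborel. (tent 1 x - tent (1 - \<epsilon> j) x) / \<epsilon> j * g' x)" for j
  have DM: "\<bar>dir_deriv e x * y\<bar> \<le> L * M" if "\<bar>y\<bar> \<le> M" for x y
    unfolding abs_mult using L that by (intro mult_mono) auto
  have i1: "integrable lborel (\<lambda>x. ?I r x * (dir_deriv e x * g x))" if "r \<le> 1" for r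
    by (rule integrable_on_body[OF _ that, where M = "L * M"]) (auto intro!: DM M sub)
  have i2: "integrable lborel (\<lambda>x. ?I r x * (dir_deriv e x * g (rproj x)))" if "r \<le> 1" for r
    by (rule integrable_on_body[OF _ that, where M = "L * M"]) (auto intro!: DM M rproj_closure)
  have i3: "integrable lborel (\<lambda>x. ?I r x * 1)" if "r \<le> 1" for r
    by (rule integrable_on_body[OF _ that, where M = 1]) auto
  have tentb: "0 \<le> (tent 1 x - tent (1 - \<epsilon> j) x) / \<epsilon> j" "(tent 1 x - tent (1 - \<epsilon> j) x) / \<epsilon> j \<le> ?I 1 x" for j x
    using \<epsilon>[of j] by (auto simp: tent_def max_def field_simps indicator_def)
  have Xlim: "X \<longlonglongrightarrow> (LINT x|lborel. ?I 1 x * g' x)"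
    unfolding X_def
  proof (rule integral_dominated_convergence[where w = "\<lambda>x. ?I 1 x * M'"])
    show "integrable lborel (\<lambda>x. ?I 1 x * M')"
      by (rule integrable_on_body[where M = M']) (use M' in auto)
    show "AE x in lborel. (\<lambda>j. (tent 1 x - tent (1 - \<epsilon> j) x) / \<epsilon> j * g' x) \<longlonglongrightarrow> ?I 1 x * g' x"
    proof (rule AE_I2)
      fix x
      show "(\<lambda>j. (tent 1 x - tent (1 - \<epsilon> j) x) / \<epsilon> j * g' x) \<longlonglongrightarrow> ?I 1 x * g' x"
      proof (cases "gauge_fun x < 1")
        case True
        then have "\<forall>\<^sub>F j in sequentially. \<epsilon> j < 1 - gauge_fun x"
          by (intro order_tendstoD(2)[OF \<epsilon>0]) simp
        then have "\<forall>\<^sub>F j in sequentially. ?I 1 x * g' x = (tent 1 x - tent (1 - \<epsilon> j) x) / \<epsilon> j * g' x"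
          by eventually_elim (use True \<epsilon> in \<open>simp add: tent_def max_def less_imp_neq[symmetric]\<close>)
        from Lim_transform_eventually[OF tendsto_const this] show ?thesis .
      next
        case False
        then have "tent 1 x - tent (1 - \<epsilon> j) x = 0" for j
          using \<epsilon>[of j] by (simp add: tent_def)
        then show ?thesis using False by simp
      qed
    qed
    show "AE x in lborel. norm ((tent 1 x - tent (1 - \<epsilon> j) x) / \<epsilon> j * g' x) \<le> ?I 1 x * M'" for j
    proof (rule AE_I2)
      fix x
      show "norm ((tent 1 x - tent (1 - \<epsilon> j) x) / \<epsilon> j * g' x) \<le> ?I 1 x * M'"
      proof (cases "gauge_fun x < 1")
        case True
        have "\<bar>(tent 1 x - tent (1 - \<epsilon> j) x) / \<epsilon> j\<bar> * \<bar>g' x\<bar> \<le> ?I 1 x * M'"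
          using tentb[of x j] M'(2)[OF sub[OF True]] by (intro mult_mono) auto
        then show ?thesis by (simp add: abs_mult)
      next
        case False
        then have "tent 1 x - tent (1 - \<epsilon> j) x = 0"
          using \<epsilon>[of j] by (simp add: tent_def)
        then show ?thesis using False by simp
      qed
    qed
  qed measurable
  have ti: "integrable lborel (\<lambda>x. tent a x * g' x)" if "a > 0" for a
  proof (rule integrable_continuous_bounded_support[OF _ bounded_gauge[of a]])
    show "continuous_on UNIV (\<lambda>x. tent a x * g' x)" by (intro continuous_intros g'c tent_continuous)
  qed (simp add: tent_def)
  \<comment> \<open>\<open>tent_identity\<close> at the two heights turns the cutoff integral of
    \<open>g'\<close> into an integral of \<open>g\<close> against the gauge derivative over the
    shell alone.\<close>
  have XD: "X j = (LINT x|lborel. ?S j x * (dir_deriv e x * g x)) / \<epsilon> j" for j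
  proof -
    have "X j = (LINT x|lborel. (tent 1 x * g' x - tent (1 - \<epsilon> j) x * g' x) / \<epsilon> j)"
      by (simp add: X_def left_diff_distrib)
    also have "\<dots> = ((LINT x|lborel. ?I 1 x * (dir_deriv e x * g x)) - (LINT x|lborel. ?I (1 - \<epsilon> j) x * (dir_deriv e x * g x))) / \<epsilon> j"
      using ti[of 1] ti[of "1 - \<epsilon> j"] \<epsilon>[of j] tent_identity[OF gd gc g'c, of 1] tent_identity[OF gd gc g'c, of "1 - \<epsilon> j"]
      by simp
    also have "\<dots> = (LINT x|lborel. ?S j x * (dir_deriv e x * g x)) / \<epsilon> j"
      using i1[of 1] i1[of "1 - \<epsilon> j"] \<epsilon>[of j] by (simp add: left_diff_distrib)
    finally show ?thesis .
  qed
  define q where "q j = (1 - (1 - \<epsilon> j) ^ d) / \<epsilon> j" for j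
  have shell: "(LINT x|lborel. ?S j x * H x) / \<epsilon> j = q j * (LINT x|lborel. ?I 1 x * H x)"
    if [measurable]: "H \<in> borel_measurable borel" and H: "\<And>x s. s > 0 \<Longrightarrow> H (c + s *\<^sub>R (x - c)) = H x"
      and iH: "\<And>r. r \<le> 1 \<Longrightarrow> integrable lborel (\<lambda>x. ?I r x * H x)" for H j
    using iH[of 1] iH[of "1 - \<epsilon> j"] \<epsilon>[of j] scaled_body_integral[OF that(1) _ H, of "1 - \<epsilon> j"]
    by (simp add: left_diff_distrib q_def d_def)
  have Y: "(LINT x|lborel. ?S j x * (dir_deriv e x * g (rproj x))) / \<epsilon> j = q j * J" for j
    unfolding J_def by (rule shell) (use i2 in \<open>auto simp: dir_deriv_scale rproj_scale\<close>)
  have W: "(LINT x|lborel. ?S j x * 1) / \<epsilon> j = q j * V" for j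
    unfolding V_def by (rule shell) (use i3 in auto)
  \<comment> \<open>\<open>q j\<close> is a difference quotient of the power function
    \<open>x ^ d\<close> at \<open>1\<close>; its limit is the dimension factor of the cone
    density.\<close>
  have qlim: "q \<longlonglongrightarrow> d"
  proof -
    have "((\<lambda>x::real. x ^ d) has_real_derivative real d) (at 1)"
      by (auto intro!: derivative_eq_intros)
    then have "(\<lambda>h. ((1 + h) ^ d - 1 ^ d) / h) \<midarrow>0\<rightarrow> real d" by (simp add: DERIV_def)
    moreover have "filterlim (\<lambda>j. - \<epsilon> j) (at 0) sequentially"
      unfolding filterlim_at using tendsto_minus[OF \<epsilon>0] \<epsilon> by (auto simp: less_imp_neq[symmetric])
    ultimately have "(\<lambda>j. ((1 + - \<epsilon> j) ^ d - 1 ^ d) / (- \<epsilon> j)) \<longlonglongrightarrow> real d"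
      by (rule filterlim_compose)
    moreover have "((1 + - \<epsilon> j) ^ d - 1 ^ d) / (- \<epsilon> j) = q j" for j
      using \<epsilon>[of j] by (simp add: q_def field_simps)
    ultimately show ?thesis by simp
  qed
  have q: "0 \<le> q j" "q j \<le> d" for j
  proof -
    show "0 \<le> q j" using \<epsilon>[of j] by (auto simp: q_def power_le_one)
    have "1 + real d * (- \<epsilon> j) \<le> (1 + - \<epsilon> j) ^ d" using \<epsilon>[of j] by (intro Bernoulli_inequality) simp
    then show "q j \<le> d" using \<epsilon>[of j] by (simp add: q_def field_simps)
  qed
  have V: "V \<ge> 0" unfolding V_def by (rule integral_nonneg_AE) simp
  have diff0: "(\<lambda>j. X j - q j * J) \<longlonglongrightarrow> 0"
  proof (rule LIMSEQ_I)
    fix r :: real assume r: "r > 0"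
    \<comment> \<open>The oscillation of \<open>g\<close> tolerated on the shell; the summand
      \<open>1\<close> keeps the quotient defined when \<open>L\<close> is \<open>0\<close>.\<close>
    define \<eta> where "\<eta> = r / (d * L * V + 1)"
    have den: "d * L * V + 1 > 0" using L V by (simp add: add_nonneg_pos)
    have \<eta>: "\<eta> > 0" "d * L * V * \<eta> < r"
      using r den by (auto simp: \<eta>_def field_simps)
    have "uniformly_continuous_on (closure K) g"
      by (rule compact_uniformly_continuous) (use gc bounded in \<open>auto intro: continuous_on_subset simp: compact_closure\<close>)
    then obtain \<delta> where \<delta>: "\<delta> > 0" "\<And>x y. x \<in> closure K \<Longrightarrow> y \<in> closure K \<Longrightarrow> dist y x < \<delta> \<Longrightarrow> dist (g y) (g x) < \<eta>"
      unfolding uniformly_continuous_on_def using \<eta>(1) by metis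
    have "\<forall>\<^sub>F j in sequentially. \<epsilon> j < \<delta> / R"
      using \<delta> R by (intro order_tendstoD(2)[OF \<epsilon>0]) simp
    then obtain j0 where j0: "\<And>j. j \<ge> j0 \<Longrightarrow> \<epsilon> j < \<delta> / R" by (auto simp: eventually_sequentially)
    have "norm (X j - q j * J - 0) < r" if "j \<ge> j0" for j
    proof -
      \<comment> \<open>On the shell the distance of \<open>x\<close> to its projection is at most
        \<open>(1 - gauge_fun x) * R\<close>, hence at most \<open>\<epsilon> j * R\<close>, and
        uniform continuity of \<open>g\<close> applies.\<close>
      have close: "\<bar>g x - g (rproj x)\<bar> \<le> \<eta>" if x: "gauge_fun x < 1" "\<not> gauge_fun x < 1 - \<epsilon> j" for x
      proof -
        have g0: "gauge_fun x > 0" using x(2) \<epsilon>[of j] by simp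
        have "x - rproj x = (1 - 1 / gauge_fun x) *\<^sub>R (x - c)" by (simp add: rproj_def algebra_simps)
        then have "norm (x - rproj x) = \<bar>1 - 1 / gauge_fun x\<bar> * norm (x - c)" by simp
        also have "\<bar>1 - 1 / gauge_fun x\<bar> = 1 / gauge_fun x - 1"
          using x(1) g0 by (simp add: abs_if field_simps)
        finally have "norm (x - rproj x) = (1 / gauge_fun x - 1) * norm (x - c)" .
        also have "\<dots> \<le> (1 / gauge_fun x - 1) * (R * gauge_fun x)"
          using x(1) g0 R(2)[of x] by (intro mult_left_mono) auto
        also have "\<dots> = (1 - gauge_fun x) * R" using g0 by (simp add: field_simps)
        also have "\<dots> \<le> \<epsilon> j * R" using x(2) R by (intro mult_right_mono) auto
        also have "\<dots> < \<delta>" using j0[OF \<open>j \<ge> j0\<close>] R by (simp add: field_simps)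
        finally show ?thesis
          using \<delta>(2)[OF rproj_closure sub[OF x(1)], of x] by (simp add: dist_norm)
      qed
      have i4: "integrable lborel (\<lambda>x. ?S j x * (dir_deriv e x * g x))"
        "integrable lborel (\<lambda>x. ?S j x * (dir_deriv e x * g (rproj x)))"
        "integrable lborel (\<lambda>x. ?S j x * 1)"
        using i1[of 1] i1[of "1 - \<epsilon> j"] i2[of 1] i2[of "1 - \<epsilon> j"] i3[of 1] i3[of "1 - \<epsilon> j"] \<epsilon>[of j]
        by (auto simp: left_diff_distrib)
      have E: "(X j - q j * J) * \<epsilon> j = (LINT x|lborel. ?S j x * (dir_deriv e x * g x) - ?S j x * (dir_deriv e x * g (rproj x)))"
        unfolding Bochner_Integration.integral_diff[OF i4(1,2)] XD Y[symmetric] left_diff_distrib[of _ _ "\<epsilon> j"]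
        using \<epsilon>(1)[of j] by simp
      have "\<bar>(X j - q j * J) * \<epsilon> j\<bar> \<le> (LINT x|lborel. ?S j x * 1 * (L * \<eta>))"
        unfolding E
      proof (rule integral_abs_bound[THEN order_trans], rule integral_mono)
        show "integrable lborel (\<lambda>x. \<bar>?S j x * (dir_deriv e x * g x) - ?S j x * (dir_deriv e x * g (rproj x))\<bar>)"
          using i4 by (intro integrable_abs Bochner_Integration.integrable_diff) auto
        show "integrable lborel (\<lambda>x. ?S j x * 1 * (L * \<eta>))"
          using i4(3) by (rule integrable_mult_left)
        fix x
        have eq: "?S j x * (dir_deriv e x * g x) - ?S j x * (dir_deriv e x * g (rproj x))
           = ?S j x * (dir_deriv e x * (g x - g (rproj x)))"
          by (simp add: algebra_simps)
        show "\<bar>?S j x * (dir_deriv e x * g x) - ?S j x * (dir_deriv e x * g (rproj x))\<bar>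
           \<le> ?S j x * 1 * (L * \<eta>)"
        proof (cases "gauge_fun x < 1 \<and> \<not> gauge_fun x < 1 - \<epsilon> j")
          case True
          have "\<bar>dir_deriv e x\<bar> * \<bar>g x - g (rproj x)\<bar> \<le> L * \<eta>"
            using L close True by (intro mult_mono) auto
          then show ?thesis unfolding eq using True by (simp add: abs_mult)
        next
          case False
          then have "?S j x = 0" using \<epsilon>[of j] by (auto simp: indicator_def)
          then show ?thesis unfolding eq by simp
        qed
      qed
      also have "\<dots> = (LINT x|lborel. ?S j x * 1) * (L * \<eta>)" by (rule integral_mult_left_zero)
      also have "\<dots> = q j * V * \<epsilon> j * (L * \<eta>)"
        unfolding nonzero_divide_eq_eq[THEN iffD1, OF less_imp_neq[OF \<epsilon>(1)[of j], symmetric] W[of j]] ..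
      finally have "\<bar>X j - q j * J\<bar> * \<epsilon> j \<le> q j * V * \<epsilon> j * (L * \<eta>)"
        unfolding abs_mult abs_of_pos[OF \<epsilon>(1)] .
      then have "\<bar>X j - q j * J\<bar> * \<epsilon> j \<le> (q j * V * (L * \<eta>)) * \<epsilon> j" by (simp only: mult_ac)
      then have "\<bar>X j - q j * J\<bar> \<le> q j * V * (L * \<eta>)" by (rule mult_right_le_imp_le) (rule \<epsilon>)
      also have "\<dots> \<le> d * V * (L * \<eta>)" using q[of j] V L \<eta>(1) by (intro mult_right_mono) auto
      also have "\<dots> < r" using \<eta>(2) by (simp add: mult_ac)
      finally show ?thesis by simp
    qed
    then show "\<exists>no. \<forall>n\<ge>no. norm (X n - q n * J - 0) < r" by blast
  qed
  have "X \<longlonglongrightarrow> d * J"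
    using tendsto_add[OF diff0 tendsto_mult[OF qlim tendsto_const[of J]]] by simp
  then have "(LINT x|lborel. ?I 1 x * g' x) = d * J"
    using Xlim LIMSEQ_unique by blast
  then show ?thesis by (simp add: int J_def d_def)
qed

definition surface_density :: "'a \<Rightarrow> real" where
  "surface_density x = DIM('a) / ((radial_projection K c x - c) \<bullet> outward_normal K (radial_projection K c x))"

text \<open>The density of the cone construction turns each normal component into a derivative of the gauge.\<close>

lemma AE_surface_density_normal:
  "AE x in lborel. x \<in> interior K \<longrightarrow> x \<noteq> c \<and> smooth_at K (rproj x) \<and> radial_projection K c x = rproj x \<and>
     (\<forall>b\<in>Basis. surface_density x * (outward_normal K (rproj x) \<bullet> b) = DIM('a) * dir_deriv b x)"
  using AE_regular AE_not_center
proof eventually_elim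
  case (elim x)
  show ?case
  proof
    assume x: "x \<in> interior K"
    with elim have r: "regular x" and xc: "x \<noteq> c" by auto
    have sm: "smooth_at K (radial_projection K c x)" by (rule regular_smooth[OF xc r])
    show "x \<noteq> c \<and> smooth_at K (rproj x) \<and> radial_projection K c x = rproj x \<and>
     (\<forall>b\<in>Basis. surface_density x * (outward_normal K (rproj x) \<bullet> b) = DIM('a) * dir_deriv b x)"
    proof (intro conjI ballI)
      show "smooth_at K (rproj x)" "radial_projection K c x = rproj x"
        using sm by (simp_all add: rproj_eq xc)
      fix b :: 'a assume b: "b \<in> Basis"
      show "surface_density x * (outward_normal K (rproj x) \<bullet> b) = DIM('a) * dir_deriv b x"
        using regular_normal[OF xc r b outward_normal_supporting[OF sm]]
        by (simp add: surface_density_def rproj_eq[OF xc] flip: times_divide_eq_right)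
    qed (rule xc)
  qed
qed

text \<open>Gauss's theorem for the field with the single component \<open>g\<close> along
  \<open>b\<close>. Almost everywhere the density times the normal component is the dimension times
  a derivative of the gauge, so the left side is the right side of \<open>divergence_gauge\<close>.
  Integrability is recorded because the surface terms are later split into sums.\<close>

lemma divergence_cone:
  fixes g g' :: "'a \<Rightarrow> real"
  assumes b: "b \<in> Basis" and gd: "\<And>x. ((\<lambda>s. g (x + s *\<^sub>R b)) has_real_derivative g' x) (at 0)"
    and gc: "continuous_on UNIV g" and g'c: "continuous_on UNIV g'"
  shows "(LINT x:K|lebesgue. surface_density x * ((outward_normal K (radial_projection K c x) \<bullet> b) * g (radial_projection K c x)))
    = (LINT x:K|lebesgue. g' x)"
    and "set_integrable lebesgue K (\<lambda>x. surface_density x * ((outward_normal K (radial_projection K c x) \<bullet> b) * g (radial_projection K c x)))"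
proof -
  have [measurable]: "g \<in> borel_measurable borel" "g' \<in> borel_measurable borel"
    using gc g'c by (auto intro: borel_measurable_continuous_onI)
  have eq: "AE x in lborel. x \<in> interior K \<longrightarrow>
     surface_density x * ((outward_normal K (radial_projection K c x) \<bullet> b) * g (radial_projection K c x))
     = DIM('a) * (dir_deriv b x * g (rproj x))"
    using AE_surface_density_normal
    by eventually_elim (use b in \<open>simp add: mult.assoc[symmetric]\<close>)
  have m: "(\<lambda>x. DIM('a) * (dir_deriv b x * g (rproj x))) \<in> borel_measurable borel" by measurable
  have "(LINT x:K|lebesgue. g' x) = (LINT x|lborel. indicator (interior K) x *\<^sub>R g' x)"
    by (rule set_integral_lebesgue_convex(1)[OF convex]) auto
  then show "(LINT x:K|lebesgue. surface_density x * ((outward_normal K (radial_projection K c x) \<bullet> b) * g (radial_projection K c x)))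
    = (LINT x:K|lebesgue. g' x)"
    using set_integral_lebesgue_convex(1)[OF convex m eq] divergence_gauge[OF gd gc g'c] by (simp add: mult.left_commute)
  obtain M where M: "M > 0" "\<And>x. x \<in> closure K \<Longrightarrow> \<bar>g x\<bar> \<le> M"
    using continuous_compact_bound[OF gc bounded_closure[OF bounded]] by metis
  have "integrable lborel (\<lambda>x. indicator {x. gauge_fun x < 1} x * (DIM('a) * (dir_deriv b x * g (rproj x))))"
  proof (rule integrable_on_body[where M = "DIM('a) * (norm b / inradius * M)"])
    show "\<bar>DIM('a) * (dir_deriv b x * g (rproj x))\<bar> \<le> DIM('a) * (norm b / inradius * M)" for x
      unfolding abs_mult using dir_deriv_abs[of b x] M(2)[OF rproj_closure] inradius by (intro mult_mono) auto
  qed auto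
  then show "set_integrable lebesgue K (\<lambda>x. surface_density x * ((outward_normal K (radial_projection K c x) \<bullet> b) * g (radial_projection K c x)))"
    using set_integral_lebesgue_convex(2)[OF convex m eq] by (simp add: interior_iff_gauge[abs_def] set_eq_iff Collect_mem_eq indicator_def)
qed

end

section \<open>Surface integrals over a common face\<close>

text \<open>The affine map that fixes the hyperplane \<open>x \<bullet> m = b\<close> and sends \<open>c\<close> to \<open>c'\<close>. It carries the cone with apex
  \<open>c\<close> over a subset of the hyperplane to the cone with apex \<open>c'\<close>, and it scales volumes by the ratio of the
  heights, which is what the density of \<^const>\<open>surface_integral\<close> compensates.\<close>

definition face_map :: "'a::euclidean_space \<Rightarrow> 'a \<Rightarrow> 'a \<Rightarrow> real \<Rightarrow> 'a \<Rightarrow> 'a" where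
  "face_map c c' m b x = x + ((b - x \<bullet> m) / (b - c \<bullet> m)) *\<^sub>R (c' - c)"

text \<open>An affine map that fixes \<open>y\<close> and sends \<open>c\<close> to
  \<open>c'\<close> keeps the ray parameter \<open>s\<close>. In both bodies this parameter is the
  gauge of the point, so the truncation of the cones to the interiors is respected too.\<close>

lemma face_map_cone:
  assumes "b \<noteq> c \<bullet> m" "y \<bullet> m = b"
  shows "face_map c c' m b (c + s *\<^sub>R (y - c)) = c' + s *\<^sub>R (y - c')"
proof -
  have "b - (c + s *\<^sub>R (y - c)) \<bullet> m = (1 - s) * (b - c \<bullet> m)"
    using assms(2) by (simp add: inner_simps algebra_simps)
  then have "(b - (c + s *\<^sub>R (y - c)) \<bullet> m) / (b - c \<bullet> m) = 1 - s"
    using assms(1) by simp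
  then have "face_map c c' m b (c + s *\<^sub>R (y - c)) = c + s *\<^sub>R (y - c) + (1 - s) *\<^sub>R (c' - c)"
    unfolding face_map_def by simp
  then show ?thesis by (simp add: algebra_simps)
qed

lemma face_map_rank_one:
  fixes c c' m x :: "'a::euclidean_space"
  assumes "b \<noteq> c \<bullet> m"
  defines "L \<equiv> rank_one_map m (- (1 / (b - c \<bullet> m)) *\<^sub>R (c' - c))"
  shows "face_map c c' m b x = (c' - L c) + L x"
proof -
  have "c' - L c + L x = x + (c' - c) + (c \<bullet> m / (b - c \<bullet> m) - x \<bullet> m / (b - c \<bullet> m)) *\<^sub>R (c' - c)"
    by (simp add: L_def rank_one_map_def scaleR_left_diff_distrib)
  also have "(c \<bullet> m / (b - c \<bullet> m) - x \<bullet> m / (b - c \<bullet> m)) = (b - x \<bullet> m) / (b - c \<bullet> m) - 1"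
  proof -
    define h where "h = b - c \<bullet> m"
    have "b = h + c \<bullet> m" "h \<noteq> 0" using assms(1) by (auto simp: h_def)
    then show ?thesis by (simp add: add_divide_distrib diff_divide_distrib)
  qed
  finally show ?thesis by (simp add: face_map_def scaleR_left_diff_distrib)
qed

text \<open>\<open>S\<close> lies in the closure of \<open>K\<close> and in a supporting hyperplane
  with outward normal \<open>m\<close>. It may be of lower dimension, as for cells that meet in a
  vertex; the cone over it is then null, and no case distinction arises.\<close>

locale body_face = convex_body K c for K :: "'a::euclidean_space set" and c :: 'a +
  fixes S :: "'a set" and m :: 'a and b :: real
  assumes normal: "norm m = 1" and S_borel [measurable]: "S \<in> sets borel" and S_closure: "S \<subseteq> closure K"
    and body_below: "\<And>x. x \<in> K \<Longrightarrow> x \<bullet> m \<le> b" and S_level: "\<And>x. x \<in> S \<Longrightarrow> x \<bullet> m = b"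
begin

lemma face_supporting: "y \<in> S \<Longrightarrow> supporting_normal K y m"
  using body_below S_level normal by (auto simp: supporting_normal_def inner_simps)

lemma apex_below: "c \<bullet> m < b"
proof -
  have "c + inradius *\<^sub>R m \<in> K"
    using inradius normal by (intro subsetD[OF inradius(2)]) (auto simp: dist_norm)
  then have "(c + inradius *\<^sub>R m) \<bullet> m \<le> b" by (rule body_below)
  then show ?thesis using inradius normal by (simp add: inner_simps norm_eq_1)
qed

lemma face_gauge: "y \<in> S \<Longrightarrow> gauge_fun y = 1"
proof -
  assume y: "y \<in> S"
  have "b - c \<bullet> m \<le> gauge_fun y * (b - c \<bullet> m)"
    using supporting_normal_gauge_le[OF face_supporting[OF y], of y] S_level[OF y] by (simp add: inner_simps)
  then have "gauge_fun y \<ge> 1" using apex_below by simp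
  moreover have "gauge_fun y \<le> 1" using y S_closure closure_iff_gauge by auto
  ultimately show ?thesis by simp
qed

lemma face_cone:
  assumes y: "y \<in> S" and s: "0 < s"
  shows "gauge_fun (c + s *\<^sub>R (y - c)) = s" "rproj (c + s *\<^sub>R (y - c)) = y"
  using face_gauge[OF y] gauge_scale[of s y] rproj_scale[OF s, of y] s by (simp_all add: rproj_def)

lemma cone_decompose:
  assumes "rproj x \<in> S"
  shows "x = c + gauge_fun x *\<^sub>R (rproj x - c)" "gauge_fun x > 0"
proof -
  have "x \<noteq> c" using assms face_gauge[of c] by (auto simp: rproj_def)
  then show "gauge_fun x > 0" by (rule gauge_pos)
  then show "x = c + gauge_fun x *\<^sub>R (rproj x - c)" by (simp add: rproj_def)
qed

definition cone_part :: "('a \<Rightarrow> real) \<Rightarrow> 'a \<Rightarrow> real" where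
  "cone_part B x = indicator (interior K) x * (indicator S (rproj x) * B (rproj x))"

lemma cone_part_measurable [measurable (raw)]: "B \<in> borel_measurable borel \<Longrightarrow> cone_part B \<in> borel_measurable borel"
proof -
  assume [measurable]: "B \<in> borel_measurable borel"
  have [measurable]: "interior K \<in> sets borel" by simp
  show ?thesis unfolding cone_part_def by measurable
qed

lemma cone_part_cone:
  assumes "y \<in> S" "0 < s"
  shows "cone_part B (c + s *\<^sub>R (y - c)) = (if s < 1 then B y else 0)"
  using assms face_cone[OF assms] by (simp add: cone_part_def interior_iff_gauge indicator_def)

lemma cone_part_nonzero:
  assumes "cone_part B x \<noteq> 0"
  obtains y s where "y \<in> S" "0 < s" "x = c + s *\<^sub>R (y - c)"
  using assms cone_decompose[of x] by (auto simp: cone_part_def indicator_def split: if_splits)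

text \<open>On a flat face the height \<open>(y - c) \<bullet> m\<close> is the constant
  \<open>b - c \<bullet> m\<close>, so the density of the surface integral is constant over the
  cone.\<close>

lemma AE_face_density:
  "AE x in lborel. x \<in> interior K \<longrightarrow>
     surface_density x * (indicator S (radial_projection K c x) * B (radial_projection K c x))
     = DIM('a) / (b - c \<bullet> m) * (indicator S (rproj x) * B (rproj x))"
  using AE_surface_density_normal
proof eventually_elim
  case (elim x)
  show ?case
  proof
    assume x: "x \<in> interior K"
    show "surface_density x * (indicator S (radial_projection K c x) * B (radial_projection K c x))
     = DIM('a) / (b - c \<bullet> m) * (indicator S (rproj x) * B (rproj x))"
    proof (cases "rproj x \<in> S")
      case True
      have "outward_normal K (rproj x) = m"
        using elim x face_supporting[OF True] by (intro outward_normal_eqI) auto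
      then have "surface_density x = DIM('a) / (b - c \<bullet> m)"
        using elim x S_level[OF True] by (simp add: surface_density_def inner_simps)
      then show ?thesis using elim x by simp
    qed (use elim x in simp)
  qed
qed

lemma face_integral:
  assumes [measurable]: "B \<in> borel_measurable borel"
  shows "(LINT x:K|lebesgue. surface_density x * (indicator S (radial_projection K c x) * B (radial_projection K c x)))
    = DIM('a) / (b - c \<bullet> m) * (LINT x|lborel. cone_part B x)"
proof -
  have m: "(\<lambda>x. DIM('a) / (b - c \<bullet> m) * (indicator S (rproj x) * B (rproj x))) \<in> borel_measurable borel" by measurable
  show ?thesis
    unfolding set_integral_lebesgue_convex(1)[OF convex m AE_face_density] cone_part_def
    by (simp add: mult.left_commute)
qed

lemma face_integrable:
  assumes [measurable]: "B \<in> borel_measurable borel" and "\<And>y. y \<in> S \<Longrightarrow> \<bar>B y\<bar> \<le> M"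
  shows "set_integrable lebesgue K (\<lambda>x. surface_density x * (indicator S (radial_projection K c x) * B (radial_projection K c x)))"
proof -
  have m: "(\<lambda>x. DIM('a) / (b - c \<bullet> m) * (indicator S (rproj x) * B (rproj x))) \<in> borel_measurable borel" by measurable
  have "integrable lborel (\<lambda>x. indicator (interior K) x *\<^sub>R (DIM('a) / (b - c \<bullet> m) * (indicator S (rproj x) * B (rproj x))))"
  proof (rule integrable_bounded_support[where S = "interior K" and B = "DIM('a) / (b - c \<bullet> m) * max 0 M"])
    fix x
    have "\<bar>indicator S (rproj x) * B (rproj x)\<bar> \<le> max 0 M"
      using assms(2)[of "rproj x"] by (auto simp: indicator_def)
    then have "\<bar>DIM('a) / (b - c \<bullet> m)\<bar> * \<bar>indicator S (rproj x) * B (rproj x)\<bar> \<le> DIM('a) / (b - c \<bullet> m) * max 0 M"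
      using apex_below by (intro mult_mono) auto
    then show "\<bar>indicator (interior K) x *\<^sub>R (DIM('a) / (b - c \<bullet> m) * (indicator S (rproj x) * B (rproj x)))\<bar> \<le> DIM('a) / (b - c \<bullet> m) * max 0 M"
      if "x \<in> interior K" using that by (simp add: abs_mult)
  qed (use bounded bounded_interior m in auto)
  then show ?thesis
    using set_integral_lebesgue_convex(2)[OF convex m AE_face_density] by blast
qed

end

text \<open>Pulling \<open>cone_part\<close> of \<open>K'\<close> back along \<open>face_map\<close>
  gives \<open>cone_part\<close> of \<open>K\<close>; the volume factor is the ratio of the heights
  and cancels the two densities. For the second claim the exceptional set in the cone of
  \<open>K\<close> is contained in the image of the one in the cone of \<open>K'\<close> under a
  differentiable map, hence is negligible for an arbitrary \<open>P\<close>.\<close>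

lemma
  fixes K K' :: "(real^'d) set"
  assumes K: "body_face K c S m b" and K': "body_face K' c' S (- m) (- b)"
  shows face_integral_transfer: "B \<in> borel_measurable borel \<Longrightarrow>
      (LINT x:K|lebesgue. convex_body.surface_density K c x * (indicator S (radial_projection K c x) * B (radial_projection K c x)))
    = (LINT x:K'|lebesgue. convex_body.surface_density K' c' x * (indicator S (radial_projection K' c' x) * B (radial_projection K' c' x)))"
    and face_AE_transfer: "AE x in lborel. x \<in> interior K' \<longrightarrow> convex_body.rproj K' c' x \<in> S \<longrightarrow> P (convex_body.rproj K' c' x) \<Longrightarrow>
      AE x in lborel. x \<in> interior K \<longrightarrow> convex_body.rproj K c x \<in> S \<longrightarrow> P (convex_body.rproj K c x)"
proof -
  interpret A: body_face K c S m b by (rule K)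
  interpret A': body_face K' c' S "- m" "- b" by (rule K')
  have h: "b - c \<bullet> m > 0" "c' \<bullet> m - b > 0" using A.apex_below A'.apex_below by auto
  let ?w = "- (1 / (b - c \<bullet> m)) *\<^sub>R (c' - c)"
  let ?L = "rank_one_map m ?w"
  \<comment> \<open>The value is negative because the apexes lie on opposite sides of the
    hyperplane. The map reverses orientation, and the absolute value of its determinant is the ratio
    of the heights.\<close>
  have w: "1 + ?w \<bullet> m = - ((c' \<bullet> m - b) / (b - c \<bullet> m))"
  proof -
    define h where "h = b - c \<bullet> m"
    have "b = h + c \<bullet> m" "h \<noteq> 0" using \<open>b - c \<bullet> m > 0\<close> by (auto simp: h_def)
    then show ?thesis by (simp add: inner_simps add_divide_distrib diff_divide_distrib)
  qed
  have w0: "1 + ?w \<bullet> m \<noteq> 0" using h unfolding w by simp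
  have lin: "linear ?L" "inj ?L" using linear_rank_one_map inj_rank_one_map[OF w0] by auto
  have sc: "linear_scale ?L = (c' \<bullet> m - b) / (b - c \<bullet> m)"
    using linear_scale_rank_one_map[OF A.normal w0] h unfolding w by simp
  have fm: "face_map c c' m b x = (c' - ?L c) + ?L x" for x
    using h by (intro face_map_rank_one) auto
  have cone: "face_map c c' m b (c + s *\<^sub>R (y - c)) = c' + s *\<^sub>R (y - c')" if "y \<in> S" for s y
    using A.S_level[OF that] h by (intro face_map_cone) auto
  have inj: "face_map c c' m b x = face_map c c' m b z \<Longrightarrow> x = z" for x z
    using injD[OF lin(2)] unfolding fm by simp
  {
    assume B[measurable]: "B \<in> borel_measurable borel"
    have eq: "A'.cone_part B (face_map c c' m b x) = A.cone_part B x" for x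
    proof (cases "\<exists>y s. y \<in> S \<and> 0 < s \<and> x = c + s *\<^sub>R (y - c)")
      case True
      then obtain y s where ys: "y \<in> S" "0 < s" "x = c + s *\<^sub>R (y - c)" by blast
      then show ?thesis
        unfolding ys(3) cone[OF ys(1)] by (simp add: A.cone_part_cone A'.cone_part_cone)
    next
      case False
      then have "A.cone_part B x = 0" using A.cone_part_nonzero by metis
      moreover have "A'.cone_part B (face_map c c' m b x) = 0"
      proof (rule ccontr)
        assume "A'.cone_part B (face_map c c' m b x) \<noteq> 0"
        then obtain y s where ys: "y \<in> S" "0 < s" "face_map c c' m b x = c' + s *\<^sub>R (y - c')"
          by (rule A'.cone_part_nonzero)
        then have "face_map c c' m b x = face_map c c' m b (c + s *\<^sub>R (y - c))" using cone by simp
        then have "x = c + s *\<^sub>R (y - c)" by (rule inj)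
        then show False using ys False by blast
      qed
      ultimately show ?thesis by simp
    qed
    have "(LINT x|lborel. A'.cone_part B x) = linear_scale ?L * (LINT x|lborel. A'.cone_part B ((c' - ?L c) + ?L x))"
      by (rule lborel_integral_affine_image[OF lin]) measurable
    also have "\<dots> = (c' \<bullet> m - b) / (b - c \<bullet> m) * (LINT x|lborel. A.cone_part B x)"
      unfolding fm[symmetric] eq sc ..
    finally have I: "(LINT x|lborel. A'.cone_part B x) = (c' \<bullet> m - b) / (b - c \<bullet> m) * (LINT x|lborel. A.cone_part B x)" .
    have h': "- b - c' \<bullet> (- m) = c' \<bullet> m - b" by simp
    show "(LINT x:K|lebesgue. A.surface_density x * (indicator S (radial_projection K c x) * B (radial_projection K c x)))
      = (LINT x:K'|lebesgue. A'.surface_density x * (indicator S (radial_projection K' c' x) * B (radial_projection K' c' x)))"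
      unfolding A.face_integral[OF B] A'.face_integral[OF B] I h' using h by simp
  next
    assume AE: "AE x in lborel. x \<in> interior K' \<longrightarrow> A'.rproj x \<in> S \<longrightarrow> P (A'.rproj x)"
    define N where "N = {x. x \<in> interior K \<and> A.rproj x \<in> S \<and> \<not> P (A.rproj x)}"
    define N' where "N' = {x. x \<in> interior K' \<and> A'.rproj x \<in> S \<and> \<not> P (A'.rproj x)}"
    have "AE x in lebesgue. x \<notin> N'"
      using AE by (intro AE_completion) (auto simp: N'_def elim!: eventually_mono)
    then have "N' \<in> null_sets lebesgue" by (simp add: completion.null_sets_iff_AE)
    then have N': "negligible N'" by (simp add: negligible_iff_null_sets)
    have cone': "face_map c' c (- m) (- b) (c' + s *\<^sub>R (y - c')) = c + s *\<^sub>R (y - c)" if "y \<in> S" for s y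
      using A'.S_level[OF that] h by (intro face_map_cone) auto
    have "N \<subseteq> face_map c' c (- m) (- b) ` N'"
    proof
      fix x assume x: "x \<in> N"
      let ?y = "A.rproj x" and ?s = "A.gauge_fun x"
      have y: "?y \<in> S" "\<not> P ?y" and s1: "?s < 1" using x by (auto simp: N_def A.interior_iff_gauge)
      have d: "x = c + ?s *\<^sub>R (?y - c)" and s0: "?s > 0" using A.cone_decompose[OF y(1)] by auto
      have "c' + ?s *\<^sub>R (?y - c') \<in> N'"
        using A'.face_cone[OF y(1) s0] s1 y by (simp add: N'_def A'.interior_iff_gauge)
      moreover have "x = face_map c' c (- m) (- b) (c' + ?s *\<^sub>R (?y - c'))"
        using d cone'[OF y(1), of ?s] by simp
      ultimately show "x \<in> face_map c' c (- m) (- b) ` N'" by (rule image_eqI[rotated])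
    qed
    moreover have "negligible (face_map c' c (- m) (- b) ` N')"
    proof (rule negligible_differentiable_image_negligible[OF _ N'])
      have "\<exists>D. (face_map c' c (- m) (- b) has_derivative D) (at x within N')" for x
        unfolding face_map_def by (rule exI) (use h in \<open>auto intro!: derivative_eq_intros\<close>)
      then show "face_map c' c (- m) (- b) differentiable_on N'"
        by (auto simp: differentiable_on_def differentiable_def)
    qed simp
    ultimately have "N \<in> null_sets lebesgue"
      using negligible_subset by (auto simp: negligible_iff_null_sets[symmetric])
    then have "AE x in lebesgue. x \<notin> N" by (rule AE_not_in)
    then have "AE x in lborel. x \<notin> N" by (simp add: AE_completion_iff)
    then show "AE x in lborel. x \<in> interior K \<longrightarrow> A.rproj x \<in> S \<longrightarrow> P (A.rproj x)"
      by eventually_elim (simp add: N_def)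
  }
qed

section \<open>Traces on the boundary and integrals over time slabs\<close>

text \<open>If the inner normal ray missed the interior, a separating hyperplane would support
  \<open>K\<close> at \<open>x\<close>. Smoothness makes \<open>outward_normal K x\<close> its
  normal, but moving against this direction leads strictly to the side of \<open>K\<close>. Once one
  point of the ray is interior, so is the open segment between it and \<open>x\<close>.\<close>

lemma smooth_inner_ray:
  fixes K :: "'a::euclidean_space set"
  assumes K: "convex K" "interior K \<noteq> {}" and x: "x \<in> closure K" and sm: "smooth_at K x"
  shows "\<forall>\<^sub>F e in at_right 0. x - e *\<^sub>R outward_normal K x \<in> interior K"
proof -
  let ?n = "outward_normal K x"
  have n: "norm ?n = 1" using outward_normal_supporting[OF sm] by (simp add: supporting_normal_def)
  have "\<exists>e0>0. x - e0 *\<^sub>R ?n \<in> interior K"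
  proof (rule ccontr)
    assume none: "\<not> (\<exists>e0>0. x - e0 *\<^sub>R ?n \<in> interior K)"
    let ?R = "(\<lambda>e. x - e *\<^sub>R ?n) ` {0<..}"
    have "convex ?R"
    proof -
      have "convex ((\<lambda>e. e *\<^sub>R (- ?n)) ` {0::real<..})"
        by (intro convex_linear_image linearI) (auto simp: algebra_simps)
      from convex_translation[OF this, of x] show ?thesis by (simp add: image_image)
    qed
    then obtain a b where ab: "a \<noteq> 0" "\<forall>y\<in>interior K. a \<bullet> y \<le> b" "\<forall>y\<in>?R. b \<le> a \<bullet> y"
      using separating_hyperplane_sets[of "interior K" ?R] K none by (auto simp: convex_interior)
    have "closed {y. a \<bullet> y \<le> b}" by (intro closed_Collect_le continuous_intros)
    then have "closure (interior K) \<subseteq> {y. a \<bullet> y \<le> b}"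
      using ab(2) by (intro closure_minimal) auto
    then have le: "a \<bullet> y \<le> b" if "y \<in> closure K" for y
      using that by (auto simp: convex_closure_interior[OF K])
    have ge: "b \<le> a \<bullet> x - e * (a \<bullet> ?n)" if "e > 0" for e
      using ab(3) that by (auto simp: inner_simps)
    have eq: "a \<bullet> x = b"
    proof (rule antisym)
      show "a \<bullet> x \<le> b" by (rule le[OF x])
      have "((\<lambda>e. a \<bullet> x - e * (a \<bullet> ?n)) \<longlongrightarrow> a \<bullet> x - 0 * (a \<bullet> ?n)) (at_right 0)"
        by (intro tendsto_intros)
      then show "b \<le> a \<bullet> x"
        using ge by (intro tendsto_lowerbound[of _ "a \<bullet> x" "at_right 0"]) (auto simp: eventually_at_right_field intro!: exI[of _ 1])
    qed
    have "supporting_normal K x ((1 / norm a) *\<^sub>R a)"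
      unfolding supporting_normal_def
      using ab(1) le eq closure_subset[of K] by (auto simp: inner_simps inner_commute divide_simps)
    then have "(1 / norm a) *\<^sub>R a = ?n" using outward_normal_eqI[OF sm] by simp
    then have "norm a *\<^sub>R ?n = norm a *\<^sub>R ((1 / norm a) *\<^sub>R a)" by simp
    then have "a = norm a *\<^sub>R ?n" using ab(1) by simp
    then have "a \<bullet> ?n = norm a * (?n \<bullet> ?n)" by (metis inner_scaleR_left)
    then have "a \<bullet> ?n > 0" using ab(1) n by (simp add: norm_eq_1)
    then show False using ge[of 1] eq by simp
  qed
  then obtain e0 where e0: "e0 > 0" "x - e0 *\<^sub>R ?n \<in> interior K" by blast
  have "x - e *\<^sub>R ?n \<in> interior K" if "0 < e" "e < e0" for e
  proof -
    have "x - e *\<^sub>R ?n = (1 - (1 - e / e0)) *\<^sub>R (x - e0 *\<^sub>R ?n) + (1 - e / e0) *\<^sub>R x"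
      using e0 by (simp add: algebra_simps)
    moreover have "x - e0 *\<^sub>R ?n \<noteq> x" using e0 n by auto
    ultimately have "x - e *\<^sub>R ?n \<in> open_segment (x - e0 *\<^sub>R ?n) x"
      using that e0 unfolding in_segment by (intro conjI exI[of _ "1 - e / e0"]) auto
    then show ?thesis using in_interior_closure_convex_segment[OF K(1) e0(2) x] by blast
  qed
  then show ?thesis using e0 by (auto simp: eventually_at_right_field)
qed

lemma Lim_at_right_eqI:
  fixes l :: "'b::t2_space"
  assumes "(g \<longlongrightarrow> l) (at_right (a::real))" "\<forall>\<^sub>F e in at_right a. g e = f e"
  shows "Lim (at_right a) f = l"
  by (intro tendsto_Lim Lim_transform_eventually[OF assms]) simp

lemma inner_trace_smooth:
  assumes K: "convex K" "interior K \<noteq> {}" and x: "x \<in> closure K" and sm: "smooth_at K x"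
    and p: "continuous_on UNIV p" and v: "\<And>y. y \<in> K \<Longrightarrow> v y t = p y"
  shows "inner_trace K v x t = p x"
  unfolding inner_trace_def
proof (rule Lim_at_right_eqI)
  have "isCont p x" using p by (simp add: continuous_on_eq_continuous_at)
  moreover have "((\<lambda>e. x - e *\<^sub>R outward_normal K x) \<longlongrightarrow> x - 0 *\<^sub>R outward_normal K x) (at_right 0)"
    by (intro tendsto_intros)
  ultimately show "((\<lambda>e. p (x - e *\<^sub>R outward_normal K x)) \<longlongrightarrow> p x) (at_right 0)"
    by (intro isCont_tendsto_compose[of x p]) auto
  show "\<forall>\<^sub>F e in at_right 0. p (x - e *\<^sub>R outward_normal K x) = v (x - e *\<^sub>R outward_normal K x) t"
    using smooth_inner_ray[OF K x sm]
    by eventually_elim (use v interior_subset in \<open>metis subsetD\<close>)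
qed

text \<open>With opposite normals the outer ray of \<open>K\<close> is literally the inner ray of
  \<open>K'\<close>.\<close>

lemma outer_trace_opposite:
  "outward_normal K x = - outward_normal K' x \<Longrightarrow> outer_trace K v x t = inner_trace K' v x t"
  by (simp add: outer_trace_def inner_trace_def)

text \<open>The complement of \<open>C\<close> is open, so both rays start in the region where
  \<open>v\<close> is constant, whatever the direction of the normal.\<close>

lemma traces_outside:
  assumes C: "closed C" "x \<notin> C" and v: "\<And>y. y \<notin> C \<Longrightarrow> v y t = vs"
  shows "inner_trace K v x t = vs" "outer_trace K v x t = vs"
proof -
  have "\<forall>\<^sub>F e in at_right 0. vs = v (x + e *\<^sub>R n) t" for n
  proof -
    have "((\<lambda>e. x + e *\<^sub>R n) \<longlongrightarrow> x + 0 *\<^sub>R n) (at_right 0)"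
      by (intro tendsto_intros)
    then have "\<forall>\<^sub>F e in at_right 0. x + e *\<^sub>R n \<in> - C"
      using C by (intro topological_tendstoD) auto
    then show ?thesis by eventually_elim (simp add: v)
  qed
  from this[of "outward_normal K x"] this[of "- outward_normal K x"]
  show "inner_trace K v x t = vs" "outer_trace K v x t = vs"
    unfolding inner_trace_def outer_trace_def by (auto intro!: Lim_at_right_eqI[OF tendsto_const])
qed

lemma set_integral_cong_AE_convex:
  fixes K :: "'a::euclidean_space set" and f g :: "'a \<Rightarrow> real"
  assumes K: "convex K" and g: "set_integrable lebesgue K g" and eq: "AE x in lborel. x \<in> interior K \<longrightarrow> f x = g x"
  shows "(LINT x:K|lebesgue. f x) = (LINT x:K|lebesgue. g x)"
proof -
  have "AE x in lborel. indicator K x *\<^sub>R f x = indicator K x *\<^sub>R g x"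
    using eq convex_interior_lborel[OF K] by eventually_elim (auto simp: indicator_def)
  then have AE: "AE x in lebesgue. indicator K x *\<^sub>R f x = indicator K x *\<^sub>R g x" by (rule AE_completion)
  have gm: "(\<lambda>x. indicator K x *\<^sub>R g x) \<in> borel_measurable lebesgue"
    using g unfolding set_integrable_def by (rule borel_measurable_integrable)
  show ?thesis
    unfolding set_lebesgue_integral_def
    by (rule integral_cong_AE[OF lebesgue_measurable_cong_AE[OF gm AE] gm AE])
qed

lemma time_set_integral:
  fixes f :: "real \<Rightarrow> real"
  assumes [measurable]: "f \<in> borel_measurable borel"
  shows "(LINT t:{a..<b}|lebesgue. f t) = (LINT t|lborel. indicator {a..<b} t * f t)"
    and "set_integrable lebesgue {a..<b} f \<longleftrightarrow> integrable lborel (\<lambda>t. indicator {a..<b} t * f t)"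
proof -
  have m: "(\<lambda>t. indicator {a..<b} t * f t) \<in> borel_measurable lborel" by measurable
  show "(LINT t:{a..<b}|lebesgue. f t) = (LINT t|lborel. indicator {a..<b} t * f t)"
    unfolding set_lebesgue_integral_def real_scaleR_def by (rule integral_completion[OF m])
  show "set_integrable lebesgue {a..<b} f \<longleftrightarrow> integrable lborel (\<lambda>t. indicator {a..<b} t * f t)"
    unfolding set_integrable_def real_scaleR_def by (rule integrable_completion[OF m])
qed

lemma
  fixes \<Phi> :: "'a::euclidean_space \<times> real \<Rightarrow> real"
  assumes \<Phi>[measurable]: "\<Phi> \<in> borel_measurable borel" and S: "S \<in> sets borel" "bounded S"
    and B: "\<And>x t. x \<in> S \<Longrightarrow> t \<in> {a..<b} \<Longrightarrow> \<bar>\<Phi> (x, t)\<bar> \<le> B"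
  shows slab_integrable: "set_integrable lebesgue {a..<b} (\<lambda>t. LINT x|lborel. indicator S x * \<Phi> (x, t))"
    and slab_Fubini: "(LINT t:{a..<b}|lebesgue. LINT x|lborel. indicator S x * \<Phi> (x, t))
      = (LINT x|lborel. indicator S x * (LINT t|lborel. indicator {a..<b} t * \<Phi> (x, t)))"
proof -
  note [measurable] = S(1)
  let ?F = "\<lambda>z. indicator (S \<times> {a..<b}) z * \<Phi> z"
  have SP: "S \<times> {a..<b} \<in> sets borel" using S(1) by (intro borel_Times) auto
  have "integrable lborel ?F"
  proof (rule integrable_bounded_support[where S = "S \<times> {a..<b}" and B = B])
    show "?F \<in> borel_measurable borel" using SP by (intro borel_measurable_times borel_measurable_indicator \<Phi>)
  qed (use S B in \<open>auto intro!: bounded_Times\<close>)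
  then have F: "integrable (lborel \<Otimes>\<^sub>M lborel) ?F" by (simp add: lborel_prod)
  have F': "integrable (lborel \<Otimes>\<^sub>M lborel) (\<lambda>(x, t). indicator S x * (indicator {a..<b} t * \<Phi> (x, t)))"
    by (rule Bochner_Integration.integrable_cong[THEN iffD1, OF refl _ F]) (auto simp: indicator_def)
  have [measurable]: "(\<lambda>t. LINT x|lborel. indicator S x * \<Phi> (x, t)) \<in> borel_measurable borel"
  proof -
    have "(\<lambda>t. LINT x|lborel. indicator S x * \<Phi> (x, t)) \<in> borel_measurable lborel"
      by (rule lborel.borel_measurable_lebesgue_integral) (simp add: borel_prod[symmetric], measurable)
    then show ?thesis by simp
  qed
  have eq: "indicator {a..<b} t * (LINT x|lborel. indicator S x * \<Phi> (x, t)) = (LINT x|lborel. indicator S x * (indicator {a..<b} t * \<Phi> (x, t)))" for t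
    by (simp add: indicator_def)
  show "set_integrable lebesgue {a..<b} (\<lambda>t. LINT x|lborel. indicator S x * \<Phi> (x, t))"
    using lborel_pair.integrable_snd[OF F'] by (simp add: time_set_integral eq)
  show "(LINT t:{a..<b}|lebesgue. LINT x|lborel. indicator S x * \<Phi> (x, t))
      = (LINT x|lborel. indicator S x * (LINT t|lborel. indicator {a..<b} t * \<Phi> (x, t)))"
    using lborel_pair.Fubini_integral[OF F'] by (simp add: time_set_integral eq)
qed

lemma set_integral_cell_lborel:
  fixes g :: "'a::euclidean_space \<times> real \<Rightarrow> real"
  assumes "convex K" "continuous_on UNIV g"
  shows "(LINT x:K|lebesgue. g (x, t)) = (LINT x|lborel. indicator (interior K) x * g (x, t))"
proof -
  have "continuous_on UNIV (\<lambda>x::'a. (x, t))"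
    by (intro continuous_on_Pair continuous_on_id continuous_on_const)
  then have "continuous_on UNIV (\<lambda>x. g (x, t))" by (rule continuous_on_compose2[OF assms(2)]) simp
  then have m: "(\<lambda>x. g (x, t)) \<in> borel_measurable borel" by (rule borel_measurable_continuous_onI)
  show ?thesis using set_integral_lebesgue_convex(1)[OF assms(1) m, of "\<lambda>x. g (x, t)"] by simp
qed

lemma space_time_integrable:
  fixes g :: "'a::euclidean_space \<times> real \<Rightarrow> real"
  assumes K: "convex K" "bounded K" and g: "continuous_on UNIV g"
  shows "set_integrable lebesgue {a..<b} (\<lambda>t. LINT x:K|lebesgue. g (x, t))"
proof -
  obtain B where B: "\<And>z. z \<in> K \<times> {a..b} \<Longrightarrow> \<bar>g z\<bar> \<le> B"
    using continuous_compact_bound[OF g, of "K \<times> {a..b}"] bounded_Times[OF K(2) bounded_closed_interval] by metis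
  have "\<bar>g (x, t)\<bar> \<le> B" if "x \<in> interior K" "t \<in> {a..<b}" for x t
    using that interior_subset[of K] by (intro B) auto
  from slab_integrable[OF borel_measurable_continuous_onI[OF g] _ bounded_interior[OF K(2)] this]
  show ?thesis by (simp add: set_integral_cell_lborel[OF K(1) g])
qed

section \<open>Flux balance on a slab\<close>

text \<open>A name for the very choice made inside \<open>surface_integral\<close>, so that its apex
  can be addressed.\<close>

definition center :: "'a::euclidean_space set \<Rightarrow> 'a" where
  "center K = (SOME c. c \<in> interior K)"

lemma convex_body_center:
  assumes "convex K" "bounded K" "interior K \<noteq> {}"
  shows "convex_body K (center K)"
proof
  show "center K \<in> interior K"
    unfolding center_def by (rule someI_ex) (use assms(3) in blast)
qed (use assms in auto)

lemma surface_integral_density: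
  assumes "convex_body K (center K)"
  shows "surface_integral K g
    = (LINT x:K|lebesgue. convex_body.surface_density K (center K) x * g (radial_projection K (center K) x))"
proof -
  have c: "(SOME c. c \<in> interior K) = center K" by (simp only: center_def)
  show ?thesis
    unfolding surface_integral_def Let_def c by (simp only: convex_body.surface_density_def[OF assms])
qed

definition separates :: "(real^'d) set \<Rightarrow> (real^'d) set \<Rightarrow> (real^'d) \<times> real \<Rightarrow> bool" where
  "separates K K' = (\<lambda>(m, b). norm m = 1 \<and> (\<forall>x\<in>K. x \<bullet> m \<le> b) \<and> (\<forall>x\<in>K'. b \<le> x \<bullet> m))"

text \<open>The choices for a pair and for the reversed pair are independent. That their normals are
  opposite is derived only at smooth points of the common face, in
  \<open>face_flux_pair\<close>.\<close>

definition separator :: "(real^'d) set \<Rightarrow> (real^'d) set \<Rightarrow> (real^'d) \<times> real" where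
  "separator K K' = (SOME mb. separates K K' mb)"

lemma separator:
  assumes "convex K" "convex K'" "K \<noteq> {}" "K' \<noteq> {}" "K \<inter> K' = {}"
  shows "separates K K' (separator K K')"
proof -
  obtain a b where ab: "a \<noteq> 0" "\<forall>x\<in>K. a \<bullet> x \<le> b" "\<forall>x\<in>K'. b \<le> a \<bullet> x"
    using separating_hyperplane_sets[OF assms] by blast
  have "separates K K' ((1 / norm a) *\<^sub>R a, b / norm a)"
    using ab by (auto simp: separates_def inner_commute divide_right_mono)
  then show ?thesis unfolding separator_def by (rule someI[of "separates K K'"])
qed

text \<open>One time slab \<open>[t0, t1)\<close> with cells \<open>M\<close>. Outside \<open>C\<close> the solution has the constant value \<open>vs\<close>, so at boundary points
  of cells that lie on the boundary of the domain both traces equal \<open>vs\<close>.\<close>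

locale slab =
  fixes \<Omega> :: "(real^'d) set" and M :: "(real^'d) set set" and C :: "(real^'d) set"
    and v :: "real^'d \<Rightarrow> real \<Rightarrow> real^'m" and vs :: "real^'m" and t0 t1 :: real
    and p :: "(real^'d) set \<Rightarrow> (real^'d) \<times> real \<Rightarrow> real^'m"
  assumes open_domain: "open \<Omega>" and finite_cells: "finite M" and disjoint_cells: "disjoint M"
    and cell_convex: "K \<in> M \<Longrightarrow> convex K" and cell_bounded: "K \<in> M \<Longrightarrow> bounded K"
    and cell_interior: "K \<in> M \<Longrightarrow> interior K \<noteq> {}"
    and cover: "\<Omega> \<subseteq> (\<Union>K\<in>M. closure K)"
    and C: "closed C" "C \<subseteq> \<Omega>"
    and outside: "t \<in> {t0..<t1} \<Longrightarrow> x \<notin> C \<Longrightarrow> v x t = vs"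
    and p_cont: "K \<in> M \<Longrightarrow> continuous_on UNIV (p K)"
    and p_eq: "K \<in> M \<Longrightarrow> x \<in> K \<Longrightarrow> t \<in> {t0..<t1} \<Longrightarrow> v x t = p K (x, t)"
begin

lemma body: "K \<in> M \<Longrightarrow> convex_body K (center K)"
  using convex_body_center[OF cell_convex cell_bounded cell_interior] by blast

lemma p_cont_x:
  assumes "K \<in> M"
  shows "continuous_on UNIV (\<lambda>x. p K (x, t))"
proof -
  have 1: "continuous_on UNIV (\<lambda>x::real^'d. (x, t))"
    by (intro continuous_on_Pair continuous_on_id continuous_on_const)
  show ?thesis by (rule continuous_on_compose2[OF p_cont[OF assms] 1]) simp
qed

abbreviation "fnormal K K' \<equiv> fst (separator K K')"
abbreviation "flevel K K' \<equiv> snd (separator K K')"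
abbreviation "face K K' \<equiv> closure K \<inter> closure K'"

lemma separated:
  assumes "K \<in> M" "K' \<in> M" "K \<noteq> K'"
  shows "norm (fnormal K K') = 1" "x \<in> closure K \<Longrightarrow> x \<bullet> fnormal K K' \<le> flevel K K'"
    "x \<in> closure K' \<Longrightarrow> flevel K K' \<le> x \<bullet> fnormal K K'"
proof -
  have "K \<inter> K' = {}" using disjoint_cells assms by (auto simp: disjoint_def)
  then have sep: "separates K K' (separator K K')"
    using cell_interior[OF assms(1)] cell_interior[OF assms(2)]
    by (intro separator cell_convex[OF assms(1)] cell_convex[OF assms(2)]) auto
  show "norm (fnormal K K') = 1" using sep by (auto simp: separates_def split: prod.splits)
  show "x \<bullet> fnormal K K' \<le> flevel K K'" if "x \<in> closure K"
  proof -
    have "closed {x. x \<bullet> fnormal K K' \<le> flevel K K'}" by (intro closed_Collect_le continuous_intros)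
    then have "closure K \<subseteq> {x. x \<bullet> fnormal K K' \<le> flevel K K'}"
      using sep by (intro closure_minimal) (auto simp: separates_def split: prod.splits)
    then show ?thesis using that by blast
  qed
  show "flevel K K' \<le> x \<bullet> fnormal K K'" if "x \<in> closure K'"
  proof -
    have "closed {x. flevel K K' \<le> x \<bullet> fnormal K K'}" by (intro closed_Collect_le continuous_intros)
    then have "closure K' \<subseteq> {x. flevel K K' \<le> x \<bullet> fnormal K K'}"
      using sep by (intro closure_minimal) (auto simp: separates_def split: prod.splits)
    then show ?thesis using that by blast
  qed
qed

lemma body_face:
  assumes "K \<in> M" "K' \<in> M" "K \<noteq> K'"
  shows "body_face K (center K) (face K K') (fnormal K K') (flevel K K')"
    and "body_face K' (center K') (face K K') (- fnormal K K') (- flevel K K')"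
proof -
  note sep = separated[OF assms]
  interpret A: convex_body K "center K" by (rule body[OF assms(1)])
  interpret A': convex_body K' "center K'" by (rule body[OF assms(2)])
  have level: "x \<bullet> fnormal K K' = flevel K K'" if "x \<in> face K K'" for x
    using sep(2,3)[of x] that by auto
  have closed: "face K K' \<in> sets borel" by (intro borel_closed closed_Int closed_closure)
  show "body_face K (center K) (face K K') (fnormal K K') (flevel K K')"
  proof
    show "norm (fnormal K K') = 1" by (rule sep(1))
    show "x \<bullet> fnormal K K' \<le> flevel K K'" if "x \<in> K" for x
      by (rule sep(2)[OF subsetD[OF closure_subset that]])
  qed (use level closed in auto)
  show "body_face K' (center K') (face K K') (- fnormal K K') (- flevel K K')"
  proof
    show "norm (- fnormal K K') = 1" using sep(1) by simp
    show "x \<bullet> (- fnormal K K') \<le> - flevel K K'" if "x \<in> K'" for x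
      using sep(3)[OF subsetD[OF closure_subset that]] by simp
    show "x \<bullet> (- fnormal K K') = - flevel K K'" if "x \<in> face K K'" for x
      using level[OF that] by simp
  qed (use closed in auto)
qed

text \<open>Otherwise a neighbourhood of \<open>x\<close> in the domain would avoid the finitely
  many other closures and be covered by \<open>closure K\<close> alone, which makes \<open>x\<close>
  an interior point of the convex set \<open>K\<close>.\<close>

lemma frontier_in_other_cell:
  assumes K: "K \<in> M" and x: "x \<in> frontier K" "x \<in> \<Omega>"
  shows "\<exists>K'\<in>M - {K}. x \<in> closure K'"
proof (rule ccontr)
  assume no: "\<not> ?thesis"
  let ?F = "\<Union>K'\<in>M - {K}. closure K'"
  have "open (\<Omega> - ?F)" using open_domain finite_cells by (intro open_Diff closed_UN) auto
  moreover have "\<Omega> - ?F \<subseteq> closure K" using cover by auto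
  moreover have "x \<in> \<Omega> - ?F" using no x by auto
  ultimately have "x \<in> interior (closure K)" using interiorI by blast
  then show False using x by (simp add: frontier_def convex_interior_closure cell_convex K)
qed

text \<open>Smoothness of the neighbour \<open>K'\<close> holds almost everywhere in the cone of
  \<open>K'\<close>, and \<open>face_AE_transfer\<close> moves it to the cone of \<open>K\<close>.
  Where both cells are smooth, the separating hyperplane supports both, so its normal and the
  opposite vector are the two outward normals.\<close>

lemma AE_face_smooth:
  assumes "K \<in> M"
  shows "AE x in lborel. x \<in> interior K \<longrightarrow> (let y = convex_body.rproj K (center K) x in
     x \<noteq> center K \<and> radial_projection K (center K) x = y \<and> y \<in> frontier K \<and> smooth_at K y \<and>
     (\<forall>K'\<in>M - {K}. y \<in> closure K' \<longrightarrow> smooth_at K' y \<and> outward_normal K y = fnormal K K' \<and> outward_normal K' y = - fnormal K K'))"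
proof -
  interpret A: convex_body K "center K" by (rule body[OF assms])
  have "AE x in lborel. x \<in> interior K \<longrightarrow> A.rproj x \<in> face K K' \<longrightarrow> smooth_at K' (A.rproj x)"
    if "K' \<in> M - {K}" for K'
  proof (rule face_AE_transfer)
    show "body_face K (center K) (face K K') (fnormal K K') (flevel K K')"
      "body_face K' (center K') (face K K') (- fnormal K K') (- flevel K K')"
      using body_face[of K K'] assms that by auto
    interpret A': convex_body K' "center K'" using that by (intro body) auto
    show "AE x in lborel. x \<in> interior K' \<longrightarrow> A'.rproj x \<in> face K K' \<longrightarrow> smooth_at K' (A'.rproj x)"
      using A'.AE_surface_density_normal by eventually_elim auto
  qed
  then have "AE x in lborel. \<forall>K'\<in>M - {K}. x \<in> interior K \<longrightarrow> A.rproj x \<in> face K K' \<longrightarrow> smooth_at K' (A.rproj x)"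
    using finite_cells by (intro AE_finite_allI) auto
  then show ?thesis
    using A.AE_surface_density_normal
  proof eventually_elim
    case (elim x)
    show ?case
    proof
      assume x: "x \<in> interior K"
      define y where "y = A.rproj x"
      have y: "x \<noteq> center K" "radial_projection K (center K) x = y" "smooth_at K y"
        using elim x by (auto simp: y_def)
      have yf: "y \<in> frontier K" using A.radial_projection_frontier[OF y(1)] y(2) by simp
      have "smooth_at K' y \<and> outward_normal K y = fnormal K K' \<and> outward_normal K' y = - fnormal K K'"
        if K': "K' \<in> M - {K}" "y \<in> closure K'" for K'
      proof -
        interpret F: body_face K "center K" "face K K'" "fnormal K K'" "flevel K K'"
          using body_face[of K K'] assms K' by auto
        interpret F': body_face K' "center K'" "face K K'" "- fnormal K K'" "- flevel K K'"
          using body_face[of K K'] assms K' by auto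
        have yf: "y \<in> face K K'" using yf K' by (simp add: frontier_def)
        have sm: "smooth_at K' y" using elim(1) K' x yf by (auto simp: y_def)
        show ?thesis
          using sm outward_normal_eqI[OF y(3) F.face_supporting[OF yf]] outward_normal_eqI[OF sm F'.face_supporting[OF yf]] by simp
      qed
      then show "let y = A.rproj x in
     x \<noteq> center K \<and> radial_projection K (center K) x = y \<and> y \<in> frontier K \<and> smooth_at K y \<and>
     (\<forall>K'\<in>M - {K}. y \<in> closure K' \<longrightarrow> smooth_at K' y \<and> outward_normal K y = fnormal K K' \<and> outward_normal K' y = - fnormal K K')"
        using y yf unfolding y_def[symmetric] Let_def by blast
    qed
  qed
qed

text \<open>Both cells contain the beginning of the same inner normal ray, against disjointness.
  Consequently a boundary point where \<open>K\<close> and all adjoining cells are smooth has at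
  most one neighbouring cell.\<close>

lemma smooth_face_unique:
  assumes K: "K' \<in> M" "K'' \<in> M" and y: "y \<in> closure K'" "y \<in> closure K''"
    and sm: "smooth_at K' y" "smooth_at K'' y" and n: "outward_normal K' y = outward_normal K'' y"
  shows "K' = K''"
proof (rule ccontr)
  assume ne: "K' \<noteq> K''"
  have "\<forall>\<^sub>F e in at_right 0. y - e *\<^sub>R outward_normal K' y \<in> interior K' \<and> y - e *\<^sub>R outward_normal K' y \<in> interior K''"
  proof (rule eventually_conj)
    show "\<forall>\<^sub>F e in at_right 0. y - e *\<^sub>R outward_normal K' y \<in> interior K'"
      by (rule smooth_inner_ray[OF cell_convex[OF K(1)] cell_interior[OF K(1)] y(1) sm(1)])
    show "\<forall>\<^sub>F e in at_right 0. y - e *\<^sub>R outward_normal K' y \<in> interior K''"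
      unfolding n by (rule smooth_inner_ray[OF cell_convex[OF K(2)] cell_interior[OF K(2)] y(2) sm(2)])
  qed
  from eventually_happens'[OF trivial_limit_at_right_real this]
  obtain e :: real where "y - e *\<^sub>R outward_normal K' y \<in> interior K'" "y - e *\<^sub>R outward_normal K' y \<in> interior K''"
    by blast
  then have "y - e *\<^sub>R outward_normal K' y \<in> K' \<inter> K''" using interior_subset by blast
  then show False using disjoint_cells ne K by (auto simp: disjoint_def)
qed

end

text \<open>Covers both test functions at once. \<Theta> is the remainder \<open>excess\<close>,
  \<open>G\<close> a field that depends on the inner state only, and \<open>gd\<close> contains its
  partial derivatives along the cell polynomials. \<Theta> is only asked to be measurable and
  bounded on bounded sets, in accordance with what is known of \<open>D\<close>.\<close>

locale slab_flux = slab \<Omega> M C v vs t0 t1 p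
  for \<Omega> :: "(real^'d) set" and M C and v :: "real^'d \<Rightarrow> real \<Rightarrow> real^'m" and vs t0 t1 p +
  fixes \<Theta> :: "real^'m \<Rightarrow> real^'m \<Rightarrow> real^'d \<Rightarrow> real" and G :: "'d \<Rightarrow> real^'m \<Rightarrow> real"
    and gd :: "(real^'d) set \<Rightarrow> 'd \<Rightarrow> (real^'d) \<times> real \<Rightarrow> real"
  assumes \<Theta>_measurable: "norm n = 1 \<Longrightarrow> (\<lambda>(a, b). \<Theta> a b n) \<in> borel_measurable borel"
    and \<Theta>_bounded: "norm n = 1 \<Longrightarrow> \<exists>B. \<forall>a b. norm a \<le> R \<longrightarrow> norm b \<le> R \<longrightarrow> \<bar>\<Theta> a b n\<bar> \<le> B"
    and \<Theta>_outside: "norm n = 1 \<Longrightarrow> \<Theta> vs vs n = 0"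
    and G_cont: "continuous_on UNIV (G k)"
    and gd_cont: "K \<in> M \<Longrightarrow> continuous_on UNIV (gd K k)"
    and gd: "K \<in> M \<Longrightarrow> ((\<lambda>s. G k (p K (x + s *\<^sub>R axis k 1, t))) has_real_derivative gd K k (x, t)) (at 0)"
begin

definition flux_integrand :: "(real^'d) set \<Rightarrow> real \<Rightarrow> real^'d \<Rightarrow> real" where
  "flux_integrand K t x = \<Theta> (inner_trace K v x t) (outer_trace K v x t) (outward_normal K x)
     + (\<Sum>k\<in>UNIV. outward_normal K x $ k * G k (inner_trace K v x t))"

definition face_value :: "(real^'d) set \<Rightarrow> (real^'d) set \<Rightarrow> real \<Rightarrow> real^'d \<Rightarrow> real" where
  "face_value K K' t y = \<Theta> (p K (y, t)) (p K' (y, t)) (fnormal K K')"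

definition face_flux :: "(real^'d) set \<Rightarrow> (real^'d) set \<Rightarrow> real \<Rightarrow> real" where
  "face_flux K K' t = (LINT x:K|lebesgue. convex_body.surface_density K (center K) x *
     (indicator (face K K') (radial_projection K (center K) x) * face_value K K' t (radial_projection K (center K) x)))"

lemma face_value_joint_measurable:
  assumes "K \<in> M" "K' \<in> M" "K \<noteq> K'"
  shows "(\<lambda>(y, t). face_value K K' t y) \<in> borel_measurable borel"
proof -
  have "(\<lambda>z. (p K z, p K' z)) \<in> borel \<rightarrow>\<^sub>M borel"
    by (intro borel_measurable_continuous_onI continuous_on_Pair p_cont assms)
  from measurable_compose[OF this \<Theta>_measurable[OF separated(1)[OF assms]]]
  show ?thesis by (simp add: face_value_def split_beta')
qed

lemma face_value_measurable:
  assumes "K \<in> M" "K' \<in> M" "K \<noteq> K'"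
  shows "face_value K K' t \<in> borel_measurable borel"
proof -
  have "(\<lambda>y::real^'d. (y, t)) \<in> borel \<rightarrow>\<^sub>M borel" by (intro borel_measurable_continuous_onI continuous_intros)
  from measurable_compose[OF this face_value_joint_measurable[OF assms]] show ?thesis by simp
qed

lemma face_value_bounded:
  assumes "K \<in> M" "K' \<in> M" "K \<noteq> K'"
  obtains B where "\<And>y t. y \<in> closure K \<Longrightarrow> t \<in> {t0..t1} \<Longrightarrow> \<bar>face_value K K' t y\<bar> \<le> B"
proof -
  have cpt: "compact (closure K \<times> {t0..t1})"
    using cell_bounded[OF assms(1)] by (intro compact_Times) (auto simp: compact_closure)
  have bp: "bounded (p L ` (closure K \<times> {t0..t1}))" if "L \<in> M" for L
    by (intro compact_imp_bounded compact_continuous_image cpt continuous_on_subset[OF p_cont[OF that]]) simp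
  obtain R1 where R1: "\<forall>z\<in>closure K \<times> {t0..t1}. norm (p K z) \<le> R1"
    using bp[OF assms(1)] unfolding bounded_iff by (simp only: ball_simps(9)) blast
  obtain R2 where R2: "\<forall>z\<in>closure K \<times> {t0..t1}. norm (p K' z) \<le> R2"
    using bp[OF assms(2)] unfolding bounded_iff by (simp only: ball_simps(9)) blast
  obtain B where B: "\<And>a b. norm a \<le> max R1 R2 \<Longrightarrow> norm b \<le> max R1 R2 \<Longrightarrow> \<bar>\<Theta> a b (fnormal K K')\<bar> \<le> B"
    using \<Theta>_bounded[OF separated(1)[OF assms], of "max R1 R2"] by blast
  show ?thesis
  proof (rule that[of B])
    fix y t assume "y \<in> closure K" "t \<in> {t0..t1}"
    then have "norm (p K (y, t)) \<le> R1" "norm (p K' (y, t)) \<le> R2" using R1 R2 by auto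
    then show "\<bar>face_value K K' t y\<bar> \<le> B" unfolding face_value_def by (intro B) auto
  qed
qed

text \<open>Almost every boundary point lies on the closure of exactly one other cell or outside the
  domain. In the first case the outer trace is the polynomial of that neighbour, which splits the
  \<Theta> part into face fluxes; the \<open>G\<close> part is left to
  \<open>divergence_cone\<close>.\<close>

lemma surface_integral_flux:
  assumes K: "K \<in> M" and t: "t \<in> {t0..<t1}"
  shows "surface_integral K (flux_integrand K t)
    = (\<Sum>K'\<in>M - {K}. face_flux K K' t) + (\<Sum>k\<in>UNIV. LINT x:K|lebesgue. gd K k (x, t))"
proof -
  interpret A: convex_body K "center K" by (rule body[OF K])
  let ?c = "center K"
  let ?rp = "radial_projection K ?c"
  define f1 where "f1 K' x = A.surface_density x * (indicator (face K K') (?rp x) * face_value K K' t (?rp x))" for K' x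
  define f2 where "f2 k x = A.surface_density x * ((outward_normal K (?rp x) \<bullet> axis k 1) * G k (p K (?rp x, t)))" for k x
  have i1: "set_integrable lebesgue K (f1 K')" if "K' \<in> M - {K}" for K'
  proof -
    have K': "K' \<in> M" "K \<noteq> K'" using that by auto
    interpret F: body_face K "center K" "face K K'" "fnormal K K'" "flevel K K'"
      using body_face[of K K'] K K' by auto
    obtain B where "\<And>y t. y \<in> closure K \<Longrightarrow> t \<in> {t0..t1} \<Longrightarrow> \<bar>face_value K K' t y\<bar> \<le> B"
      using face_value_bounded[OF K K'] by blast
    then show ?thesis
      unfolding f1_def using t by (intro F.face_integrable[OF face_value_measurable[OF K K'], where M = B]) auto
  qed
  have gpc: "continuous_on UNIV (\<lambda>x. G k (p K (x, t)))" "continuous_on UNIV (\<lambda>x. gd K k (x, t))" for k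
  proof -
    have "continuous_on UNIV (\<lambda>x::real^'d. (x, t))"
      by (intro continuous_on_Pair continuous_on_id continuous_on_const)
    then show "continuous_on UNIV (\<lambda>x. gd K k (x, t))" by (rule continuous_on_compose2[OF gd_cont[OF K]]) simp
    show "continuous_on UNIV (\<lambda>x. G k (p K (x, t)))" by (rule continuous_on_compose2[OF G_cont p_cont_x[OF K]]) simp
  qed
  have i2: "set_integrable lebesgue K (f2 k)" "(LINT x:K|lebesgue. f2 k x) = (LINT x:K|lebesgue. gd K k (x, t))" for k
    unfolding f2_def by (rule A.divergence_cone[OF _ gd[OF K] gpc]; simp)+
  have i1s: "set_integrable lebesgue K (\<lambda>x. \<Sum>K'\<in>M - {K}. f1 K' x)"
    using i1 unfolding set_integrable_def scaleR_sum_right by (intro Bochner_Integration.integrable_sum) auto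
  have i2s: "set_integrable lebesgue K (\<lambda>x. \<Sum>k\<in>UNIV. f2 k x)"
    using i2(1) unfolding set_integrable_def scaleR_sum_right by (intro Bochner_Integration.integrable_sum) auto
  have eq: "AE x in lborel. x \<in> interior K \<longrightarrow>
      A.surface_density x * flux_integrand K t (?rp x) = (\<Sum>K'\<in>M - {K}. f1 K' x) + (\<Sum>k\<in>UNIV. f2 k x)"
    using AE_face_smooth[OF K]
  proof eventually_elim
    case (elim x)
    show ?case
    proof
      assume x: "x \<in> interior K"
      define y where "y = A.rproj x"
      have y: "?rp x = y" "y \<in> frontier K" "smooth_at K y" "y \<in> closure K"
        and oth: "\<And>K'. K' \<in> M - {K} \<Longrightarrow> y \<in> closure K' \<Longrightarrow> smooth_at K' y \<and> outward_normal K y = fnormal K K' \<and> outward_normal K' y = - fnormal K K'"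
        using elim x by (auto simp: y_def Let_def frontier_def)
      have inn: "inner_trace K v y t = p K (y, t)"
        by (rule inner_trace_smooth[OF cell_convex[OF K] cell_interior[OF K] y(4,3) p_cont_x[OF K]])
          (use p_eq K t in auto)
      have "\<Theta> (inner_trace K v y t) (outer_trace K v y t) (outward_normal K y)
          = (\<Sum>K'\<in>M - {K}. indicator (face K K') y * face_value K K' t y)"
      proof (cases "\<exists>K'\<in>M - {K}. y \<in> closure K'")
        case True
        then obtain K' where K': "K' \<in> M - {K}" "y \<in> closure K'" by blast
        have uni: "K'' = K'" if "K'' \<in> M - {K}" "y \<in> closure K''" for K''
          using smooth_face_unique[of K'' K' y] oth[OF that] oth[OF K'] that K' by auto
        have "outer_trace K v y t = inner_trace K' v y t"
          using oth[OF K'] by (intro outer_trace_opposite) simp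
        also have "\<dots> = p K' (y, t)"
          using K' oth[OF K'] t
          by (intro inner_trace_smooth[OF cell_convex cell_interior _ _ p_cont_x]) (auto simp: p_eq)
        finally have "\<Theta> (inner_trace K v y t) (outer_trace K v y t) (outward_normal K y) = face_value K K' t y"
          using oth[OF K'] inn by (simp add: face_value_def)
        also have "\<dots> = (\<Sum>K''\<in>M - {K}. if K'' = K' then face_value K K' t y else 0)"
          using K' finite_cells by simp
        also have "\<dots> = (\<Sum>K'\<in>M - {K}. indicator (face K K') y * face_value K K' t y)"
        proof (rule sum.cong[OF refl])
          fix L assume L: "L \<in> M - {K}"
          show "(if L = K' then face_value K K' t y else 0) = indicator (face K L) y * face_value K L t y"
          proof (cases "y \<in> closure L")
            case True
            then have "L = K'" using uni[OF L] by blast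
            then show ?thesis using True y(4) by simp
          next
            case False
            then have "L \<noteq> K'" using K' by blast
            then show ?thesis using False by simp
          qed
        qed
        finally show ?thesis .
      next
        \<comment> \<open>No neighbour means a point outside the domain, thus outside
          \<open>C\<close>: both traces equal \<open>vs\<close>, where \<Theta> vanishes.\<close>
        case False
        then have "y \<notin> \<Omega>" using frontier_in_other_cell[OF K y(2)] by blast
        then have yC: "y \<notin> C" using C by blast
        have "inner_trace K v y t = vs" "outer_trace K v y t = vs"
          using traces_outside[where C = C and v = v and vs = vs and t = t and x = y, OF C(1) yC] outside[OF t] by blast+
        moreover have "norm (outward_normal K y) = 1"
          using outward_normal_supporting[OF y(3)] by (simp add: supporting_normal_def)
        ultimately have "\<Theta> (inner_trace K v y t) (outer_trace K v y t) (outward_normal K y) = 0"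
          using \<Theta>_outside by simp
        also have "\<dots> = (\<Sum>K'\<in>M - {K}. indicator (face K K') y * face_value K K' t y)"
          using False by (intro sum.neutral[symmetric]) auto
        finally show ?thesis .
      qed
      then show "A.surface_density x * flux_integrand K t (?rp x) = (\<Sum>K'\<in>M - {K}. f1 K' x) + (\<Sum>k\<in>UNIV. f2 k x)"
        unfolding flux_integrand_def f1_def f2_def y(1) inn
        by (simp add: distrib_left sum_distrib_left inner_axis)
    qed
  qed
  have "surface_integral K (flux_integrand K t) = (LINT x:K|lebesgue. A.surface_density x * flux_integrand K t (?rp x))"
    by (rule surface_integral_density[OF A.convex_body_axioms])
  also have "\<dots> = (LINT x:K|lebesgue. (\<Sum>K'\<in>M - {K}. f1 K' x) + (\<Sum>k\<in>UNIV. f2 k x))"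
    by (rule set_integral_cong_AE_convex[OF A.convex set_integral_add(1)[OF i1s i2s] eq])
  also have "\<dots> = (LINT x:K|lebesgue. \<Sum>K'\<in>M - {K}. f1 K' x) + (LINT x:K|lebesgue. \<Sum>k\<in>UNIV. f2 k x)"
    by (rule set_integral_add(2)[OF i1s i2s])
  also have "(LINT x:K|lebesgue. \<Sum>K'\<in>M - {K}. f1 K' x) = (\<Sum>K'\<in>M - {K}. LINT x:K|lebesgue. f1 K' x)"
    using i1 unfolding set_lebesgue_integral_def set_integrable_def scaleR_sum_right
    by (intro Bochner_Integration.integral_sum) auto
  also have "(LINT x:K|lebesgue. \<Sum>k\<in>UNIV. f2 k x) = (\<Sum>k\<in>UNIV. LINT x:K|lebesgue. f2 k x)"
    using i2(1) unfolding set_lebesgue_integral_def set_integrable_def scaleR_sum_right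
    by (intro Bochner_Integration.integral_sum) auto
  finally show ?thesis by (simp add: face_flux_def f1_def i2(2))
qed

text \<open>The constant density on a face turns the flux into a space integral of a jointly Borel
  function of point and time, to which Fubini's theorem applies.\<close>

lemma face_flux_integrable:
  assumes "K \<in> M" "K' \<in> M" "K \<noteq> K'"
  shows "set_integrable lebesgue {t0..<t1} (face_flux K K')"
proof -
  interpret F: body_face K "center K" "face K K'" "fnormal K K'" "flevel K K'"
    by (rule body_face[OF assms])
  define \<Phi> where "\<Phi> = (\<lambda>z. indicator (face K K') (F.rproj (fst z)) * face_value K K' (snd z) (F.rproj (fst z)))"
  obtain B where B: "\<And>y t. y \<in> closure K \<Longrightarrow> t \<in> {t0..t1} \<Longrightarrow> \<bar>face_value K K' t y\<bar> \<le> B"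
    using face_value_bounded[OF assms] by blast
  have [measurable]: "fst \<in> (borel :: ((real^'d) \<times> real) measure) \<rightarrow>\<^sub>M borel" "snd \<in> (borel :: ((real^'d) \<times> real) measure) \<rightarrow>\<^sub>M borel"
    by (intro borel_measurable_continuous_onI continuous_intros)+
  have "(\<lambda>z. (F.rproj (fst z), snd z)) \<in> (borel :: ((real^'d) \<times> real) measure) \<rightarrow>\<^sub>M borel"
    by (intro borel_measurable_Pair) measurable
  from measurable_compose[OF this face_value_joint_measurable[OF assms]]
  have [measurable]: "(\<lambda>z. face_value K K' (snd z) (F.rproj (fst z))) \<in> borel_measurable (borel :: ((real^'d) \<times> real) measure)" by simp
  have "\<Phi> \<in> borel_measurable borel" unfolding \<Phi>_def by measurable
  then have "set_integrable lebesgue {t0..<t1} (\<lambda>t. LINT x|lborel. indicator (interior K) x * \<Phi> (x, t))"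
    by (rule slab_integrable[where B = "max 0 B"])
      (use B F.bounded bounded_interior in \<open>auto simp: \<Phi>_def indicator_def intro: F.rproj_closure le_max_iff_disj[THEN iffD2]\<close>)
  then have "set_integrable lebesgue {t0..<t1} (\<lambda>t. DIM(real^'d) / (flevel K K' - center K \<bullet> fnormal K K') * (LINT x|lborel. indicator (interior K) x * \<Phi> (x, t)))"
    by (rule set_integrable_mult_right)
  then show ?thesis
    unfolding face_flux_def F.face_integral[OF face_value_measurable[OF assms]]
    by (simp add: F.cone_part_def[abs_def] \<Phi>_def)
qed

lemma volume_flux_integrable:
  "K \<in> M \<Longrightarrow> set_integrable lebesgue {t0..<t1} (\<lambda>t. LINT x:K|lebesgue. gd K k (x, t))"
  by (rule space_time_integrable[OF cell_convex cell_bounded gd_cont])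

text \<open>Symmetrisation over ordered pairs saves choosing an orientation for each face. The
  factor \<open>2\<close> is harmless, as only a sign or a vanishing sum is at stake.\<close>

lemma sum_pairs:
  fixes h :: "(real^'d) set \<Rightarrow> (real^'d) set \<Rightarrow> real"
  shows "2 * (\<Sum>K\<in>M. \<Sum>K'\<in>M - {K}. h K K') = (\<Sum>K\<in>M. \<Sum>K'\<in>M - {K}. h K K' + h K' K)"
proof -
  have d: "(\<Sum>K'\<in>M. if K' = K then 0 else g K') = (\<Sum>K'\<in>M - {K}. g K')" if "K \<in> M" for K and g :: "(real^'d) set \<Rightarrow> real"
    using finite_cells that by (subst sum.remove[of M K]) (auto intro!: sum.cong)
  have "(\<Sum>K\<in>M. \<Sum>K'\<in>M - {K}. h K' K) = (\<Sum>K\<in>M. \<Sum>K'\<in>M. if K' = K then 0 else h K' K)"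
    by (intro sum.cong refl d[symmetric])
  also have "\<dots> = (\<Sum>K'\<in>M. \<Sum>K\<in>M. if K' = K then 0 else h K' K)" by (rule sum.swap)
  also have "\<dots> = (\<Sum>K'\<in>M. \<Sum>K\<in>M. if K = K' then 0 else h K' K)" by (simp only: eq_commute)
  also have "\<dots> = (\<Sum>K\<in>M. \<Sum>K'\<in>M - {K}. h K K')"
    by (intro sum.cong refl d)
  finally show ?thesis by (simp add: sum.distrib)
qed

text \<open>After the transfer both fluxes are integrals over the cone of \<open>K\<close>. At
  almost every point of the cone that projects to the face the two separating normals are opposite,
  so the joint integrand is the nonnegative density times
  \<open>\<Theta> a b n + \<Theta> b a (- n)\<close>.\<close>

lemma face_flux_pair:
  assumes "K \<in> M" "K' \<in> M" "K \<noteq> K'" and t: "t \<in> {t0..<t1}"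
  shows "(\<And>a b n. norm n = 1 \<Longrightarrow> \<Theta> a b n + \<Theta> b a (- n) \<ge> 0) \<Longrightarrow> face_flux K K' t + face_flux K' K t \<ge> 0"
    and "(\<And>a b n. norm n = 1 \<Longrightarrow> \<Theta> a b n + \<Theta> b a (- n) = 0) \<Longrightarrow> face_flux K K' t + face_flux K' K t = 0"
proof -
  interpret F: body_face K "center K" "face K K'" "fnormal K K'" "flevel K K'"
    by (rule body_face[OF assms(1-3)])
  have K'K: "K' \<in> M" "K \<in> M" "K' \<noteq> K" using assms by auto
  let ?rp = "radial_projection K (center K)"
  let ?sd = F.surface_density
  have tr: "face_flux K' K t = (LINT x:K|lebesgue. ?sd x * (indicator (face K K') (?rp x) * face_value K' K t (?rp x)))"
    unfolding face_flux_def Int_commute[of "closure K'"]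
    by (rule face_integral_transfer[OF body_face[OF assms(1-3)] face_value_measurable[OF K'K], symmetric])
  obtain B1 where B1: "\<And>y t. y \<in> closure K \<Longrightarrow> t \<in> {t0..t1} \<Longrightarrow> \<bar>face_value K K' t y\<bar> \<le> B1"
    using face_value_bounded[OF assms(1-3)] by blast
  obtain B2 where B2: "\<And>y t. y \<in> closure K' \<Longrightarrow> t \<in> {t0..t1} \<Longrightarrow> \<bar>face_value K' K t y\<bar> \<le> B2"
    using face_value_bounded[OF K'K] by blast
  define S where "S x = ?sd x * (indicator (face K K') (?rp x) * face_value K K' t (?rp x))
     + ?sd x * (indicator (face K K') (?rp x) * face_value K' K t (?rp x))" for x
  have i1: "set_integrable lebesgue K (\<lambda>x. ?sd x * (indicator (face K K') (?rp x) * face_value K K' t (?rp x)))"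
    by (rule F.face_integrable[OF face_value_measurable[OF assms(1-3)], where M = B1]) (use B1 t in auto)
  have i2: "set_integrable lebesgue K (\<lambda>x. ?sd x * (indicator (face K K') (?rp x) * face_value K' K t (?rp x)))"
    by (rule F.face_integrable[OF face_value_measurable[OF K'K], where M = B2]) (use B2 t in auto)
  have sum: "face_flux K K' t + face_flux K' K t = (LINT x:K|lebesgue. S x)"
    unfolding tr S_def set_integral_add(2)[OF i1 i2] by (simp add: face_flux_def)
  have AE: "AE x in lborel. x \<in> interior K \<longrightarrow> ?sd x \<ge> 0 \<and>
      (?rp x \<in> face K K' \<longrightarrow> fnormal K' K = - fnormal K K')"
    using AE_face_smooth[OF assms(1)]
  proof eventually_elim
    case (elim x)
    show ?case
    proof (intro impI conjI)
      assume x: "x \<in> interior K"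
      let ?y = "F.rproj x"
      have y: "?rp x = ?y" "smooth_at K ?y"
        and oth: "?y \<in> closure K' \<Longrightarrow> smooth_at K' ?y \<and> outward_normal K' ?y = - fnormal K K'"
        using elim x K'K by (auto simp: Let_def)
      show "?sd x \<ge> 0"
        using F.supporting_normal_ge_inradius[OF outward_normal_supporting[OF y(2)]] F.inradius(1)
        by (simp add: F.surface_density_def y(1))
      assume f: "?rp x \<in> face K K'"
      interpret F': body_face K' "center K'" "face K' K" "fnormal K' K" "flevel K' K"
        by (rule body_face[OF K'K])
      have "smooth_at K' ?y \<and> outward_normal K' ?y = - fnormal K K'" using oth f y by simp
      moreover have "supporting_normal K' ?y (fnormal K' K)"
        using f y by (intro F'.face_supporting) auto
      ultimately show "fnormal K' K = - fnormal K K'" using outward_normal_eqI by metis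
    qed
  qed
  have S: "S x = ?sd x * (indicator (face K K') (?rp x) * (\<Theta> (p K (?rp x, t)) (p K' (?rp x, t)) (fnormal K K')
      + \<Theta> (p K' (?rp x, t)) (p K (?rp x, t)) (fnormal K' K)))" for x
    by (simp add: S_def face_value_def algebra_simps)
  have n: "norm (fnormal K K') = 1" by (rule F.normal)
  { assume nn: "\<And>a b n. norm n = 1 \<Longrightarrow> \<Theta> a b n + \<Theta> b a (- n) \<ge> 0"
    \<comment> \<open>Exchanging \<open>S\<close> for its absolute value turns a sign known almost
      everywhere into one that holds pointwise.\<close>
    have "AE x in lborel. x \<in> interior K \<longrightarrow> S x = \<bar>S x\<bar>"
      using AE by eventually_elim (use nn[OF n] in \<open>auto simp: S indicator_def abs_mult\<close>)
    moreover have "set_integrable lebesgue K (\<lambda>x. \<bar>S x\<bar>)"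
      unfolding S_def using set_integral_add(1)[OF i1 i2] by (rule set_integrable_abs)
    ultimately have "(LINT x:K|lebesgue. S x) = (LINT x:K|lebesgue. \<bar>S x\<bar>)"
      by (intro set_integral_cong_AE_convex F.convex)
    also have "\<dots> \<ge> 0" unfolding set_lebesgue_integral_def by (intro integral_nonneg_AE) simp
    finally show "face_flux K K' t + face_flux K' K t \<ge> 0" using sum by simp
  next
    assume zz: "\<And>a b n. norm n = 1 \<Longrightarrow> \<Theta> a b n + \<Theta> b a (- n) = 0"
    have "AE x in lborel. x \<in> interior K \<longrightarrow> S x = 0"
      using AE by eventually_elim (use zz[OF n] in \<open>auto simp: S indicator_def\<close>)
    then have "(LINT x:K|lebesgue. S x) = (LINT x:K|lebesgue. 0)"
      by (intro set_integral_cong_AE_convex F.convex) (auto simp: set_integrable_def)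
    then show "face_flux K K' t + face_flux K' K t = 0" using sum by simp
  }
qed

text \<open>Symmetrised over ordered pairs, the face fluxes have a known sign at every time; apart
  from this sign only the divergence terms of the cells remain.\<close>

lemma flux_balance:
  shows "(\<And>a b n. norm n = 1 \<Longrightarrow> \<Theta> a b n + \<Theta> b a (- n) \<ge> 0) \<Longrightarrow>
     (\<Sum>K\<in>M. LINT t:{t0..<t1}|lebesgue. surface_integral K (flux_integrand K t))
     \<ge> (\<Sum>K\<in>M. \<Sum>k\<in>UNIV. LINT t:{t0..<t1}|lebesgue. LINT x:K|lebesgue. gd K k (x, t))"
    and "(\<And>a b n. norm n = 1 \<Longrightarrow> \<Theta> a b n + \<Theta> b a (- n) = 0) \<Longrightarrow>
     (\<Sum>K\<in>M. LINT t:{t0..<t1}|lebesgue. surface_integral K (flux_integrand K t))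
     = (\<Sum>K\<in>M. \<Sum>k\<in>UNIV. LINT t:{t0..<t1}|lebesgue. LINT x:K|lebesgue. gd K k (x, t))"
proof -
  let ?V = "\<lambda>K k t. LINT x:K|lebesgue. gd K k (x, t)"
  let ?I = "\<lambda>f. LINT t:{t0..<t1}|lebesgue. f t"
  have split: "?I (\<lambda>t. surface_integral K (flux_integrand K t))
      = (\<Sum>K'\<in>M - {K}. ?I (face_flux K K')) + (\<Sum>k\<in>UNIV. ?I (?V K k))" if K: "K \<in> M" for K
  proof -
    have i1: "set_integrable lebesgue {t0..<t1} (\<lambda>t. \<Sum>K'\<in>M - {K}. face_flux K K' t)"
      using face_flux_integrable[OF K] unfolding set_integrable_def scaleR_sum_right
      by (intro Bochner_Integration.integrable_sum) auto
    have i2: "set_integrable lebesgue {t0..<t1} (\<lambda>t. \<Sum>k\<in>UNIV. ?V K k t)"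
      using volume_flux_integrable[OF K] unfolding set_integrable_def scaleR_sum_right
      by (intro Bochner_Integration.integrable_sum) auto
    have "?I (\<lambda>t. surface_integral K (flux_integrand K t))
        = ?I (\<lambda>t. (\<Sum>K'\<in>M - {K}. face_flux K K' t) + (\<Sum>k\<in>UNIV. ?V K k t))"
      using surface_integral_flux[OF K] by (intro set_lebesgue_integral_cong) auto
    also have "\<dots> = ?I (\<lambda>t. \<Sum>K'\<in>M - {K}. face_flux K K' t) + ?I (\<lambda>t. \<Sum>k\<in>UNIV. ?V K k t)"
      by (rule set_integral_add(2)[OF i1 i2])
    also have "?I (\<lambda>t. \<Sum>K'\<in>M - {K}. face_flux K K' t) = (\<Sum>K'\<in>M - {K}. ?I (face_flux K K'))"
      using face_flux_integrable[OF K] unfolding set_integrable_def set_lebesgue_integral_def scaleR_sum_right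
      by (intro Bochner_Integration.integral_sum) auto
    also have "?I (\<lambda>t. \<Sum>k\<in>UNIV. ?V K k t) = (\<Sum>k\<in>UNIV. ?I (?V K k))"
      using volume_flux_integrable[OF K] unfolding set_integrable_def set_lebesgue_integral_def scaleR_sum_right
      by (intro Bochner_Integration.integral_sum) auto
    finally show ?thesis .
  qed
  have pair: "?I (face_flux K K') + ?I (face_flux K' K) = ?I (\<lambda>t. face_flux K K' t + face_flux K' K t)"
    if "K \<in> M" "K' \<in> M - {K}" for K K'
    using that face_flux_integrable by (intro set_integral_add(2)[symmetric]) auto
  have tot: "(\<Sum>K\<in>M. ?I (\<lambda>t. surface_integral K (flux_integrand K t)))
      = (\<Sum>K\<in>M. \<Sum>K'\<in>M - {K}. ?I (face_flux K K')) + (\<Sum>K\<in>M. \<Sum>k\<in>UNIV. ?I (?V K k))"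
    using split by (simp add: sum.distrib)
  have pairs: "2 * (\<Sum>K\<in>M. \<Sum>K'\<in>M - {K}. ?I (face_flux K K'))
      = (\<Sum>K\<in>M. \<Sum>K'\<in>M - {K}. ?I (\<lambda>t. face_flux K K' t + face_flux K' K t))"
    unfolding sum_pairs using pair by (intro sum.cong) auto
  { assume nn: "\<And>a b n. norm n = 1 \<Longrightarrow> \<Theta> a b n + \<Theta> b a (- n) \<ge> 0"
    have "0 \<le> (\<Sum>K\<in>M. \<Sum>K'\<in>M - {K}. ?I (\<lambda>t. face_flux K K' t + face_flux K' K t))"
      unfolding set_lebesgue_integral_def
      using face_flux_pair(1)[OF _ _ _ _ nn] by (intro sum_nonneg integral_nonneg_AE AE_I2) (auto simp: indicator_def)
    then show "(\<Sum>K\<in>M. \<Sum>k\<in>UNIV. ?I (?V K k)) \<le> (\<Sum>K\<in>M. ?I (\<lambda>t. surface_integral K (flux_integrand K t)))"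
      using tot pairs by simp
  next
    assume zz: "\<And>a b n. norm n = 1 \<Longrightarrow> \<Theta> a b n + \<Theta> b a (- n) = 0"
    have "?I (\<lambda>t. face_flux K K' t + face_flux K' K t) = ?I (\<lambda>t. 0)" if "K \<in> M" "K' \<in> M - {K}" for K K'
      using face_flux_pair(2)[OF _ _ _ _ zz] that by (intro set_lebesgue_integral_cong) auto
    then have "0 = (\<Sum>K\<in>M. \<Sum>K'\<in>M - {K}. ?I (\<lambda>t. face_flux K K' t + face_flux K' K t))"
      by (intro sum.neutral[symmetric] ballI) simp
    then show "(\<Sum>K\<in>M. ?I (\<lambda>t. surface_integral K (flux_integrand K t))) = (\<Sum>K\<in>M. \<Sum>k\<in>UNIV. ?I (?V K k))"
      using tot pairs by simp
  }
qed

end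

section \<open>Piecewise polynomials\<close>

lemma finite_multi_indices: "finite (multi_indices q :: ('a::euclidean_space \<Rightarrow> nat) set)"
proof (rule finite_subset)
  show "multi_indices q \<subseteq> (Basis :: 'a set) \<rightarrow>\<^sub>E {..q}"
  proof
    fix \<alpha> :: "'a \<Rightarrow> nat" assume \<alpha>: "\<alpha> \<in> multi_indices q"
    have "\<alpha> b \<le> q" if "b \<in> Basis" for b
      using \<alpha> member_le_sum[OF that, of \<alpha>] by (simp add: multi_indices_def)
    then show "\<alpha> \<in> Basis \<rightarrow>\<^sub>E {..q}" using \<alpha> by (auto simp: multi_indices_def PiE_def)
  qed
qed (auto intro: finite_PiE)

lemma const_polys:
  fixes e :: "'b::real_vector"
  shows "(\<lambda>_::'a::euclidean_space. e) \<in> polys q"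
proof -
  \<comment> \<open>Multi-indices are extensional functions, so the zero index has to be restricted
    to \<open>Basis\<close>.\<close>
  let ?z = "restrict (\<lambda>_. 0) Basis :: 'a \<Rightarrow> nat"
  have z: "?z \<in> multi_indices q" by (simp add: multi_indices_def)
  have "(\<Sum>\<alpha>\<in>multi_indices q. (\<Prod>b\<in>Basis. (z \<bullet> b) ^ \<alpha> b) *\<^sub>R (if \<alpha> = ?z then e else 0)) = e" for z :: 'a
  proof -
    have "(\<Sum>\<alpha>\<in>multi_indices q. (\<Prod>b\<in>Basis. (z \<bullet> b) ^ \<alpha> b) *\<^sub>R (if \<alpha> = ?z then e else 0))
        = (\<Sum>\<alpha>\<in>multi_indices q. if \<alpha> = ?z then (\<Prod>b\<in>Basis. (z \<bullet> b) ^ ?z b) *\<^sub>R e else 0)"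
      by (intro sum.cong) auto
    also have "\<dots> = e" by (subst sum.delta[OF finite_multi_indices]) (simp add: z)
    finally show ?thesis .
  qed
  then show ?thesis unfolding polys_def by (intro CollectI exI[of _ "\<lambda>\<alpha>. if \<alpha> = ?z then e else 0"]) auto
qed

lemma polys_C1:
  fixes p :: "'a::euclidean_space \<Rightarrow> 'b::euclidean_space"
  assumes "p \<in> polys q"
  obtains p' where "\<And>z. (p has_derivative p' z) (at z)" "\<And>h. continuous_on UNIV (\<lambda>z. p' z h)"
proof -
  obtain c where p: "\<And>z. p z = (\<Sum>\<alpha>\<in>multi_indices q. (\<Prod>b\<in>Basis. (z \<bullet> b) ^ \<alpha> b) *\<^sub>R c \<alpha>)"
    using assms by (auto simp: polys_def)
  define p' where "p' z h = (\<Sum>\<alpha>\<in>multi_indices q. (\<Sum>b\<in>Basis. (real (\<alpha> b) * (h \<bullet> b) * (z \<bullet> b) ^ (\<alpha> b - 1)) * (\<Prod>j\<in>Basis - {b}. (z \<bullet> j) ^ \<alpha> j)) *\<^sub>R c \<alpha>)" for z h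
  show ?thesis
  proof (rule that)
    fix z
    have "((\<lambda>z. (z \<bullet> b) ^ n) has_derivative (\<lambda>h. real n * (h \<bullet> b) * (z \<bullet> b) ^ (n - 1))) (at z)" for b :: 'a and n
      by (auto intro!: derivative_eq_intros)
    then have "((\<lambda>z. \<Prod>b\<in>Basis. (z \<bullet> b) ^ \<alpha> b) has_derivative
        (\<lambda>h. \<Sum>b\<in>Basis. (real (\<alpha> b) * (h \<bullet> b) * (z \<bullet> b) ^ (\<alpha> b - 1)) * (\<Prod>j\<in>Basis - {b}. (z \<bullet> j) ^ \<alpha> j))) (at z)" for \<alpha> :: "'a \<Rightarrow> nat"
      by (intro has_derivative_prod)
    then show "(p has_derivative p' z) (at z)"
      unfolding p[abs_def] p'_def[abs_def]
      by (intro has_derivative_sum has_derivative_scaleR_left)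
    show "continuous_on UNIV (\<lambda>z. p' z h)" for h
      unfolding p'_def by (intro continuous_intros)
  qed
qed

text \<open>Fubini's theorem brings the time integral inside, where the fundamental theorem applies
  for each fixed \<open>x\<close>; the half-open and the closed time interval differ by a null
  set.\<close>

lemma space_time_FTC:
  fixes g \<Phi> :: "'a::euclidean_space \<times> real \<Rightarrow> real"
  assumes K: "convex K" "bounded K" and g: "continuous_on UNIV g" and \<Phi>: "continuous_on UNIV \<Phi>"
    and der: "\<And>x t. ((\<lambda>s. \<Phi> (x, s)) has_real_derivative g (x, t)) (at t)" and ab: "a \<le> b"
  shows "(LINT t:{a..<b}|lebesgue. LINT x:K|lebesgue. g (x, t)) = (LINT x:K|lebesgue. \<Phi> (x, b) - \<Phi> (x, a))"
proof -
  obtain B where B: "\<And>z. z \<in> K \<times> {a..b} \<Longrightarrow> \<bar>g z\<bar> \<le> B"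
    using continuous_compact_bound[OF g, of "K \<times> {a..b}"] bounded_Times[OF K(2) bounded_closed_interval] by metis
  have bnd: "\<bar>g (x, t)\<bar> \<le> B" if "x \<in> interior K" "t \<in> {a..<b}" for x t
    using that interior_subset[of K] by (intro B) auto
  have inner: "(LINT t|lborel. indicator {a..<b} t * g (x, t)) = \<Phi> (x, b) - \<Phi> (x, a)" for x
  proof -
    have "continuous_on UNIV (\<lambda>t::real. (x, t))"
      by (intro continuous_on_Pair continuous_on_id continuous_on_const)
    then have gc: "continuous_on UNIV (\<lambda>t. g (x, t))" by (rule continuous_on_compose2[OF g]) simp
    have "(LINT t|lborel. g (x, t) * indicator {a..b} t) = \<Phi> (x, b) - \<Phi> (x, a)"
      using integral_FTC_Icc_real[OF ab, of "\<lambda>s. \<Phi> (x, s)" "\<lambda>t. g (x, t)"] der gc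
      by (simp add: continuous_on_eq_continuous_at)
    moreover have "(LINT t|lborel. g (x, t) * indicator {a..b} t) = (LINT t|lborel. indicator {a..<b} t * g (x, t))"
    proof (rule integral_cong_AE)
      have "(\<lambda>t. g (x, t)) \<in> borel_measurable borel" by (rule borel_measurable_continuous_onI[OF gc])
      then show "(\<lambda>t. g (x, t) * indicator {a..b} t) \<in> borel_measurable lborel" "(\<lambda>t. indicator {a..<b} t * g (x, t)) \<in> borel_measurable lborel"
        by measurable
      show "AE t in lborel. g (x, t) * indicator {a..b} t = indicator {a..<b} t * g (x, t)"
        using AE_lborel_singleton[of b] by eventually_elim (auto simp: indicator_def)
    qed
    ultimately show ?thesis by simp
  qed
  have "(LINT t:{a..<b}|lebesgue. LINT x:K|lebesgue. g (x, t)) = (LINT x|lborel. indicator (interior K) x * (\<Phi> (x, b) - \<Phi> (x, a)))"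
    unfolding set_integral_cell_lborel[OF K(1) g] inner[symmetric]
    by (rule slab_Fubini[OF borel_measurable_continuous_onI[OF g] _ bounded_interior[OF K(2)] bnd]) auto
  also have "\<dots> = (LINT x:K|lebesgue. \<Phi> (x, b) - \<Phi> (x, a))"
  proof -
    have "continuous_on UNIV (\<lambda>x::'a. (x, t))" for t :: real
      by (intro continuous_on_Pair continuous_on_id continuous_on_const)
    then have "continuous_on UNIV (\<lambda>x. \<Phi> (x, t))" for t by (rule continuous_on_compose2[OF \<Phi>]) simp
    then have m: "(\<lambda>x. \<Phi> (x, b) - \<Phi> (x, a)) \<in> borel_measurable borel"
      by (intro borel_measurable_continuous_onI continuous_intros)
    show ?thesis using set_integral_lebesgue_convex(1)[OF K(1) m, of "\<lambda>x. \<Phi> (x, b) - \<Phi> (x, a)"] by simp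
  qed
  finally show ?thesis .
qed

text \<open>The bound holds almost everywhere only: functions of the scheme are determined on the
  cells and arbitrary on the null set that the cells leave uncovered.\<close>

definition bounded_measurable_on :: "'a::euclidean_space set \<Rightarrow> ('a \<Rightarrow> 'b::euclidean_space) \<Rightarrow> bool" where
  "bounded_measurable_on S w \<longleftrightarrow> (\<lambda>x. indicator S x *\<^sub>R w x) \<in> borel_measurable lebesgue \<and>
     (\<exists>B. AE x in lebesgue. x \<in> S \<longrightarrow> norm (w x) \<le> B)"

lemma bounded_measurable_integrable:
  fixes h :: "'b::euclidean_space \<times> 'a::euclidean_space \<Rightarrow> 'c::euclidean_space"
  assumes w: "bounded_measurable_on \<Omega> w" and h: "continuous_on UNIV h" and \<Omega>: "bounded \<Omega>"
    and S: "S \<in> sets lebesgue" "S \<subseteq> \<Omega>"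
  shows "set_integrable lebesgue S (\<lambda>x. h (w x, x))"
proof -
  obtain B where B: "AE x in lebesgue. x \<in> \<Omega> \<longrightarrow> norm (w x) \<le> B"
    using w by (auto simp: bounded_measurable_on_def)
  have "compact (h ` (cball 0 B \<times> closure \<Omega>))"
    using \<Omega> by (intro compact_continuous_image continuous_on_subset[OF h] compact_Times) (auto simp: compact_closure)
  then have "bounded (h ` (cball 0 B \<times> closure \<Omega>))" by (rule compact_imp_bounded)
  then obtain H where H: "\<forall>y\<in>h ` (cball 0 B \<times> closure \<Omega>). norm y \<le> H"
    unfolding bounded_iff by blast
  have m: "(\<lambda>x. indicator S x *\<^sub>R h (indicator \<Omega> x *\<^sub>R w x, x)) \<in> borel_measurable lebesgue"
  proof (intro borel_measurable_scaleR borel_measurable_indicator S(1))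
    have "(\<lambda>x. (indicator \<Omega> x *\<^sub>R w x, x)) \<in> borel_measurable lebesgue"
      using w by (intro borel_measurable_Pair measurable_completion[of "\<lambda>x. x"]) (auto simp: bounded_measurable_on_def)
    from measurable_compose[OF this borel_measurable_continuous_onI[OF h]]
    show "(\<lambda>x. h (indicator \<Omega> x *\<^sub>R w x, x)) \<in> borel_measurable lebesgue" .
  qed
  have eq: "(\<lambda>x. indicator S x *\<^sub>R h (indicator \<Omega> x *\<^sub>R w x, x)) = (\<lambda>x. indicator S x *\<^sub>R h (w x, x))"
  proof
    fix x show "indicator S x *\<^sub>R h (indicator \<Omega> x *\<^sub>R w x, x) = indicator S x *\<^sub>R h (w x, x)"
      using S(2) by (cases "x \<in> S") auto
  qed
  have bS: "bounded S" using S(2) \<Omega> bounded_subset by blast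
  then obtain R where R: "S \<subseteq> ball 0 R" using bounded_subset_ballD by blast
  have "emeasure lebesgue S \<le> emeasure lebesgue (ball 0 R :: 'a set)" using R by (intro emeasure_mono) auto
  also have "\<dots> < \<infinity>" using emeasure_bounded_finite[of "ball (0::'a) R"] by simp
  finally have fin: "emeasure lebesgue S < \<infinity>" .
  show ?thesis
    unfolding set_integrable_def
  proof (rule integrableI_bounded_set[OF S(1) _ fin, where B = H])
    show "(\<lambda>x. indicator S x *\<^sub>R h (w x, x)) \<in> borel_measurable lebesgue" using m unfolding eq .
    show "AE x in lebesgue. x \<in> S \<longrightarrow> norm (indicator S x *\<^sub>R h (w x, x)) \<le> H"
      using B
    proof eventually_elim
      case (elim x)
      show ?case
      proof
        assume x: "x \<in> S"
        then have "(w x, x) \<in> cball 0 B \<times> closure \<Omega>" using elim S(2) closure_subset by auto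
        then show "norm (indicator S x *\<^sub>R h (w x, x)) \<le> H" using H x by auto
      qed
    qed
  qed simp
qed

lemma AE_in_cell:
  fixes M :: "'a::euclidean_space set set"
  assumes "finite M" "\<And>K. K \<in> M \<Longrightarrow> convex K" "\<Omega> \<subseteq> (\<Union>K\<in>M. closure K)"
  shows "AE x in lebesgue. x \<in> \<Omega> \<longrightarrow> (\<exists>K\<in>M. x \<in> interior K)"
proof -
  have "frontier K \<in> null_sets lebesgue" if "K \<in> M" for K
    using negligible_convex_frontier[OF assms(2)[OF that]] by (simp add: negligible_iff_null_sets)
  then have "AE x in lebesgue. \<forall>K\<in>M. x \<notin> frontier K"
    using assms(1) by (intro AE_finite_allI AE_not_in) auto
  then show ?thesis
    by eventually_elim (use assms(3) in \<open>unfold frontier_def, blast\<close>)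
qed

lemma bounded_measurable_piecewise:
  fixes M :: "'a::euclidean_space set set" and w :: "'a \<Rightarrow> 'b::euclidean_space"
  assumes M: "finite M" "disjoint M" "\<And>K. K \<in> M \<Longrightarrow> convex K" "\<And>K. K \<in> M \<Longrightarrow> bounded K" and cover: "\<Omega> \<subseteq> (\<Union>K\<in>M. closure K)"
    and \<Omega>: "\<Omega> \<in> sets lebesgue"
    and g: "\<And>K. K \<in> M \<Longrightarrow> continuous_on UNIV (g K)" "\<And>K x. K \<in> M \<Longrightarrow> x \<in> K \<Longrightarrow> w x = g K x"
  shows "bounded_measurable_on \<Omega> w"
proof -
  have cpt: "bounded (g K ` closure K)" if "K \<in> M" for K
    using M(4)[OF that] g(1)[OF that]
    by (intro compact_imp_bounded compact_continuous_image continuous_on_subset[OF g(1)[OF that]]) (auto simp: compact_closure)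
  then have "bounded (\<Union>K\<in>M. g K ` closure K)" using M(1) by (intro bounded_UN) auto
  then obtain B where B: "\<And>y. y \<in> (\<Union>K\<in>M. g K ` closure K) \<Longrightarrow> norm y \<le> B" unfolding bounded_iff by metis
  have AE: "AE x in lebesgue. x \<in> \<Omega> \<longrightarrow> (\<exists>K\<in>M. x \<in> interior K)"
    by (rule AE_in_cell) (use M cover in auto)
  have 1: "AE x in lebesgue. x \<in> \<Omega> \<longrightarrow> norm (w x) \<le> B"
    using AE
  proof eventually_elim
    case (elim x)
    show ?case
    proof
      assume "x \<in> \<Omega>"
      then obtain K where K: "K \<in> M" "x \<in> interior K" using elim by blast
      then have "x \<in> K" "x \<in> closure K" using interior_subset closure_subset by blast+
      then have "w x \<in> (\<Union>K\<in>M. g K ` closure K)" using K g(2)[OF K(1)] by auto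
      then show "norm (w x) \<le> B" by (rule B)
    qed
  qed
  let ?s = "\<lambda>x. indicator \<Omega> x *\<^sub>R (\<Sum>K\<in>M. indicator (interior K) x *\<^sub>R g K x)"
  have "g K \<in> borel_measurable lebesgue" if "K \<in> M" for K
    using borel_measurable_continuous_onI[OF g(1)[OF that]] by (intro measurable_completion) simp
  then have m: "?s \<in> borel_measurable lebesgue"
    using \<Omega> by (intro borel_measurable_scaleR borel_measurable_indicator borel_measurable_sum) auto
  have "AE x in lebesgue. indicator \<Omega> x *\<^sub>R w x = ?s x"
    using AE
  proof eventually_elim
    case (elim x)
    show ?case
    proof (cases "x \<in> \<Omega>")
      case True
      then obtain K where K: "K \<in> M" "x \<in> interior K" using elim by blast
      have xK: "x \<in> K" using K interior_subset by blast
      have "x \<notin> interior L" if "L \<in> M - {K}" for L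
      proof
        assume "x \<in> interior L"
        then have "x \<in> L" using interior_subset by blast
        then show False using M(2) that K xK by (auto simp: disjoint_def)
      qed
      then have "(\<Sum>L\<in>M. indicator (interior L) x *\<^sub>R g L x) = indicator (interior K) x *\<^sub>R g K x"
        using M(1) K(1) by (subst sum.remove[of M K]) auto
      then show ?thesis using K g(2)[OF K(1) xK] by simp
    qed simp
  qed
  from lebesgue_measurable_cong_AE[OF m this] 1 show ?thesis by (auto simp: bounded_measurable_on_def)
qed

lemma sum_cells_integral:
  fixes M :: "'a::euclidean_space set set" and g :: "'a \<Rightarrow> 'b::euclidean_space"
  assumes M: "finite M" "disjoint M" "\<And>K. K \<in> M \<Longrightarrow> convex K" "\<And>K. K \<in> M \<Longrightarrow> bounded K" "\<And>K. K \<in> M \<Longrightarrow> K \<subseteq> \<Omega>"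
    and cover: "\<Omega> \<subseteq> (\<Union>K\<in>M. closure K)" and g: "set_integrable lebesgue \<Omega> g" and \<Omega>: "\<Omega> \<in> sets lebesgue"
  shows "(\<Sum>K\<in>M. LINT x:K|lebesgue. g x) = (LINT x:\<Omega>|lebesgue. g x)"
proof -
  have Km: "K \<in> sets lebesgue" if "K \<in> M" for K
    using measurable_convex[OF M(3)[OF that] M(4)[OF that]] by (auto simp: fmeasurable_def)
  have Ki: "set_integrable lebesgue K g" if "K \<in> M" for K
    by (rule set_integrable_subset[OF g Km[OF that] M(5)[OF that]])
  have dis: "disjoint_family_on (\<lambda>K. K) M"
    using M(2) by (auto simp: disjoint_family_on_def disjoint_def)
  have "(\<Sum>K\<in>M. LINT x:K|lebesgue. g x) = (LINT x:(\<Union>K\<in>M. K)|lebesgue. g x)"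
    by (rule set_integral_finite_Union[OF M(1) dis Ki Km, symmetric])
  also have "\<dots> = (LINT x:\<Omega>|lebesgue. g x)"
  proof (rule set_integral_cong_set)
    show "set_borel_measurable lebesgue \<Omega> g"
      using g unfolding set_integrable_def set_borel_measurable_def by (rule borel_measurable_integrable)
    have "set_integrable lebesgue (\<Union>K\<in>M. K) g"
    proof (rule set_integrable_subset[OF g])
      show "(\<Union>K\<in>M. K) \<in> sets lebesgue" using Km M(1) by (intro sets.finite_UN) auto
      show "(\<Union>K\<in>M. K) \<subseteq> \<Omega>" using M(5) by (rule UN_least)
    qed
    then show "set_borel_measurable lebesgue (\<Union>K\<in>M. K) g"
      unfolding set_integrable_def set_borel_measurable_def by (rule borel_measurable_integrable)
    have "AE x in lebesgue. x \<in> \<Omega> \<longrightarrow> (\<exists>K\<in>M. x \<in> interior K)"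
      by (rule AE_in_cell) (use M cover in auto)
    then show "AE x in lebesgue. x \<in> \<Omega> \<longleftrightarrow> x \<in> (\<Union>K\<in>M. K)"
    proof eventually_elim
      case (elim x)
      then show ?case using M(5) interior_subset by blast
    qed
  qed
  finally show ?thesis .
qed

section \<open>Entropy potentials and numerical flux\<close>

lemma has_derivative_continuous_UNIV:
  assumes "\<And>x. (g has_derivative g' x) (at x)"
  shows "continuous_on UNIV g"
proof (rule continuous_at_imp_continuous_on, rule ballI)
  fix x show "isCont g x" using assms by (rule has_derivative_continuous)
qed

lemma entropy_var_has_derivative:
  fixes U :: "real^'m \<Rightarrow> real"
  assumes "U differentiable (at u)"
  shows "(U has_derivative (\<lambda>h. entropy_var U u \<bullet> h)) (at u)"
proof -
  let ?D = "frechet_derivative U (at u)"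
  have D: "(U has_derivative ?D) (at u)" using assms by (simp add: frechet_derivative_works)
  then have lin: "linear ?D" by (rule has_derivative_linear)
  have "?D h = entropy_var U u \<bullet> h" for h
  proof -
    have "?D h = ?D (\<Sum>i\<in>UNIV. h $ i *\<^sub>R axis i 1)"
      using basis_expansion[of h] by (simp add: scalar_mult_eq_scaleR)
    also have "\<dots> = (\<Sum>i\<in>UNIV. h $ i * ?D (axis i 1))"
      using lin by (simp add: linear_sum linear_cmul)
    also have "\<dots> = entropy_var U u \<bullet> h"
      by (simp add: entropy_var_def inner_vec_def mult.commute)
    finally show ?thesis .
  qed
  then have "?D = (\<lambda>h. entropy_var U u \<bullet> h)" by (rule ext)
  with D show ?thesis by simp
qed

text \<open>The secant slopes from \<open>x\<close> towards \<open>y\<close> are at most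
  \<open>U y - U x\<close>; the tangent slope is their limit.\<close>

lemma strictly_convex_tangent:
  fixes U :: "real^'m \<Rightarrow> real"
  assumes U: "strictly_convex U" "U differentiable (at x)"
  shows "U x + entropy_var U x \<bullet> (y - x) \<le> U y"
proof (cases "x = y")
  case False
  let ?g = "\<lambda>s::real. U (x + s *\<^sub>R (y - x))"
  have "((\<lambda>s::real. x + s *\<^sub>R (y - x)) has_derivative (\<lambda>s. s *\<^sub>R (y - x))) (at 0)"
    by (auto intro!: derivative_eq_intros)
  moreover have "(U has_derivative (\<lambda>h. entropy_var U x \<bullet> h)) (at (x + 0 *\<^sub>R (y - x)))"
    using entropy_var_has_derivative[OF U(2)] by simp
  ultimately have "(?g has_derivative (\<lambda>s. entropy_var U x \<bullet> (s *\<^sub>R (y - x)))) (at 0)"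
    by (rule has_derivative_compose)
  then have "(?g has_real_derivative entropy_var U x \<bullet> (y - x)) (at 0)"
    by (simp add: has_field_derivative_def mult_commute_abs)
  then have "(\<lambda>s. (?g s - ?g 0) / s) \<midarrow>0\<rightarrow> entropy_var U x \<bullet> (y - x)" by (simp add: DERIV_def)
  then have lim: "((\<lambda>s. (?g s - ?g 0) / s) \<longlongrightarrow> entropy_var U x \<bullet> (y - x)) (at_right 0)"
    by (rule filterlim_mono) (auto simp: at_le)
  have "\<forall>\<^sub>F s in at_right 0. (?g s - ?g 0) / s \<le> U y - U x"
  proof -
    have "(?g s - ?g 0) / s \<le> U y - U x" if s: "0 < s" "s < 1" for s
    proof -
      have "x + s *\<^sub>R (y - x) = (1 - s) *\<^sub>R x + s *\<^sub>R y" by (simp add: algebra_simps)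
      then have "?g s \<le> (1 - s) * U x + s * U y"
        using U(1) False s unfolding strictly_convex_def by (metis less_imp_le)
      then show ?thesis using s by (simp add: field_simps)
    qed
    then show ?thesis by (auto simp: eventually_at_right_field intro!: exI[of _ 1])
  qed
  from tendsto_upperbound[OF lim this] show ?thesis by simp
qed simp

lemma continuous_bounded_on_pairs:
  fixes g :: "'a::euclidean_space \<times> 'b::euclidean_space \<Rightarrow> 'c::real_normed_vector"
  assumes "continuous_on UNIV g"
  obtains B where "\<And>a b. norm a \<le> R \<Longrightarrow> norm b \<le> R \<Longrightarrow> norm (g (a, b)) \<le> B"
proof -
  have "compact (g ` (cball 0 R \<times> cball 0 R))"
    by (intro compact_continuous_image compact_Times compact_cball continuous_on_subset[OF assms]) simp
  then have "bounded (g ` (cball 0 R \<times> cball 0 R))" by (rule compact_imp_bounded)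
  then obtain B where "\<forall>y\<in>g ` (cball 0 R \<times> cball 0 R). norm y \<le> B" unfolding bounded_iff by blast
  then show ?thesis by (intro that[of B]) auto
qed

lemma sym_pos_def_nonneg: "sym_pos_def A \<Longrightarrow> w \<bullet> (A *v w) \<ge> 0"
  unfolding sym_pos_def_def by (cases "w = 0") (simp_all add: less_imp_le)

text \<open>Admissibility controls the quadratic form of \<open>D\<close>, whereas
  \<open>excess_bounded\<close> meets the bilinear form with two different arguments. Expanding the
  quadratic form at \<open>x + y\<close> and \<open>x - y\<close> bridges the gap.\<close>

lemma sym_pos_def_polarization:
  fixes A :: "real^'m^'m"
  assumes A: "sym_pos_def A" and C: "\<And>w. w \<bullet> (A *v w) \<le> C * (w \<bullet> w)" and C0: "C \<ge> 0"
  shows "\<bar>x \<bullet> (A *v y)\<bar> \<le> C * (norm x + norm y)\<^sup>2"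
proof -
  have sym: "y \<bullet> (A *v x) = x \<bullet> (A *v y)"
  proof -
    have "y \<bullet> (A *v x) = (transpose A *v y) \<bullet> x" by (simp add: dot_lmul_matrix)
    also have "transpose A = A" using A by (simp add: sym_pos_def_def)
    finally show ?thesis by (simp add: inner_commute)
  qed
  have p: "(x + y) \<bullet> (A *v (x + y)) = x \<bullet> (A *v x) + 2 * (x \<bullet> (A *v y)) + y \<bullet> (A *v y)"
    and m: "(x - y) \<bullet> (A *v (x - y)) = x \<bullet> (A *v x) - 2 * (x \<bullet> (A *v y)) + y \<bullet> (A *v y)"
    using sym by (simp_all add: matrix_vector_right_distrib matrix_vector_mult_diff_distrib inner_simps)
  have xx: "x \<bullet> (A *v x) \<ge> 0" "y \<bullet> (A *v y) \<ge> 0" using sym_pos_def_nonneg[OF A] by auto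
  have b: "C * (w \<bullet> w) \<le> C * (norm x + norm y)\<^sup>2" if "norm w \<le> norm x + norm y" for w :: "real^'m"
    using that C0 by (intro mult_left_mono) (auto simp: power2_norm_eq_inner[symmetric] intro: power_mono)
  have "(x + y) \<bullet> (A *v (x + y)) \<le> C * (norm x + norm y)\<^sup>2"
    using order_trans[OF C b[OF norm_triangle_ineq]] .
  moreover have "(x - y) \<bullet> (A *v (x - y)) \<le> C * (norm x + norm y)\<^sup>2"
    using order_trans[OF C b[OF norm_triangle_ineq4]] .
  moreover have "(x + y) \<bullet> (A *v (x + y)) \<ge> 0" "(x - y) \<bullet> (A *v (x - y)) \<ge> 0"
    using sym_pos_def_nonneg[OF A] by auto
  ultimately show ?thesis using p m xx by (simp only: abs_le_iff) linarith
qed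

locale entropy_system =
  fixes f :: "'d::finite \<Rightarrow> real^'m \<Rightarrow> real^'m" and U :: "real^'m \<Rightarrow> real" and F :: "'d \<Rightarrow> real^'m \<Rightarrow> real"
  assumes C1_flux: "C1 (f k)" and entropy: "strictly_convex_entropy U" and pair: "entropy_pair f U F"
begin

abbreviation "cv \<equiv> cons_var U"
abbreviation "ev \<equiv> entropy_var U"

lemma bij_ev: "bij ev"
  using entropy unfolding strictly_convex_entropy_def by blast

lemma cv_ev [simp]: "cv (ev u) = u"
  unfolding cons_var_def by (rule inv_f_f[OF bij_is_inj[OF bij_ev]])

lemma ev_cv [simp]: "ev (cv v) = v"
  unfolding cons_var_def by (rule surj_f_inv_f[OF bij_is_surj[OF bij_ev]])

lemma U_differentiable: "U differentiable (at u)"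
  using entropy unfolding strictly_convex_entropy_def by blast

lemma U_deriv: "(U has_derivative (\<lambda>h. ev u \<bullet> h)) (at u)"
  by (rule entropy_var_has_derivative[OF U_differentiable])

lemma U_tangent: "U x + ev x \<bullet> (y - x) \<le> U y"
proof (rule strictly_convex_tangent[OF _ U_differentiable])
  show "strictly_convex U" using entropy unfolding strictly_convex_entropy_def by blast
qed

lemma U_cont: "continuous_on UNIV U"
  by (rule has_derivative_continuous_UNIV[OF U_deriv])

definition cv' :: "real^'m \<Rightarrow> real^'m \<Rightarrow> real^'m" where "cv' v = frechet_derivative cv (at v)"
definition f' :: "'d \<Rightarrow> real^'m \<Rightarrow> real^'m \<Rightarrow> real^'m" where "f' k u = frechet_derivative (f k) (at u)"

lemma cv_deriv: "(cv has_derivative cv' v) (at v)"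
  using entropy unfolding cv'_def strictly_convex_entropy_def by (intro frechet_derivative_works[THEN iffD1]) blast

lemma f_deriv: "(f k has_derivative f' k u) (at u)"
  using C1_flux unfolding f'_def C1_def by (intro frechet_derivative_works[THEN iffD1]) blast

lemma F_deriv: "(F k has_derivative (\<lambda>h. ev u \<bullet> f' k u h)) (at u)"
proof -
  have "F k differentiable (at u)" "frechet_derivative (F k) (at u) = frechet_derivative U (at u) \<circ> f' k u"
    using pair by (auto simp: entropy_pair_def f'_def)
  moreover have "frechet_derivative U (at u) = (\<lambda>h. ev u \<bullet> h)"
    using frechet_derivative_at[OF U_deriv] by simp
  ultimately show ?thesis unfolding frechet_derivative_works by (simp add: o_def)
qed

lemma cv_cont: "continuous_on UNIV cv"
  by (rule has_derivative_continuous_UNIV[OF cv_deriv])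

lemma f_cont: "continuous_on UNIV (f k)"
  by (rule has_derivative_continuous_UNIV[OF f_deriv])

lemma fcv_cont: "continuous_on UNIV (\<lambda>v. f k (cv v))"
  by (rule continuous_on_compose2[OF f_cont cv_cont]) simp

text \<open>The potentials of the state and of the fluxes: their gradients with respect to the entropy variables
  are the state and the fluxes themselves.\<close>

definition phi :: "real^'m \<Rightarrow> real" where "phi v = v \<bullet> cv v - U (cv v)"
definition psi :: "'d \<Rightarrow> real^'m \<Rightarrow> real" where "psi k v = v \<bullet> f k (cv v) - F k (cv v)"

text \<open>The derivative of \<open>cv\<close> enters with the factor \<open>v - ev (cv v)\<close>,
  which is zero: \<open>phi\<close> is the Legendre transform of \<open>U\<close>.\<close>

lemma phi_deriv: "(phi has_derivative (\<lambda>h. cv v \<bullet> h)) (at v)"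
proof -
  have "((\<lambda>v. U (cv v)) has_derivative (\<lambda>h. ev (cv v) \<bullet> cv' v h)) (at v)"
    by (rule has_derivative_compose[OF cv_deriv U_deriv])
  then show ?thesis
    unfolding phi_def[abs_def]
    by (auto intro!: derivative_eq_intros cv_deriv simp: inner_commute)
qed

text \<open>Here the relation of the entropy pair provides the cancellation: the derivative of
  \<open>F k\<close> is that of \<open>f k\<close> tested with \<open>ev\<close>, and
  \<open>ev (cv v) = v\<close>.\<close>

lemma psi_deriv: "(psi k has_derivative (\<lambda>h. f k (cv v) \<bullet> h)) (at v)"
proof -
  have "((\<lambda>v. F k (cv v)) has_derivative (\<lambda>h. ev (cv v) \<bullet> f' k (cv v) (cv' v h))) (at v)"
    by (rule has_derivative_compose[OF cv_deriv F_deriv])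
  moreover have "((\<lambda>v. f k (cv v)) has_derivative (\<lambda>h. f' k (cv v) (cv' v h))) (at v)"
    by (rule has_derivative_compose[OF cv_deriv f_deriv])
  ultimately show ?thesis
    unfolding psi_def[abs_def]
    by (auto intro!: derivative_eq_intros simp: inner_commute)
qed

lemma phi_cont: "continuous_on UNIV phi"
  by (rule has_derivative_continuous_UNIV[OF phi_deriv])

lemma psi_cont: "continuous_on UNIV (psi k)"
  by (rule has_derivative_continuous_UNIV[OF psi_deriv])

lemma flux_dot_cont: "continuous_on UNIV (\<lambda>v. flux_dot f (cv v) n)"
  unfolding flux_dot_def by (intro continuous_intros fcv_cont)

lemma flux_dot_path_cont: "continuous_on S (\<lambda>s. flux_dot f (cv (a + s *\<^sub>R (b - a))) n)"
  by (rule continuous_on_compose2[OF flux_dot_cont]) (auto intro!: continuous_intros)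

lemma ec_flux_integral: "ec_flux f U a b n = integral {0..1} (\<lambda>s. flux_dot f (cv (a + s *\<^sub>R (b - a))) n)"
  unfolding ec_flux_def
  by (rule set_lebesgue_integral_eq_integral(2)) (rule absolutely_integrable_continuous_real[OF flux_dot_path_cont])

lemma ec_flux_cont: "continuous_on UNIV (\<lambda>z. ec_flux f U (fst z) (snd z) n)"
proof -
  have "continuous_on (UNIV \<times> cbox 0 1) (\<lambda>(z :: (real^'m) \<times> (real^'m), s::real). flux_dot f (cv (fst z + s *\<^sub>R (snd z - fst z))) n)"
    unfolding split_beta'
    by (rule continuous_on_compose2[OF flux_dot_cont]) (auto intro!: continuous_intros)
  from integral_continuous_on_param[OF this] show ?thesis by (simp add: ec_flux_integral)
qed

text \<open>Tested with \<open>b - a\<close>, the flux average over the segment from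
  \<open>a\<close> to \<open>b\<close> is the line integral of the gradient of the potentials
  weighted by \<open>n\<close>. This is the entropy conservation of the averaged flux.\<close>

lemma ec_flux_jump: "ec_flux f U a b n \<bullet> (b - a) = (\<Sum>k\<in>UNIV. n $ k * (psi k b - psi k a))"
proof -
  let ?g = "\<lambda>s. flux_dot f (cv (a + s *\<^sub>R (b - a))) n"
  have "(?g has_integral ec_flux f U a b n) {0..1}"
    unfolding ec_flux_integral
    by (intro integrable_integral integrable_continuous_real flux_dot_path_cont)
  from has_integral_linear[OF this bounded_linear_inner_left[of "b - a"]]
  have 1: "((\<lambda>s. ?g s \<bullet> (b - a)) has_integral (ec_flux f U a b n \<bullet> (b - a))) {0..1}" by (simp add: o_def)
  have "((\<lambda>s. ?g s \<bullet> (b - a)) has_integral ((\<Sum>k\<in>UNIV. n $ k * psi k (a + 1 *\<^sub>R (b - a))) - (\<Sum>k\<in>UNIV. n $ k * psi k (a + 0 *\<^sub>R (b - a))))) {0..1}"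
  proof (rule fundamental_theorem_of_calculus)
    fix s :: real
    have "((\<lambda>s. a + s *\<^sub>R (b - a)) has_derivative (\<lambda>h. h *\<^sub>R (b - a))) (at s)"
      by (auto intro!: derivative_eq_intros)
    from has_derivative_compose[OF this psi_deriv]
    have "((\<lambda>s. psi k (a + s *\<^sub>R (b - a))) has_derivative (\<lambda>h. f k (cv (a + s *\<^sub>R (b - a))) \<bullet> (h *\<^sub>R (b - a)))) (at s)" for k .
    then have "((\<lambda>s. \<Sum>k\<in>UNIV. n $ k * psi k (a + s *\<^sub>R (b - a))) has_derivative
       (\<lambda>h. \<Sum>k\<in>UNIV. n $ k * (f k (cv (a + s *\<^sub>R (b - a))) \<bullet> (h *\<^sub>R (b - a))))) (at s)"
      by (intro has_derivative_sum has_derivative_mult_right)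
    moreover have "(\<lambda>h. \<Sum>k\<in>UNIV. n $ k * (f k (cv (a + s *\<^sub>R (b - a))) \<bullet> (h *\<^sub>R (b - a)))) = (\<lambda>h. h *\<^sub>R (?g s \<bullet> (b - a)))"
      by (rule ext) (simp add: flux_dot_def inner_sum_left sum_distrib_left mult.left_commute)
    ultimately have "((\<lambda>s. \<Sum>k\<in>UNIV. n $ k * psi k (a + s *\<^sub>R (b - a))) has_derivative (\<lambda>h. h *\<^sub>R (?g s \<bullet> (b - a)))) (at s)"
      by simp
    then show "((\<lambda>s. \<Sum>k\<in>UNIV. n $ k * psi k (a + s *\<^sub>R (b - a))) has_vector_derivative ?g s \<bullet> (b - a)) (at s within {0..1})"
      unfolding has_vector_derivative_def by (rule has_derivative_at_withinI)
  qed simp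
  then have "((\<lambda>s. ?g s \<bullet> (b - a)) has_integral (\<Sum>k\<in>UNIV. n $ k * (psi k b - psi k a))) {0..1}"
    by (simp add: sum_subtractf right_diff_distrib)
  with 1 show ?thesis by (rule has_integral_unique)
qed

end

section \<open>The remainder of the numerical flux on faces\<close>

locale numerical_scheme = entropy_system f U F
  for f :: "'d::finite \<Rightarrow> real^'m \<Rightarrow> real^'m" and U F +
  fixes D :: "real^'m \<Rightarrow> real^'m \<Rightarrow> real^'d \<Rightarrow> real^'m^'m"
  assumes admissible: "admissible_diffusion D"
    and consistent: "consistent_flux f U (num_flux f U D)"
    and conservative: "conservative_flux (num_flux f U D)"
begin

lemma num_flux_measurable: "(\<lambda>z. num_flux f U D (fst z) (snd z) n) \<in> borel_measurable borel"
proof -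
  have m1: "(\<lambda>z. ec_flux f U (fst z) (snd z) n) \<in> borel_measurable borel"
    by (rule borel_measurable_continuous_onI[OF ec_flux_cont])
  have Dm: "(\<lambda>(a, b, n). D a b n) \<in> borel_measurable borel" using admissible by (simp add: admissible_diffusion_def)
  have "(\<lambda>z :: (real^'m) \<times> (real^'m). (fst z, snd z, n)) \<in> borel \<rightarrow>\<^sub>M borel"
    by (intro borel_measurable_continuous_onI continuous_intros)
  from measurable_compose[OF this Dm]
  have "(\<lambda>z. D (fst z) (snd z) n) \<in> borel_measurable borel" by simp
  moreover have "(\<lambda>z :: (real^'m) \<times> (real^'m). snd z - fst z) \<in> borel_measurable borel"
    by (intro borel_measurable_continuous_onI continuous_intros)
  ultimately have P: "(\<lambda>z. (D (fst z) (snd z) n, snd z - fst z)) \<in> borel \<rightarrow>\<^sub>M borel"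
    by (rule borel_measurable_Pair)
  have "continuous_on UNIV (\<lambda>(A :: real^'m^'m, w :: real^'m). A *v w)"
    unfolding split_beta' matrix_vector_mult_def
    by (intro continuous_on_vec_lambda continuous_on_sum continuous_on_mult continuous_on_component continuous_intros)
  from measurable_compose[OF P borel_measurable_continuous_onI[OF this]]
  have m2: "(\<lambda>z. D (fst z) (snd z) n *v (snd z - fst z)) \<in> borel_measurable borel" by simp
  show ?thesis unfolding num_flux_def by (intro borel_measurable_diff borel_measurable_scaleR m1 m2) simp
qed

text \<open>For a test function whose trace is \<open>\<omega>\<close> of the inner trace of the solution, this is the part of the
  numerical flux that is left after subtraction of the normal component of a vector field \<open>G\<close>, which the
  divergence theorem handles cell by cell. It vanishes on \<open>\<partial>\<Omega>\<close>, and its two values on a common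
  face add up to a nonnegative number.\<close>

definition excess :: "(real^'m \<Rightarrow> real^'m) \<Rightarrow> ('d \<Rightarrow> real^'m \<Rightarrow> real) \<Rightarrow> real^'m \<Rightarrow> real^'m \<Rightarrow> real^'d \<Rightarrow> real" where
  "excess \<omega> G a b n = num_flux f U D a b n \<bullet> \<omega> a - (\<Sum>k\<in>UNIV. n $ k * G k a)"

lemma excess_measurable:
  assumes "continuous_on UNIV \<omega>" "\<And>k. continuous_on UNIV (G k)"
  shows "(\<lambda>(a, b). excess \<omega> G a b n) \<in> borel_measurable borel"
proof -
  have m: "(\<lambda>z :: (real^'m) \<times> (real^'m). \<omega> (fst z)) \<in> borel_measurable borel"
    by (intro borel_measurable_continuous_onI continuous_on_compose2[OF assms(1)] continuous_intros) simp
  have "continuous_on UNIV (\<lambda>z :: (real^'m) \<times> (real^'m). G k (fst z))" for k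
    by (rule continuous_on_compose2[OF assms(2)]) (auto intro!: continuous_intros)
  then have "(\<lambda>z :: (real^'m) \<times> (real^'m). \<Sum>k\<in>UNIV. n $ k * G k (fst z)) \<in> borel_measurable borel"
    by (intro borel_measurable_continuous_onI continuous_intros)
  then show ?thesis
    unfolding excess_def split_beta' by (intro borel_measurable_diff borel_measurable_inner num_flux_measurable m)
qed

lemma excess_bounded:
  assumes \<omega>: "continuous_on UNIV \<omega>" and G: "\<And>k. continuous_on UNIV (G k)" and n: "norm n = 1"
  shows "\<exists>B. \<forall>a b. norm a \<le> R \<longrightarrow> norm b \<le> R \<longrightarrow> \<bar>excess \<omega> G a b n\<bar> \<le> B"
proof -
  obtain C where C: "C > 0" "\<And>a b w. w \<bullet> (D a b n *v w) \<le> C * (w \<bullet> w)" and spd: "\<And>a b. sym_pos_def (D a b n)"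
    using admissible n unfolding admissible_diffusion_def by metis
  have "continuous_on UNIV (\<lambda>z. ec_flux f U (fst z) (snd z) n \<bullet> \<omega> (fst z) - (\<Sum>k\<in>UNIV. n $ k * G k (fst z)))"
    by (intro continuous_intros ec_flux_cont continuous_on_compose2[OF \<omega>] continuous_on_compose2[OF G]) auto
  then obtain B1 where B1: "\<And>a b. norm a \<le> R \<Longrightarrow> norm b \<le> R \<Longrightarrow>
     norm (ec_flux f U (fst (a, b)) (snd (a, b)) n \<bullet> \<omega> (fst (a, b)) - (\<Sum>k\<in>UNIV. n $ k * G k (fst (a, b)))) \<le> B1"
    by (rule continuous_bounded_on_pairs) blast
  have "continuous_on UNIV (\<lambda>z :: (real^'m) \<times> (real^'m). \<omega> (fst z))"
    by (intro continuous_on_compose2[OF \<omega>] continuous_intros) auto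
  then obtain B2 where B2: "\<And>a b. norm a \<le> R \<Longrightarrow> norm (b::real^'m) \<le> R \<Longrightarrow> norm (\<omega> (fst (a, b))) \<le> B2"
    by (rule continuous_bounded_on_pairs) blast
  have "\<bar>excess \<omega> G a b n\<bar> \<le> B1 + C * (B2 + 2 * R)\<^sup>2" if ab: "norm a \<le> R" "norm b \<le> R" for a b
  proof -
    have R: "norm (b - a) \<le> 2 * R" using ab norm_triangle_ineq4[of b a] by simp
    have w: "norm (\<omega> a) \<le> B2" using B2[OF ab] by simp
    have "\<bar>\<omega> a \<bullet> (D a b n *v (b - a))\<bar> \<le> C * (norm (\<omega> a) + norm (b - a))\<^sup>2"
      by (rule sym_pos_def_polarization[OF spd C(2)]) (use C in simp)
    also have "\<dots> \<le> C * (B2 + 2 * R)\<^sup>2"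
      using C R w by (intro mult_left_mono power_mono add_mono) auto
    finally have d: "\<bar>\<omega> a \<bullet> (D a b n *v (b - a))\<bar> \<le> C * (B2 + 2 * R)\<^sup>2" .
    have "excess \<omega> G a b n = (ec_flux f U a b n \<bullet> \<omega> a - (\<Sum>k\<in>UNIV. n $ k * G k a)) - (1/2) * (\<omega> a \<bullet> (D a b n *v (b - a)))"
      by (simp add: excess_def num_flux_def inner_diff_left inner_diff_right inner_commute)
    moreover have "\<bar>ec_flux f U a b n \<bullet> \<omega> a - (\<Sum>k\<in>UNIV. n $ k * G k a)\<bar> \<le> B1" using B1[OF ab] by simp
    ultimately show ?thesis using d by linarith
  qed
  then show ?thesis by blast
qed

text \<open>Consistency replaces the numerical flux by the exact one, so the remainder vanishes at a
  state where \<open>G k\<close> equals the flux tested with \<omega>; this is how \<open>G\<close>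
  is adjusted to the outer state.\<close>

lemma excess_diagonal:
  assumes "norm n = 1"
  shows "excess \<omega> G a a n = (\<Sum>k\<in>UNIV. n $ k * (f k (cv a) \<bullet> \<omega> a - G k a))"
  using consistent assms
  by (simp add: excess_def consistent_flux_def flux_dot_def inner_sum_left sum_subtractf right_diff_distrib)

lemma excess_pair:
  assumes "norm n = 1"
  shows "excess \<omega> G a b n + excess \<omega> G b a (- n)
    = num_flux f U D a b n \<bullet> (\<omega> a - \<omega> b) + (\<Sum>k\<in>UNIV. n $ k * (G k b - G k a))"
proof -
  have "num_flux f U D b a (- n) = - num_flux f U D a b n"
    using conservative assms unfolding conservative_flux_def by (metis minus_minus)
  then show ?thesis
    by (simp add: excess_def inner_diff_right sum_subtractf right_diff_distrib sum_negf)
qed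

lemma excess_pair_const:
  assumes "norm n = 1"
  shows "excess (\<lambda>_. e) (\<lambda>k _. g k) a b n + excess (\<lambda>_. e) (\<lambda>k _. g k) b a (- n) = 0"
  using excess_pair[OF assms, of "\<lambda>_. e" "\<lambda>k _. g k" a b] by simp

text \<open>By \<open>ec_flux_jump\<close> the entropy conservative part cancels the jump of the
  potentials, and half the quadratic form of \<open>D\<close> at the jump is left. The constants
  \<open>g k\<close> drop out of the jump.\<close>

lemma excess_pair_entropy:
  assumes n: "norm n = 1"
  shows "excess (\<lambda>v. v) (\<lambda>k v. psi k v + g k) a b n + excess (\<lambda>v. v) (\<lambda>k v. psi k v + g k) b a (- n) \<ge> 0"
proof -
  have "(b - a) \<bullet> (D a b n *v (b - a)) \<ge> 0"
    using admissible n by (intro sym_pos_def_nonneg) (auto simp: admissible_diffusion_def)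
  moreover have "num_flux f U D a b n \<bullet> (a - b) = - (ec_flux f U a b n \<bullet> (b - a)) + (1/2) * ((b - a) \<bullet> (D a b n *v (b - a)))"
    by (simp add: num_flux_def inner_diff_left inner_diff_right inner_commute algebra_simps)
  moreover have "ec_flux f U a b n \<bullet> (b - a) = (\<Sum>k\<in>UNIV. n $ k * ((psi k b + g k) - (psi k a + g k)))"
    using ec_flux_jump[of a b n] by (simp only: add_diff_cancel_right)
  ultimately show ?thesis
    using excess_pair[OF n, of "\<lambda>v. v" "\<lambda>k v. psi k v + g k" a b] by linarith
qed

end

section \<open>Solutions of the scheme\<close>

lemma cell_integrable:
  fixes g :: "'a::euclidean_space \<times> real \<Rightarrow> real"
  assumes K: "convex K" "bounded K" and g: "continuous_on UNIV g"
  shows "set_integrable lebesgue K (\<lambda>x. g (x, t))"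
proof -
  have "continuous_on UNIV (\<lambda>x::'a. (x, t))"
    by (intro continuous_on_Pair continuous_on_id continuous_on_const)
  then have c: "continuous_on UNIV (\<lambda>x. g (x, t))" by (rule continuous_on_compose2[OF g]) simp
  then have m: "(\<lambda>x. g (x, t)) \<in> borel_measurable borel" by (rule borel_measurable_continuous_onI)
  obtain B where B: "\<And>x. x \<in> interior K \<Longrightarrow> \<bar>g (x, t)\<bar> \<le> B"
    using continuous_compact_bound[OF c bounded_interior[OF K(2)]] by metis
  have "integrable lborel (\<lambda>x. indicator (interior K) x *\<^sub>R g (x, t))"
  proof (rule integrable_bounded_support[OF _ bounded_interior[OF K(2)]])
    have [measurable]: "interior K \<in> sets borel" by simp
    show "(\<lambda>x. indicator (interior K) x *\<^sub>R g (x, t)) \<in> borel_measurable borel" using m by measurable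
    show "\<bar>indicator (interior K) x *\<^sub>R g (x, t)\<bar> \<le> B" if "x \<in> interior K" for x
      using B[OF that] that by simp
  qed simp
  then show ?thesis using set_integral_lebesgue_convex(2)[OF K(1) m, of "\<lambda>x. g (x, t)"] by simp
qed

lemma space_time_sum:
  fixes g :: "'k \<Rightarrow> 'a::euclidean_space \<times> real \<Rightarrow> real"
  assumes K: "convex K" "bounded K" and fin: "finite I" and g: "\<And>k. k \<in> I \<Longrightarrow> continuous_on UNIV (g k)"
  shows "(LINT t:{a..<b}|lebesgue. LINT x:K|lebesgue. \<Sum>k\<in>I. g k (x, t))
    = (\<Sum>k\<in>I. LINT t:{a..<b}|lebesgue. LINT x:K|lebesgue. g k (x, t))"
proof -
  have "(LINT x:K|lebesgue. \<Sum>k\<in>I. g k (x, t)) = (\<Sum>k\<in>I. LINT x:K|lebesgue. g k (x, t))" for t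
    using cell_integrable[OF K g, of _ t] unfolding set_lebesgue_integral_def set_integrable_def scaleR_sum_right
    by (intro Bochner_Integration.integral_sum) auto
  then show ?thesis
    using space_time_integrable[OF K g, of _ a b] unfolding set_lebesgue_integral_def set_integrable_def
    by (simp add: scaleR_sum_right del: real_scaleR_def)
qed

text \<open>The Bochner integral of a function that is not integrable is \<open>0\<close> by
  default, so a pointwise sign is enough; the residuals inside the viscosity are treated this
  way.\<close>

lemma set_integral_nonneg_pointwise:
  fixes f :: "'a \<Rightarrow> real"
  assumes "\<And>x. x \<in> A \<Longrightarrow> 0 \<le> f x"
  shows "0 \<le> (LINT x:A|M. f x)"
  unfolding set_lebesgue_integral_def using assms by (intro integral_nonneg_AE AE_I2) (simp add: indicator_def)

text \<open>The density is nonnegative at every point: where the normal is unique the height is at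
  least \<open>inradius\<close>, and elsewhere the default normal \<open>0\<close> makes the
  quotient \<open>0\<close>.\<close>

lemma surface_integral_nonneg:
  assumes K: "convex K" "bounded K" "interior K \<noteq> {}" and g: "\<And>x. 0 \<le> g x"
  shows "0 \<le> surface_integral K g"
proof -
  interpret convex_body K "center K" by (rule convex_body_center[OF K])
  have "surface_density x \<ge> 0" for x
  proof (cases "smooth_at K (radial_projection K (center K) x)")
    case True
    then show ?thesis
      using supporting_normal_ge_inradius[OF outward_normal_supporting[OF True]] inradius(1) by (simp add: surface_density_def)
  qed (simp add: surface_density_def outward_normal_not_smooth)
  then show ?thesis
    unfolding surface_integral_density[OF convex_body_axioms]
    by (intro set_integral_nonneg_pointwise mult_nonneg_nonneg g)
qed

text \<open>Positive definiteness gives a trivial kernel and hence an inverse; with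
  \<open>z = matrix_inv A *v w\<close> the form is that of \<open>A\<close> at
  \<open>z\<close>.\<close>

lemma sym_pos_def_inverse_nonneg:
  fixes A :: "real^'m^'m"
  assumes A: "sym_pos_def A"
  shows "w \<bullet> (matrix_inv A *v w) \<ge> 0"
proof -
  have "x = 0" if "A *v x = 0" for x
    using A that unfolding sym_pos_def_def by (metis inner_zero_right less_irrefl)
  then obtain B where "B ** A = mat 1" using matrix_left_invertible_ker[of A] by blast
  then have "invertible A" using matrix_left_right_inverse[of B A] by (auto simp: invertible_def)
  then have "\<exists>B. A ** B = mat 1 \<and> B ** A = mat 1" by (simp add: invertible_def)
  from someI_ex[OF this] have "A ** matrix_inv A = mat 1" unfolding matrix_inv_def by blast
  then have "A *v (matrix_inv A *v w) = w" by (simp add: matrix_vector_mul_assoc)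
  then show ?thesis
    using sym_pos_def_nonneg[OF A, of "matrix_inv A *v w"] by (simp add: inner_commute)
qed

text \<open>\<open>dt\<close> is a two-sided derivative, so it is identified at inner times only,
  where \<open>v\<close> is polynomial on both sides; the initial time of a slab is a null set. The
  same holds for \<open>dx\<close> at interior points of a cell.\<close>

lemma dt_eqI:
  assumes der: "((\<lambda>s. p s) has_vector_derivative d) (at t)" and "a < t" "t < b" and eq: "\<And>s. s \<in> {a..<b} \<Longrightarrow> w x s = p s"
  shows "dt w x t = d"
proof -
  have "((\<lambda>s. w x s) has_vector_derivative d) (at t)"
    by (rule has_vector_derivative_transform_within_open[OF der, of "{a<..<b}"]) (use assms in auto)
  then show ?thesis unfolding dt_def by (rule vector_derivative_at)
qed

lemma dx_eqI:
  assumes der: "((\<lambda>s. p (x + s *\<^sub>R axis k 1)) has_vector_derivative d) (at 0)" and x: "x \<in> interior K"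
    and eq: "\<And>y. y \<in> K \<Longrightarrow> w y t = p y"
  shows "dx k w x t = d"
proof -
  let ?S = "(\<lambda>s::real. x + s *\<^sub>R axis k 1) -` interior K"
  have "open ?S" by (intro open_vimage open_interior continuous_intros)
  then have "((\<lambda>s. w (x + s *\<^sub>R axis k 1) t) has_vector_derivative d) (at 0)"
    by (rule has_vector_derivative_transform_within_open[OF der]) (use x in \<open>auto intro!: eq[symmetric] dest: subsetD[OF interior_subset]\<close>)
  then show ?thesis unfolding dx_def by (rule vector_derivative_at)
qed

lemma dt_const: "dt (\<lambda>_ _. e) x t = 0" by (simp add: dt_def)
lemma dx_const: "dx k (\<lambda>_ _. e) x t = 0" by (simp add: dx_def)

lemma inner_trace_const: "inner_trace K (\<lambda>_ _. e) x t = e"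
  unfolding inner_trace_def by (intro tendsto_Lim) simp_all

section \<open>The discrete solution on cells and slabs\<close>

locale scdg = numerical_scheme f U F D
  for f :: "'d::finite \<Rightarrow> real^'m \<Rightarrow> real^'m" and U F D +
  fixes \<Omega> :: "(real^'d) set" and T :: real and N :: nat and tt :: "nat \<Rightarrow> real" and \<T> :: "nat \<Rightarrow> (real^'d) set set"
    and \<sigma> :: real and q :: nat and v :: "real^'d \<Rightarrow> real \<Rightarrow> real^'m" and v0 :: "real^'d \<Rightarrow> real^'m"
  assumes open_domain: "open \<Omega>" and bounded_domain: "bounded \<Omega>" and nonempty_domain: "\<Omega> \<noteq> {}"
    and mesh: "st_mesh \<Omega> T N tt \<T> \<sigma>" and v_DG: "v \<in> DG_space q N tt \<T>" and v0_DG: "v0 \<in> spatial_DG_space q (\<T> 0)"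
    and support: "supported_inside \<Omega> {0..<T} (\<lambda>x t. cons_var U (v x t))"
begin

lemma N_pos: "N > 0" and tt_ends: "tt 0 = 0" "tt N = T" and tt_less: "n < N \<Longrightarrow> tt n < tt (Suc n)"
  and cells: "n < N \<Longrightarrow> finite (\<T> n)" "n < N \<Longrightarrow> disjoint (\<T> n)" "n < N \<Longrightarrow> K \<in> \<T> n \<Longrightarrow> convex K"
    "n < N \<Longrightarrow> K \<in> \<T> n \<Longrightarrow> K \<subseteq> \<Omega>" "n < N \<Longrightarrow> \<Omega> \<subseteq> (\<Union>K\<in>\<T> n. closure K)"
  and shape: "\<sigma> > 0" "n < N \<Longrightarrow> K \<in> \<T> n \<Longrightarrow> mesh_size N tt \<T> \<le> \<sigma> * inner_diameter (st_cell tt n K)"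
proof -
  note m1 = mesh[unfolded st_mesh_def]
  note m2 = conjunct2[OF m1] note m3 = conjunct2[OF m2] note m4 = conjunct2[OF m3] note m5 = conjunct2[OF m4]
  note m6 = conjunct2[OF m5]
  show "N > 0" by (rule conjunct1[OF m1])
  show "tt 0 = 0" by (rule conjunct1[OF m2])
  show "tt N = T" by (rule conjunct1[OF m3])
  show "\<sigma> > 0" by (rule conjunct1[OF m6])
  show "tt n < tt (Suc n)" if "n < N" by (rule conjunct1[OF m4, rule_format, OF that])
  show "mesh_size N tt \<T> \<le> \<sigma> * inner_diameter (st_cell tt n K)" if "n < N" "K \<in> \<T> n"
    by (rule conjunct2[OF m6, rule_format, OF that])
  note c = conjunct1[OF m5, rule_format]
  show "finite (\<T> n)" if "n < N" by (rule conjunct1[OF c[OF that]])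
  show "disjoint (\<T> n)" if "n < N" by (rule conjunct1[OF conjunct2[OF c[OF that]]])
  show "convex K" if "n < N" "K \<in> \<T> n"
    by (rule conjunct1[OF bspec[OF conjunct1[OF conjunct2[OF conjunct2[OF c[OF that(1)]]]] that(2)]])
  show "K \<subseteq> \<Omega>" if "n < N" "K \<in> \<T> n"
    by (rule conjunct2[OF bspec[OF conjunct1[OF conjunct2[OF conjunct2[OF c[OF that(1)]]]] that(2)]])
  show "\<Omega> \<subseteq> (\<Union>K\<in>\<T> n. closure K)" if "n < N"
    by (rule conjunct2[OF conjunct2[OF conjunct2[OF c[OF that]]]])
qed

lemma cell_bounded: "n < N \<Longrightarrow> K \<in> \<T> n \<Longrightarrow> bounded K"
  by (rule bounded_subset[OF bounded_domain cells(4)])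

lemma tt_mono: "m \<le> n \<Longrightarrow> n \<le> N \<Longrightarrow> tt m \<le> tt n"
proof (induction n)
  case (Suc n)
  then show ?case using tt_less[of n] by (cases "m = Suc n") auto
qed simp

lemma slab_times: "n < N \<Longrightarrow> t \<in> {tt n..<tt (Suc n)} \<Longrightarrow> t \<in> {0..<T}"
  using tt_mono[of 0 n] tt_mono[of "Suc n" N] tt_ends by auto

text \<open>The closures cover a nonempty domain, so some cell of the first slab is nonempty, and
  its space-time cell contains two points with different times.\<close>

lemma mesh_size_pos: "mesh_size N tt \<T> > 0"
proof -
  have n: "0 < N" by (rule N_pos)
  obtain x K where K: "K \<in> \<T> 0" "x \<in> closure K" using nonempty_domain cells(5)[OF n] by blast
  then obtain y where y: "y \<in> K" by (metis closure_empty equals0D equals0I)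
  let ?S = "st_cell tt 0 K"
  have lt: "tt 0 < tt (Suc 0)" by (rule tt_less[OF n])
  have pts: "(y, tt 0) \<in> ?S" "(y, (tt 0 + tt (Suc 0)) / 2) \<in> ?S" using y lt by (auto simp: st_cell_def)
  have "bounded ?S" unfolding st_cell_def by (intro bounded_Times cell_bounded[OF n K(1)]) simp
  from diameter_bounded_bound[OF this pts] have "0 < diameter ?S"
    using lt by (simp add: dist_Pair_Pair dist_real_def)
  also have "diameter ?S \<le> mesh_size N tt \<T>"
  proof -
    let ?I = "Sigma {..<N} \<T>" and ?d = "\<lambda>(n, K). diameter (st_cell tt n K)"
    have "finite ?I" using cells(1) by (intro finite_SigmaI) auto
    then have "bdd_above (?d ` ?I)" by (intro bdd_above_finite finite_imageI)
    then have "?d (0, K) \<le> (SUP z\<in>?I. ?d z)" using n K(1) by (intro cSUP_upper) auto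
    then show ?thesis by (simp add: mesh_size_def)
  qed
  finally show ?thesis .
qed

text \<open>If the interior were empty, no ball of positive radius would fit and the inscribed
  diameter would be \<open>0\<close>, while shape regularity bounds the positive mesh size by a
  multiple of it.\<close>

lemma cell_interior:
  assumes "n < N" "K \<in> \<T> n"
  shows "interior K \<noteq> {}"
proof
  assume empty: "interior K = {}"
  let ?S = "st_cell tt n K"
  have int: "interior ?S = {}" unfolding st_cell_def by (simp add: interior_Times empty)
  have "{2 * r |r x. 0 \<le> r \<and> ball x r \<subseteq> ?S} = {0}"
  proof (intro equalityI subsetI)
    fix s assume "s \<in> {2 * r |r x. 0 \<le> r \<and> ball x r \<subseteq> ?S}"
    then obtain r x where r: "s = 2 * r" "0 \<le> r" "ball x r \<subseteq> ?S" by blast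
    have "r = 0"
    proof (rule ccontr)
      assume "r \<noteq> 0"
      then have "x \<in> interior ?S" using r by (intro interiorI[of "ball x r"]) auto
      then show False using int by simp
    qed
    then show "s \<in> {0}" using r by simp
  next
    fix s :: real assume "s \<in> {0}"
    then show "s \<in> {2 * r |r x. 0 \<le> r \<and> ball x r \<subseteq> ?S}" by (intro CollectI exI[of _ 0]) auto
  qed
  then have "inner_diameter ?S = 0" by (simp add: inner_diameter_def)
  then show False using shape(2)[OF assms] mesh_size_pos by simp
qed

definition poly :: "nat \<Rightarrow> (real^'d) set \<Rightarrow> (real^'d) \<times> real \<Rightarrow> real^'m" where
  "poly n K = (SOME p. p \<in> polys q \<and> (\<forall>(x, t)\<in>st_cell tt n K. v x t = p (x, t)))"

definition dpoly :: "nat \<Rightarrow> (real^'d) set \<Rightarrow> (real^'d) \<times> real \<Rightarrow> (real^'d) \<times> real \<Rightarrow> real^'m" where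
  "dpoly n K = (SOME p'. (\<forall>z. (poly n K has_derivative p' z) (at z)) \<and> (\<forall>h. continuous_on UNIV (\<lambda>z. p' z h)))"

lemma poly:
  assumes "n < N" "K \<in> \<T> n"
  shows "poly n K \<in> polys q" "x \<in> K \<Longrightarrow> t \<in> {tt n..<tt (Suc n)} \<Longrightarrow> v x t = poly n K (x, t)"
proof -
  have "\<exists>p. p \<in> polys q \<and> (\<forall>(x, t)\<in>st_cell tt n K. v x t = p (x, t))"
    using v_DG assms unfolding DG_space_def by blast
  from someI_ex[OF this] have "poly n K \<in> polys q \<and> (\<forall>(x, t)\<in>st_cell tt n K. v x t = poly n K (x, t))"
    unfolding poly_def .
  then show "poly n K \<in> polys q" "x \<in> K \<Longrightarrow> t \<in> {tt n..<tt (Suc n)} \<Longrightarrow> v x t = poly n K (x, t)"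
    by (auto simp: st_cell_def)
qed

lemma dpoly:
  assumes "n < N" "K \<in> \<T> n"
  shows "(poly n K has_derivative dpoly n K z) (at z)" "continuous_on UNIV (\<lambda>z. dpoly n K z h)"
proof -
  have "\<exists>p'. (\<forall>z. (poly n K has_derivative p' z) (at z)) \<and> (\<forall>h. continuous_on UNIV (\<lambda>z. p' z h))"
    using polys_C1[OF poly(1)[OF assms]] by metis
  from someI_ex[OF this] show "(poly n K has_derivative dpoly n K z) (at z)" "continuous_on UNIV (\<lambda>z. dpoly n K z h)"
    unfolding dpoly_def by blast+
qed

lemma poly_cont: "n < N \<Longrightarrow> K \<in> \<T> n \<Longrightarrow> continuous_on UNIV (poly n K)"
  by (rule has_derivative_continuous_UNIV[OF dpoly(1)])

lemma poly_space_deriv: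
  assumes "n < N" "K \<in> \<T> n"
  shows "((\<lambda>s. poly n K (x + s *\<^sub>R h, t)) has_vector_derivative dpoly n K (x, t) (h, 0)) (at 0)"
proof -
  have "((\<lambda>s. (x + s *\<^sub>R h, t)) has_vector_derivative (h, 0)) (at 0)"
    by (auto simp: has_vector_derivative_def intro!: derivative_eq_intros)
  then have 1: "((\<lambda>s. (x + s *\<^sub>R h, t)) has_derivative (\<lambda>r. r *\<^sub>R (h, 0))) (at 0)"
    by (simp add: has_vector_derivative_def)
  have 2: "(poly n K has_derivative dpoly n K (x, t)) (at (x + 0 *\<^sub>R h, t))" using dpoly(1)[OF assms, of "(x, t)"] by simp
  show ?thesis
    using has_derivative_compose[OF 1 2] linear_cmul[OF has_derivative_linear[OF 2], of _ "(h, 0)"]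
    by (simp add: has_vector_derivative_def)
qed

lemma poly_time_deriv:
  assumes "n < N" "K \<in> \<T> n"
  shows "((\<lambda>s. poly n K (x, s)) has_vector_derivative dpoly n K (x, t) (0, 1)) (at t)"
proof -
  have "((\<lambda>s. (x, s)) has_derivative (\<lambda>r. (0, r))) (at t)"
    by (intro has_derivative_Pair has_derivative_const has_derivative_ident)
  then have 1: "((\<lambda>s. (x, s)) has_derivative (\<lambda>r. r *\<^sub>R (0, 1))) (at t)" by simp
  have 2: "(poly n K has_derivative dpoly n K (x, t)) (at (x, t))" by (rule dpoly(1)[OF assms])
  have 3: "(\<lambda>r. dpoly n K (x, t) (r *\<^sub>R (0, 1))) = (\<lambda>r. r *\<^sub>R dpoly n K (x, t) (0, 1))"
    by (rule ext) (rule linear_cmul[OF has_derivative_linear[OF 2]])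
  show ?thesis
    using has_derivative_compose[OF 1 2] unfolding has_vector_derivative_def 3 .
qed

lemma potential_deriv:
  fixes \<Psi> :: "real^'m \<Rightarrow> real"
  assumes "(\<Psi> has_derivative (\<lambda>h. g \<bullet> h)) (at (p s))" "(p has_vector_derivative d) (at s)"
  shows "((\<lambda>s. \<Psi> (p s)) has_real_derivative g \<bullet> d) (at s)"
  using has_derivative_compose[OF assms(2)[unfolded has_vector_derivative_def] assms(1)]
  by (simp add: has_field_derivative_def mult_commute_abs)

definition supp :: "(real^'d) set" where
  "supp = (SOME C. compact C \<and> C \<subseteq> \<Omega> \<and> (\<forall>t\<in>{0..<T}. \<forall>x. x \<notin> C \<longrightarrow> cv (v x t) = 0))"

lemma supp: "closed supp" "supp \<subseteq> \<Omega>" "t \<in> {0..<T} \<Longrightarrow> x \<notin> supp \<Longrightarrow> v x t = ev 0"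
proof -
  have "\<exists>C. compact C \<and> C \<subseteq> \<Omega> \<and> (\<forall>t\<in>{0..<T}. \<forall>x. x \<notin> C \<longrightarrow> cv (v x t) = 0)"
    using support unfolding supported_inside_def .
  from someI_ex[OF this] have s: "compact supp" "supp \<subseteq> \<Omega>" "\<forall>t\<in>{0..<T}. \<forall>x. x \<notin> supp \<longrightarrow> cv (v x t) = 0"
    unfolding supp_def by blast+
  show "closed supp" "supp \<subseteq> \<Omega>" using s compact_imp_closed by blast+
  show "v x t = ev 0" if "t \<in> {0..<T}" "x \<notin> supp" using s(3) that ev_cv[of "v x t"] by simp
qed

lemma slab: "n < N \<Longrightarrow> slab \<Omega> (\<T> n) supp v (ev 0) (tt n) (tt (Suc n)) (poly n)"
proof
  assume n: "n < N"
  show "open \<Omega>" by (rule open_domain)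
  show "finite (\<T> n)" "disjoint (\<T> n)" "\<Omega> \<subseteq> (\<Union>K\<in>\<T> n. closure K)" by (rule cells[OF n])+
  show "closed supp" "supp \<subseteq> \<Omega>" by (rule supp)+
  show "v x t = ev 0" if "t \<in> {tt n..<tt (Suc n)}" "x \<notin> supp" for t x
    by (rule supp(3)[OF slab_times[OF n that(1)] that(2)])
  fix K assume K: "K \<in> \<T> n"
  show "convex K" by (rule cells(3)[OF n K])
  show "bounded K" by (rule cell_bounded[OF n K])
  show "interior K \<noteq> {}" by (rule cell_interior[OF n K])
  show "continuous_on UNIV (poly n K)" by (rule poly_cont[OF n K])
  show "v x t = poly n K (x, t)" if "x \<in> K" "t \<in> {tt n..<tt (Suc n)}" for x t
    by (rule poly(2)[OF n K that])
qed

text \<open>The shift gives the potential the value \<open>ev 0 \<bullet> f k 0\<close> at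
  \<open>ev 0\<close>, which is the flux tested with the state there; the remainder then vanishes on
  the outer boundary.\<close>

abbreviation "potential k z \<equiv> psi k z + F k 0"

definition flux_grad :: "nat \<Rightarrow> (real^'d) set \<Rightarrow> 'd \<Rightarrow> (real^'d) \<times> real \<Rightarrow> real" where
  "flux_grad n K k z = f k (cv (poly n K z)) \<bullet> dpoly n K z (axis k 1, 0)"

lemma flux_grad_cont: "n < N \<Longrightarrow> K \<in> \<T> n \<Longrightarrow> continuous_on UNIV (flux_grad n K k)"
  unfolding flux_grad_def[abs_def]
  by (intro continuous_on_inner continuous_on_compose2[OF fcv_cont poly_cont] dpoly(2)) auto

lemma slab_flux_entropy:
  assumes n: "n < N"
  shows "slab_flux \<Omega> (\<T> n) supp v (ev 0) (tt n) (tt (Suc n)) (poly n) (excess (\<lambda>z. z) potential) potential (flux_grad n)"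
proof -
  interpret slab \<Omega> "\<T> n" supp v "ev 0" "tt n" "tt (Suc n)" "poly n" by (rule slab[OF n])
  have pc: "continuous_on UNIV (potential k)" for k by (intro continuous_intros psi_cont)
  show ?thesis
  proof
    show "(\<lambda>(a, b). excess (\<lambda>z. z) potential a b m) \<in> borel_measurable borel" for m
      by (intro excess_measurable continuous_on_id pc)
    show "norm m = 1 \<Longrightarrow> \<exists>B. \<forall>a b. norm a \<le> R \<longrightarrow> norm b \<le> R \<longrightarrow> \<bar>excess (\<lambda>z. z) potential a b m\<bar> \<le> B" for m R
      by (intro excess_bounded continuous_on_id pc)
    show "norm m = 1 \<Longrightarrow> excess (\<lambda>z. z) potential (ev 0) (ev 0) m = 0" for m
      by (simp add: excess_diagonal psi_def inner_commute)
    show "continuous_on UNIV (potential k)" for k by (rule pc)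
    show "K \<in> \<T> n \<Longrightarrow> continuous_on UNIV (flux_grad n K k)" for K k by (rule flux_grad_cont[OF n])
    show "((\<lambda>s. potential k (poly n K (x + s *\<^sub>R axis k 1, t))) has_real_derivative flux_grad n K k (x, t)) (at 0)"
      if K: "K \<in> \<T> n" for K k x t
    proof -
      have "((\<lambda>s. psi k (poly n K (x + s *\<^sub>R axis k 1, t))) has_real_derivative flux_grad n K k (x, t)) (at 0)"
        unfolding flux_grad_def
        by (rule potential_deriv[OF _ poly_space_deriv[OF n K]]) (use psi_deriv in simp)
      from DERIV_add[OF this DERIV_const[of "F k 0"]] show ?thesis by simp
    qed
  qed
qed

lemma slab_flux_const:
  assumes n: "n < N"
  shows "slab_flux \<Omega> (\<T> n) supp v (ev 0) (tt n) (tt (Suc n)) (poly n)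
    (excess (\<lambda>_. e) (\<lambda>k _. f k 0 \<bullet> e)) (\<lambda>k _. f k 0 \<bullet> e) (\<lambda>_ _ _. 0)"
proof -
  interpret slab \<Omega> "\<T> n" supp v "ev 0" "tt n" "tt (Suc n)" "poly n" by (rule slab[OF n])
  show ?thesis
  proof
    show "(\<lambda>(a, b). excess (\<lambda>_. e) (\<lambda>k _. f k 0 \<bullet> e) a b m) \<in> borel_measurable borel" for m
      by (intro excess_measurable continuous_on_const)
    show "norm m = 1 \<Longrightarrow> \<exists>B. \<forall>a b. norm a \<le> R \<longrightarrow> norm b \<le> R \<longrightarrow> \<bar>excess (\<lambda>_. e) (\<lambda>k _. f k 0 \<bullet> e) a b m\<bar> \<le> B" for m R
      by (intro excess_bounded continuous_on_const)
    show "norm m = 1 \<Longrightarrow> excess (\<lambda>_. e) (\<lambda>k _. f k 0 \<bullet> e) (ev 0) (ev 0) m = 0" for m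
      by (simp add: excess_diagonal)
  qed (auto intro: continuous_on_const)
qed

definition sol :: "nat \<Rightarrow> real^'d \<Rightarrow> real^'m" where "sol n = sol_below tt v0 v n"

lemma trace_above_cell:
  assumes "n < N" "K \<in> \<T> n" "x \<in> K"
  shows "trace_above tt v n x = poly n K (x, tt n)"
  unfolding trace_above_def
proof (rule Lim_at_right_eqI)
  have "((\<lambda>s. poly n K (x, s)) has_vector_derivative dpoly n K (x, tt n) (0, 1)) (at (tt n))"
    by (rule poly_time_deriv[OF assms(1,2)])
  then have "isCont (\<lambda>s. poly n K (x, s)) (tt n)" by (rule has_vector_derivative_continuous)
  then show "((\<lambda>s. poly n K (x, s)) \<longlongrightarrow> poly n K (x, tt n)) (at_right (tt n))"
    unfolding continuous_at by (rule filterlim_mono) (auto simp: at_le)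
  show "\<forall>\<^sub>F s in at_right (tt n). poly n K (x, s) = v x s"
    using poly(2)[OF assms] tt_less[OF assms(1)]
    by (auto simp: eventually_at_right_field intro!: exI[of _ "tt (Suc n)"])
qed

lemma trace_below_cell:
  assumes "n < N" "K \<in> \<T> n" "x \<in> K"
  shows "trace_below tt v (Suc n) x = poly n K (x, tt (Suc n))" "sol (Suc n) x = poly n K (x, tt (Suc n))"
proof -
  have "((\<lambda>s. poly n K (x, s)) has_vector_derivative dpoly n K (x, tt (Suc n)) (0, 1)) (at (tt (Suc n)))"
    by (rule poly_time_deriv[OF assms(1,2)])
  then have "isCont (\<lambda>s. poly n K (x, s)) (tt (Suc n))" by (rule has_vector_derivative_continuous)
  then have lim: "((\<lambda>s. poly n K (x, s)) \<longlongrightarrow> poly n K (x, tt (Suc n))) (at_left (tt (Suc n)))"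
    unfolding continuous_at by (rule filterlim_mono) (auto simp: at_le)
  have "\<forall>\<^sub>F s in at_left (tt (Suc n)). poly n K (x, s) = v x s"
    using poly(2)[OF assms] tt_less[OF assms(1)]
    by (auto simp: eventually_at_left_field intro!: exI[of _ "tt n"])
  from Lim_transform_eventually[OF lim this]
  show "trace_below tt v (Suc n) x = poly n K (x, tt (Suc n))"
    unfolding trace_below_def by (intro tendsto_Lim) auto
  then show "sol (Suc n) x = poly n K (x, tt (Suc n))" by (simp add: sol_def sol_below_def)
qed

lemma poly_slice_cont: "n < N \<Longrightarrow> K \<in> \<T> n \<Longrightarrow> continuous_on UNIV (\<lambda>x. poly n K (x, t))"
  by (rule continuous_on_compose2[OF poly_cont]) (auto intro!: continuous_on_Pair continuous_on_id continuous_on_const)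

lemma domain_sets: "\<Omega> \<in> sets lebesgue"
  by (rule fmeasurableD[OF lmeasurable_open[OF bounded_domain open_domain]])

text \<open>For \<open>n > 0\<close> the values are piecewise polynomial with respect to the mesh of
  the preceding slab, for \<open>n = 0\<close> with respect to the first mesh. Meshes may change
  between slabs, so the property is stated on the whole domain, where it can be restricted to the
  cells of either mesh.\<close>

lemma sol_bounded_measurable:
  assumes "n \<le> N"
  shows "bounded_measurable_on \<Omega> (sol n)"
proof (cases n)
  case 0
  have n: "0 < N" by (rule N_pos)
  obtain g where g: "\<And>K. K \<in> \<T> 0 \<Longrightarrow> g K \<in> polys q \<and> (\<forall>x\<in>K. v0 x = g K x)"
    using v0_DG unfolding spatial_DG_space_def by (simp only: mem_Collect_eq) metis
  have gc: "continuous_on UNIV (g K)" if "K \<in> \<T> 0" for K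
    using polys_C1[of "g K" q] g[OF that] has_derivative_continuous_UNIV by metis
  show ?thesis
    by (rule bounded_measurable_piecewise[OF cells(1,2)[OF n] _ _ cells(5)[OF n] domain_sets gc])
      (use n 0 cells(3) cell_bounded g in \<open>auto simp: sol_def sol_below_def\<close>)
next
  case (Suc k)
  then have k: "k < N" using assms by simp
  show ?thesis
    unfolding Suc
    by (rule bounded_measurable_piecewise[OF cells(1,2)[OF k] _ _ cells(5)[OF k] domain_sets poly_slice_cont[OF k]])
      (use k cells(3) cell_bounded trace_below_cell(2) in auto)
qed

end

section \<open>Conservation, entropy decay and the lower bound\<close>

context scdg
begin

definition energy :: "nat \<Rightarrow> real" where
  "energy n = (LINT x:\<Omega>|lebesgue. U (cv (sol n x)))"

lemma cell_sets: "n < N \<Longrightarrow> K \<in> \<T> n \<Longrightarrow> K \<in> sets lebesgue"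
  using measurable_convex[OF cells(3) cell_bounded] by (auto simp: fmeasurable_def)

lemma sol_integrable:
  fixes h :: "(real^'m) \<times> (real^'d) \<Rightarrow> 'c::euclidean_space"
  assumes "n \<le> N" "continuous_on UNIV h" "S \<in> sets lebesgue" "S \<subseteq> \<Omega>"
  shows "set_integrable lebesgue S (\<lambda>x. h (sol n x, x))"
  by (rule bounded_measurable_integrable[OF sol_bounded_measurable[OF assms(1)] assms(2) bounded_domain assms(3,4)])

lemma sol_integrable':
  fixes h :: "real^'m \<Rightarrow> 'c::euclidean_space"
  assumes "n \<le> N" "continuous_on UNIV h" "S \<in> sets lebesgue" "S \<subseteq> \<Omega>"
  shows "set_integrable lebesgue S (\<lambda>x. h (sol n x))"
  using sol_integrable[OF assms(1) continuous_on_compose2[OF assms(2), of UNIV fst] assms(3,4)]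
  by (simp add: continuous_on_fst continuous_on_id)

lemma Ucv_cont: "continuous_on UNIV (\<lambda>z. U (cv z))"
  by (rule continuous_on_compose2[OF U_cont cv_cont]) simp

lemma sum_domain:
  fixes g :: "real^'d \<Rightarrow> 'c::euclidean_space"
  assumes "n < N" "set_integrable lebesgue \<Omega> g"
  shows "(\<Sum>K\<in>\<T> n. LINT x:K|lebesgue. g x) = (LINT x:\<Omega>|lebesgue. g x)"
  by (rule sum_cells_integral[OF cells(1,2)[OF assms(1)] _ _ _ cells(5)[OF assms(1)] assms(2) domain_sets])
    (use assms(1) cells(3,4) cell_bounded in auto)

definition volume_term :: "nat \<Rightarrow> (real^'d) set \<Rightarrow> real" where
  "volume_term n K = (LINT t:{tt n..<tt (Suc n)}|lebesgue. LINT x:K|lebesgue.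
     cv (v x t) \<bullet> dt v x t + (\<Sum>k\<in>UNIV. f k (cv (v x t)) \<bullet> dx k v x t))"

text \<open>In time the integrand is the derivative of \<open>phi\<close> along the solution and
  integrates to its increment. In space it is the derivative of \<open>psi k\<close> and is kept in
  this form, to be matched with the surface terms.\<close>

lemma volume_term:
  assumes n: "n < N" and K: "K \<in> \<T> n"
  shows "volume_term n K = (LINT x:K|lebesgue. phi (poly n K (x, tt (Suc n))) - phi (poly n K (x, tt n)))
    + (\<Sum>k\<in>UNIV. LINT t:{tt n..<tt (Suc n)}|lebesgue. LINT x:K|lebesgue. flux_grad n K k (x, t))"
proof -
  let ?a = "tt n" and ?b = "tt (Suc n)"
  note cK = cells(3)[OF n K] and bK = cell_bounded[OF n K]
  define Q where "Q z = cv (poly n K z) \<bullet> dpoly n K z (0, 1)" for z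
  have Qc: "continuous_on UNIV Q"
    unfolding Q_def[abs_def]
    by (intro continuous_on_inner continuous_on_compose2[OF cv_cont poly_cont[OF n K]] dpoly(2)[OF n K]) auto
  \<comment> \<open>\<open>None\<close> stands for the time direction, so that one finite sum over
    the option type collects all directions of space-time.\<close>
  define G where "G k = (case k of None \<Rightarrow> Q | Some k \<Rightarrow> flux_grad n K k)" for k
  have Gc: "continuous_on UNIV (G k)" for k
    using Qc flux_grad_cont[OF n K] by (cases k) (auto simp: G_def)
  have Gsum: "(\<Sum>k\<in>UNIV. G k z) = Q z + (\<Sum>k\<in>UNIV. flux_grad n K k z)" for z
    by (simp add: UNIV_option_conv sum.reindex G_def)
  have inner: "(LINT x:K|lebesgue. cv (v x t) \<bullet> dt v x t + (\<Sum>k\<in>UNIV. f k (cv (v x t)) \<bullet> dx k v x t))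
      = (LINT x:K|lebesgue. \<Sum>k\<in>UNIV. G k (x, t))" if t: "t \<in> interior {?a..<?b}" for t
  proof (rule set_integral_cong_AE_convex[OF cK])
    have sc: "continuous_on UNIV (\<lambda>z. \<Sum>k\<in>UNIV. G k z)" by (intro continuous_on_sum Gc)
    show "set_integrable lebesgue K (\<lambda>x. \<Sum>k\<in>UNIV. G k (x, t))"
      by (rule cell_integrable[OF cK bK sc])
    have t': "?a < t" "t < ?b" "t \<in> {?a..<?b}" using t by auto
    have "cv (v x t) \<bullet> dt v x t + (\<Sum>k\<in>UNIV. f k (cv (v x t)) \<bullet> dx k v x t) = (\<Sum>k\<in>UNIV. G k (x, t))"
      if x: "x \<in> interior K" for x
    proof -
      have xK: "x \<in> K" using x interior_subset by blast
      have d: "dt v x t = dpoly n K (x, t) (0, 1)"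
        by (rule dt_eqI[OF poly_time_deriv[OF n K] t'(1,2)]) (rule poly(2)[OF n K xK])
      have "dx k v x t = dpoly n K (x, t) (axis k 1, 0)" for k
        by (rule dx_eqI[where p = "\<lambda>y. poly n K (y, t)", OF poly_space_deriv[OF n K] x]) (rule poly(2)[OF n K _ t'(3)])
      then show ?thesis
        unfolding Gsum using d poly(2)[OF n K xK t'(3)] by (simp add: Q_def flux_grad_def)
    qed
    then show "AE x in lborel. x \<in> interior K \<longrightarrow>
       cv (v x t) \<bullet> dt v x t + (\<Sum>k\<in>UNIV. f k (cv (v x t)) \<bullet> dx k v x t) = (\<Sum>k\<in>UNIV. G k (x, t))"
      by simp
  qed
  have "volume_term n K = (LINT t:{?a..<?b}|lebesgue. LINT x:K|lebesgue. \<Sum>k\<in>UNIV. G k (x, t))"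
    unfolding volume_term_def
  proof (rule set_integral_cong_AE_convex)
    have sc: "continuous_on UNIV (\<lambda>z. \<Sum>k\<in>UNIV. G k z)" by (intro continuous_on_sum Gc)
    show "set_integrable lebesgue {?a..<?b} (\<lambda>t. LINT x:K|lebesgue. \<Sum>k\<in>UNIV. G k (x, t))"
      by (rule space_time_integrable[OF cK bK sc])
  qed (use inner in auto)
  also have "\<dots> = (\<Sum>k\<in>UNIV. LINT t:{?a..<?b}|lebesgue. LINT x:K|lebesgue. G k (x, t))"
    by (rule space_time_sum[OF cK bK _ Gc]) simp
  also have "\<dots> = (LINT t:{?a..<?b}|lebesgue. LINT x:K|lebesgue. Q (x, t))
     + (\<Sum>k\<in>UNIV. LINT t:{?a..<?b}|lebesgue. LINT x:K|lebesgue. flux_grad n K k (x, t))"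
    by (simp add: UNIV_option_conv sum.reindex G_def)
  also have "(LINT t:{?a..<?b}|lebesgue. LINT x:K|lebesgue. Q (x, t))
     = (LINT x:K|lebesgue. phi (poly n K (x, ?b)) - phi (poly n K (x, ?a)))"
  proof (rule space_time_FTC[OF cK bK Qc])
    show "continuous_on UNIV (\<lambda>z. phi (poly n K z))"
      by (rule continuous_on_compose2[OF phi_cont poly_cont[OF n K]]) simp
    show "((\<lambda>s. phi (poly n K (x, s))) has_real_derivative Q (x, t)) (at t)" for x t
      unfolding Q_def by (rule potential_deriv[OF phi_deriv poly_time_deriv[OF n K]])
    show "?a \<le> ?b" using tt_less[OF n] by simp
  qed
  finally show ?thesis .
qed

definition jump_term :: "(real^'d \<Rightarrow> real \<Rightarrow> real^'m) \<Rightarrow> nat \<Rightarrow> (real^'d) set \<Rightarrow> real" where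
  "jump_term w n K = (LINT x:K|lebesgue.
     cv (sol_below tt v0 v (Suc n) x) \<bullet> trace_below tt w (Suc n) x - cv (sol_below tt v0 v n x) \<bullet> trace_above tt w n x)"

definition flux_term :: "(real^'d \<Rightarrow> real \<Rightarrow> real^'m) \<Rightarrow> nat \<Rightarrow> (real^'d) set \<Rightarrow> real" where
  "flux_term w n K = (LINT t:{tt n..<tt (Suc n)}|lebesgue. surface_integral K (\<lambda>x.
     num_flux f U D (inner_trace K v x t) (outer_trace K v x t) (outward_normal K x) \<bullet> inner_trace K w x t))"

text \<open>The dissipation comes from the convexity of the entropy across the time jump.\<close>

lemma jump_term_entropy:
  assumes n: "n < N" and K: "K \<in> \<T> n"
  shows "(LINT x:K|lebesgue. U (cv (sol (Suc n) x)) - U (cv (sol n x)))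
    \<le> jump_term v n K - (LINT x:K|lebesgue. phi (poly n K (x, tt (Suc n))) - phi (poly n K (x, tt n)))"
proof -
  let ?p0 = "\<lambda>x. poly n K (x, tt n)" and ?p1 = "\<lambda>x. poly n K (x, tt (Suc n))"
  note S = cell_sets[OF n K] cells(4)[OF n K]
  have n': "n \<le> N" "Suc n \<le> N" using n by auto
  have i0: "set_integrable lebesgue K (\<lambda>x. U (cv (sol (Suc n) x)) - U (cv (sol n x)))"
    by (intro set_integral_diff(1) sol_integrable'[OF _ Ucv_cont S] n')
  have pc: "continuous_on UNIV ?p0" "continuous_on UNIV ?p1" by (rule poly_slice_cont[OF n K])+
  have ph: "continuous_on UNIV (\<lambda>z. cv z \<bullet> z)" by (intro continuous_on_inner cv_cont continuous_on_id)
  have "continuous_on UNIV (\<lambda>z :: (real^'m) \<times> (real^'d). cv (fst z) \<bullet> ?p0 (snd z))"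
    by (intro continuous_on_inner continuous_on_compose2[OF cv_cont] continuous_on_compose2[OF pc(1)] continuous_on_fst continuous_on_snd continuous_on_id) auto
  from sol_integrable[OF n'(1) this S]
  have j0: "set_integrable lebesgue K (\<lambda>x. cv (sol n x) \<bullet> ?p0 x)" by simp
  have j1: "set_integrable lebesgue K (\<lambda>x. cv (sol (Suc n) x) \<bullet> sol (Suc n) x)"
    by (rule sol_integrable'[OF n'(2) ph S])
  have "set_integrable lebesgue K (\<lambda>x. phi (poly n K (x, t)))" for t
    by (rule cell_integrable[OF cells(3)[OF n K] cell_bounded[OF n K], where g = "\<lambda>z. phi (poly n K z)"])
      (rule continuous_on_compose2[OF phi_cont poly_cont[OF n K]], simp)
  then have k: "set_integrable lebesgue K (\<lambda>x. phi (?p1 x) - phi (?p0 x))" by (intro set_integral_diff(1))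
  have j: "set_integrable lebesgue K (\<lambda>x. cv (sol (Suc n) x) \<bullet> sol (Suc n) x - cv (sol n x) \<bullet> ?p0 x)"
    by (rule set_integral_diff(1)[OF j1 j0])
  have jt: "jump_term v n K = (LINT x:K|lebesgue. cv (sol (Suc n) x) \<bullet> sol (Suc n) x - cv (sol n x) \<bullet> ?p0 x)"
    unfolding jump_term_def sol_def[symmetric]
    by (rule set_lebesgue_integral_cong[OF S(1)]) (simp add: trace_below_cell[OF n K] trace_above_cell[OF n K])
  have "(LINT x:K|lebesgue. U (cv (sol (Suc n) x)) - U (cv (sol n x)))
      \<le> (LINT x:K|lebesgue. (cv (sol (Suc n) x) \<bullet> sol (Suc n) x - cv (sol n x) \<bullet> ?p0 x) - (phi (?p1 x) - phi (?p0 x)))"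
  proof (rule set_integral_mono[OF i0 set_integral_diff(1)[OF j k]])
    fix x assume x: "x \<in> K"
    have "sol (Suc n) x = ?p1 x" by (rule trace_below_cell(2)[OF n K x])
    \<comment> \<open>The tangent is taken at the state just above \<open>tt n\<close> and evaluated
      at the state just below; its gap is the entropy lost in the jump.\<close>
    moreover have "U (cv (?p0 x)) + ev (cv (?p0 x)) \<bullet> (cv (sol n x) - cv (?p0 x)) \<le> U (cv (sol n x))"
      by (rule U_tangent)
    ultimately show "U (cv (sol (Suc n) x)) - U (cv (sol n x))
        \<le> (cv (sol (Suc n) x) \<bullet> sol (Suc n) x - cv (sol n x) \<bullet> ?p0 x) - (phi (?p1 x) - phi (?p0 x))"
      by (simp add: phi_def inner_diff_right inner_commute)
  qed
  also have "\<dots> = jump_term v n K - (LINT x:K|lebesgue. phi (?p1 x) - phi (?p0 x))"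
    unfolding jt by (rule set_integral_diff(2)[OF j k])
  finally show ?thesis .
qed

lemma flux_term_entropy:
  assumes n: "n < N"
  shows "(\<Sum>K\<in>\<T> n. \<Sum>k\<in>UNIV. LINT t:{tt n..<tt (Suc n)}|lebesgue. LINT x:K|lebesgue. flux_grad n K k (x, t))
    \<le> (\<Sum>K\<in>\<T> n. flux_term v n K)"
proof -
  interpret slab_flux \<Omega> "\<T> n" supp v "ev 0" "tt n" "tt (Suc n)" "poly n" "excess (\<lambda>z. z) potential" potential "flux_grad n"
    by (rule slab_flux_entropy[OF n])
  have "flux_term v n K = (LINT t:{tt n..<tt (Suc n)}|lebesgue. surface_integral K (flux_integrand K t))" for K
    unfolding flux_term_def by (simp add: flux_integrand_def[abs_def] excess_def)
  then show ?thesis using flux_balance(1)[OF excess_pair_entropy] by simp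
qed

lemma flux_term_const:
  assumes n: "n < N"
  shows "(\<Sum>K\<in>\<T> n. flux_term (\<lambda>_ _. e) n K) = 0"
proof -
  interpret slab_flux \<Omega> "\<T> n" supp v "ev 0" "tt n" "tt (Suc n)" "poly n"
    "excess (\<lambda>_. e) (\<lambda>k _. f k 0 \<bullet> e)" "\<lambda>k _. f k 0 \<bullet> e" "\<lambda>_ _ _. 0"
    by (rule slab_flux_const[OF n])
  have "flux_term (\<lambda>_ _. e) n K = (LINT t:{tt n..<tt (Suc n)}|lebesgue. surface_integral K (flux_integrand K t))" for K
    unfolding flux_term_def by (simp add: flux_integrand_def[abs_def] excess_def inner_trace_const)
  then show ?thesis using flux_balance(2)[OF excess_pair_const] by (simp add: set_lebesgue_integral_def)
qed

lemma B_DG_terms: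
  "B_DG f U D N tt \<T> v0 v w = - (\<Sum>n<N. \<Sum>K\<in>\<T> n. LINT t:{tt n..<tt (Suc n)}|lebesgue. LINT x:K|lebesgue.
          cv (v x t) \<bullet> dt w x t + (\<Sum>k\<in>UNIV. f k (cv (v x t)) \<bullet> dx k w x t))
     + (\<Sum>n<N. \<Sum>K\<in>\<T> n. jump_term w n K) + (\<Sum>n<N. \<Sum>K\<in>\<T> n. flux_term w n K)"
  unfolding B_DG_def jump_term_def flux_term_def ..

lemma viscosity_nonneg:
  assumes "c\<^sub>1 > 0" "c\<^sub>2 > 0" "n < N" "K \<in> \<T> n"
  shows "sc_viscosity f U D N tt \<T> c\<^sub>1 c\<^sub>2 \<alpha>\<^sub>1 \<alpha>\<^sub>2 \<theta> v0 v n K \<ge> 0"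
proof -
  have spd: "sym_pos_def (jac_uv U z)" for z using entropy unfolding strictly_convex_entropy_def by blast
  have "Res_bar f U tt v n K \<ge> 0"
    unfolding Res_bar_def jac_vu_def
    by (intro real_sqrt_ge_zero set_integral_nonneg_pointwise sym_pos_def_inverse_nonneg spd)
  moreover have "grad_bar U tt v n K \<ge> 0"
    unfolding grad_bar_def frozen_jac_def
    by (intro real_sqrt_ge_zero set_integral_nonneg_pointwise add_nonneg_nonneg sum_nonneg sym_pos_def_nonneg spd)
  moreover have "BRes_bar f U D tt v0 v n K \<ge> 0"
    unfolding BRes_bar_def Let_def
    by (intro real_sqrt_ge_zero add_nonneg_nonneg set_integral_nonneg_pointwise zero_le_power2
        surface_integral_nonneg cells(3)[OF assms(3,4)] cell_bounded[OF assms(3,4)] cell_interior[OF assms(3,4)])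
  ultimately show ?thesis
    unfolding sc_viscosity_def using assms(1,2)
    by (intro divide_nonneg_nonneg add_nonneg_nonneg mult_nonneg_nonneg powr_ge_zero) auto
qed

lemma B_SC_nonneg:
  assumes "c\<^sub>1 > 0" "c\<^sub>2 > 0"
  shows "B_SC f U D N tt \<T> c\<^sub>1 c\<^sub>2 \<alpha>\<^sub>1 \<alpha>\<^sub>2 \<theta> v0 v v \<ge> 0"
proof -
  have spd: "sym_pos_def (frozen_jac U tt v n K)" for n K
    using entropy unfolding strictly_convex_entropy_def frozen_jac_def by blast
  show ?thesis
    unfolding B_SC_def
    by (intro sum_nonneg set_integral_nonneg_pointwise mult_nonneg_nonneg add_nonneg_nonneg sym_pos_def_nonneg spd
        viscosity_nonneg[OF assms]) auto
qed

lemma B_SC_const: "B_SC f U D N tt \<T> c\<^sub>1 c\<^sub>2 \<alpha>\<^sub>1 \<alpha>\<^sub>2 \<theta> v0 v (\<lambda>_ _. e) = 0"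
  unfolding B_SC_def dt_const dx_const by (simp add: set_lebesgue_integral_def)

text \<open>With \<open>v\<close> as test function the shock capturing term is nonnegative, so
  \<open>B_DG\<close> is at most zero, while slab by slab it dominates the increment of the energy;
  the increments telescope.\<close>

lemma entropy_stable:
  assumes c: "c\<^sub>1 > 0" "c\<^sub>2 > 0"
    and eq: "B_DG f U D N tt \<T> v0 v v + B_SC f U D N tt \<T> c\<^sub>1 c\<^sub>2 \<alpha>\<^sub>1 \<alpha>\<^sub>2 \<theta> v0 v v = 0"
  shows "energy N \<le> energy 0"
proof -
  let ?P = "\<lambda>n K. LINT x:K|lebesgue. phi (poly n K (x, tt (Suc n))) - phi (poly n K (x, tt n))"
  let ?V = "\<lambda>n K. \<Sum>k\<in>UNIV. LINT t:{tt n..<tt (Suc n)}|lebesgue. LINT x:K|lebesgue. flux_grad n K k (x, t)"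
  have "B_DG f U D N tt \<T> v0 v v = (\<Sum>n<N. (\<Sum>K\<in>\<T> n. jump_term v n K) - (\<Sum>K\<in>\<T> n. volume_term n K) + (\<Sum>K\<in>\<T> n. flux_term v n K))"
    unfolding B_DG_terms volume_term_def[symmetric] by (simp add: sum.distrib sum_subtractf)
  also have "\<dots> = (\<Sum>n<N. (\<Sum>K\<in>\<T> n. jump_term v n K - ?P n K) + ((\<Sum>K\<in>\<T> n. flux_term v n K) - (\<Sum>K\<in>\<T> n. ?V n K)))"
  proof (rule sum.cong[OF refl])
    fix n assume "n \<in> {..<N}"
    then have "(\<Sum>K\<in>\<T> n. volume_term n K) = (\<Sum>K\<in>\<T> n. ?P n K) + (\<Sum>K\<in>\<T> n. ?V n K)"
      unfolding sum.distrib[symmetric] by (intro sum.cong refl volume_term) auto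
    then show "(\<Sum>K\<in>\<T> n. jump_term v n K) - (\<Sum>K\<in>\<T> n. volume_term n K) + (\<Sum>K\<in>\<T> n. flux_term v n K)
        = (\<Sum>K\<in>\<T> n. jump_term v n K - ?P n K) + ((\<Sum>K\<in>\<T> n. flux_term v n K) - (\<Sum>K\<in>\<T> n. ?V n K))"
      by (simp only: sum_subtractf)
  qed
  also have "\<dots> \<ge> (\<Sum>n<N. energy (Suc n) - energy n)"
  proof (rule sum_mono)
    fix n assume "n \<in> {..<N}"
    then have n: "n < N" by simp
    have i: "set_integrable lebesgue \<Omega> (\<lambda>x. U (cv (sol m x)))" if "m \<le> N" for m
      by (rule sol_integrable'[OF that Ucv_cont domain_sets]) simp
    have i': "set_integrable lebesgue \<Omega> (\<lambda>x. U (cv (sol (Suc n) x)))" "set_integrable lebesgue \<Omega> (\<lambda>x. U (cv (sol n x)))"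
      using n by (auto intro!: i)
    have "energy (Suc n) - energy n = (LINT x:\<Omega>|lebesgue. U (cv (sol (Suc n) x)) - U (cv (sol n x)))"
      unfolding energy_def by (rule set_integral_diff(2)[OF i', symmetric])
    also have "\<dots> = (\<Sum>K\<in>\<T> n. LINT x:K|lebesgue. U (cv (sol (Suc n) x)) - U (cv (sol n x)))"
      by (rule sum_domain[OF n set_integral_diff(1)[OF i'], symmetric])
    also have "\<dots> \<le> (\<Sum>K\<in>\<T> n. jump_term v n K - ?P n K)"
      by (intro sum_mono jump_term_entropy[OF n])
    also have "\<dots> \<le> (\<Sum>K\<in>\<T> n. jump_term v n K - ?P n K) + ((\<Sum>K\<in>\<T> n. flux_term v n K) - (\<Sum>K\<in>\<T> n. ?V n K))"
      using flux_term_entropy[OF n] by simp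
    finally show "energy (Suc n) - energy n
        \<le> (\<Sum>K\<in>\<T> n. jump_term v n K - ?P n K) + ((\<Sum>K\<in>\<T> n. flux_term v n K) - (\<Sum>K\<in>\<T> n. ?V n K))" .
  qed
  finally have "(\<Sum>n<N. energy (Suc n) - energy n) \<le> B_DG f U D N tt \<T> v0 v v" .
  then show ?thesis
    using eq B_SC_nonneg[OF c, of \<alpha>\<^sub>1 \<alpha>\<^sub>2 \<theta>] by (simp add: sum_lessThan_telescope)
qed

text \<open>For a constant test function only the time traces survive. Summed over cells they become
  integrals over the whole domain, which telescope even though successive slabs may carry different
  meshes; testing with every \<open>e\<close> recovers the vector identity.\<close>

lemma conservation:
  assumes eq: "\<And>e. B_DG f U D N tt \<T> v0 v (\<lambda>_ _. e) + B_SC f U D N tt \<T> c\<^sub>1 c\<^sub>2 \<alpha>\<^sub>1 \<alpha>\<^sub>2 \<theta> v0 v (\<lambda>_ _. e) = 0"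
  shows "(LINT x:\<Omega>|lebesgue. cv (sol N x)) = (LINT x:\<Omega>|lebesgue. cv (sol 0 x))"
proof -
  define m where "m n = (LINT x:\<Omega>|lebesgue. cv (sol n x))" for n
  have i: "set_integrable lebesgue \<Omega> (\<lambda>x. cv (sol n x))" if "n \<le> N" for n
    by (rule sol_integrable'[OF that cv_cont domain_sets]) simp
  have "m N \<bullet> e = m 0 \<bullet> e" for e
  proof -
    have me: "(LINT x:\<Omega>|lebesgue. cv (sol n x) \<bullet> e) = m n \<bullet> e" if "n \<le> N" for n
      using integral_inner_left[OF i[OF that, unfolded set_integrable_def], of e]
      by (simp add: m_def set_lebesgue_integral_def)
    have ie: "set_integrable lebesgue \<Omega> (\<lambda>x. cv (sol n x) \<bullet> e)" if "n \<le> N" for n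
      by (rule sol_integrable'[OF that _ domain_sets]) (auto intro!: continuous_on_inner cv_cont)
    have jump: "(\<Sum>K\<in>\<T> n. jump_term (\<lambda>_ _. e) n K) = m (Suc n) \<bullet> e - m n \<bullet> e" if n: "n < N" for n
    proof -
      have i1: "set_integrable lebesgue \<Omega> (\<lambda>x. cv (sol (Suc n) x) \<bullet> e)" and i2: "set_integrable lebesgue \<Omega> (\<lambda>x. cv (sol n x) \<bullet> e)"
        using n by (auto intro!: ie)
      have ta: "trace_above tt (\<lambda>_ _. e) n x = e" and tb: "trace_below tt (\<lambda>_ _. e) n x = e" for n and x :: "real^'d"
        unfolding trace_above_def trace_below_def by (auto intro!: tendsto_Lim)
      have "(\<Sum>K\<in>\<T> n. jump_term (\<lambda>_ _. e) n K) = (LINT x:\<Omega>|lebesgue. cv (sol (Suc n) x) \<bullet> e - cv (sol n x) \<bullet> e)"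
        unfolding jump_term_def ta tb sol_def[symmetric] by (rule sum_domain[OF n set_integral_diff(1)[OF i1 i2]])
      also have "\<dots> = m (Suc n) \<bullet> e - m n \<bullet> e"
        using n me[of n] me[of "Suc n"] by (simp add: set_integral_diff(2)[OF i1 i2])
      finally show ?thesis .
    qed
    have "0 = B_DG f U D N tt \<T> v0 v (\<lambda>_ _. e)"
      using eq[of e] by (simp only: B_SC_const add_0_right)
    also have "\<dots> = (\<Sum>n<N. \<Sum>K\<in>\<T> n. jump_term (\<lambda>_ _. e) n K)"
      unfolding B_DG_terms dt_const dx_const using flux_term_const by (simp add: set_lebesgue_integral_def)
    also have "\<dots> = (\<Sum>n<N. m (Suc n) \<bullet> e - m n \<bullet> e)"
      by (intro sum.cong refl jump) simp
    also have "\<dots> = m N \<bullet> e - m 0 \<bullet> e" by (rule sum_lessThan_telescope)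
    finally show ?thesis by simp
  qed
  then have "m N = m 0" by (metis vector_eq_rdot)
  then show ?thesis by (simp add: m_def)
qed

text \<open>The tangent inequality of \<open>U\<close> at the mean \<open>u\<close> is integrated
  over the domain; its linear term integrates to zero.\<close>

lemma jensen:
  assumes mean: "(LINT x:\<Omega>|lebesgue. cv (sol N x)) = measure lebesgue \<Omega> *\<^sub>R u"
  shows "(LINT x:\<Omega>|lebesgue. U u) \<le> energy N"
proof -
  have fin: "emeasure lebesgue \<Omega> \<noteq> \<infinity>"
    using lmeasurable_open[OF bounded_domain open_domain] by (auto simp: fmeasurable_def)
  have const: "set_integrable lebesgue \<Omega> (\<lambda>x. c)" for c :: real
    using sol_integrable'[of N "\<lambda>_. c" \<Omega>] domain_sets by (simp add: continuous_on_const)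
  have i: "set_integrable lebesgue \<Omega> (\<lambda>x. cv (sol N x))" "set_integrable lebesgue \<Omega> (\<lambda>x. U (cv (sol N x)))"
    by (rule sol_integrable'[OF _ cv_cont domain_sets] sol_integrable'[OF _ Ucv_cont domain_sets]; simp)+
  have ie: "set_integrable lebesgue \<Omega> (\<lambda>x. ev u \<bullet> cv (sol N x))"
    by (rule sol_integrable'[OF _ _ domain_sets]) (auto intro!: continuous_on_inner cv_cont)
  have "(LINT x:\<Omega>|lebesgue. ev u \<bullet> cv (sol N x)) = ev u \<bullet> (LINT x:\<Omega>|lebesgue. cv (sol N x))"
    using integral_inner_right[OF i(1)[unfolded set_integrable_def], of "ev u"] by (simp add: set_lebesgue_integral_def)
  also have "\<dots> = (LINT x:\<Omega>|lebesgue. ev u \<bullet> u)"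
    unfolding mean set_integral_const[OF domain_sets fin] by simp
  finally have eq: "(LINT x:\<Omega>|lebesgue. ev u \<bullet> cv (sol N x)) = (LINT x:\<Omega>|lebesgue. ev u \<bullet> u)" .
  have "(LINT x:\<Omega>|lebesgue. U u) = (LINT x:\<Omega>|lebesgue. U u + (ev u \<bullet> cv (sol N x) - ev u \<bullet> u))"
    using eq by (simp add: set_integral_add(2)[OF const set_integral_diff(1)[OF ie const]] set_integral_diff(2)[OF ie const])
  also have "\<dots> \<le> energy N"
    unfolding energy_def
  proof (rule set_integral_mono[OF set_integral_add(1)[OF const set_integral_diff(1)[OF ie const]] i(2)])
    show "U u + (ev u \<bullet> cv (sol N x) - ev u \<bullet> u) \<le> U (cv (sol N x))" for x
      using U_tangent[of u "cv (sol N x)"] by (simp add: inner_diff_right)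
  qed
  finally show ?thesis .
qed

end

theorem theorem4p1:
  fixes f :: "'d::finite \<Rightarrow> real^'m \<Rightarrow> real^'m"
    and U :: "real^'m \<Rightarrow> real"
    and F :: "'d \<Rightarrow> real^'m \<Rightarrow> real"
    and D :: "real^'m \<Rightarrow> real^'m \<Rightarrow> real^'d \<Rightarrow> real^'m^'m"
    and \<Omega> :: "(real^'d) set"
    and \<T> :: "nat \<Rightarrow> (real^'d) set set"
    and tt :: "nat \<Rightarrow> real"
    and q N :: nat
    and T \<sigma> c\<^sub>1 c\<^sub>2 \<alpha>\<^sub>1 \<alpha>\<^sub>2 \<theta> d' :: real
    and u0 :: "real^'d \<Rightarrow> real^'m"
    and u :: "real^'d \<Rightarrow> real \<Rightarrow> real^'m"
    and P :: "(real^'d \<Rightarrow> real^'m) \<Rightarrow> (real^'d \<Rightarrow> real^'m)"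
    and v0 :: "real^'d \<Rightarrow> real^'m"
    and v :: "real^'d \<Rightarrow> real \<Rightarrow> real^'m"
  assumes "CARD('d) \<in> {1, 2, 3}" and "d' = real CARD('d) + 1"
    and "\<And>k. C1 (f k)"
    and "strictly_convex_entropy U" and "entropy_pair f U F"
    and "open \<Omega>" and "connected \<Omega>" and "bounded \<Omega>" and "\<Omega> \<noteq> {}"
    and "st_mesh \<Omega> T N tt \<T> \<sigma>"
    and "admissible_diffusion D"
    and "consistent_flux f U (num_flux f U D)" and "conservative_flux (num_flux f U D)"
    and "c\<^sub>1 > 0" and "c\<^sub>2 > 0" and "0 < \<alpha>\<^sub>1" and "\<alpha>\<^sub>1 < 2" and "\<alpha>\<^sub>2 > 0"
    and "\<theta> \<ge> max (d' / 2 - \<alpha>\<^sub>1 / 2) (d' / 2 - \<alpha>\<^sub>2)"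
    and "supported_inside \<Omega> {0} (\<lambda>x t. u0 x)"
    and "weak_solution f T u0 u" and "supported_inside \<Omega> {0..T} u"
    and "projection_onto_DG q (\<T> 0) P" and "v0 = P (\<lambda>x. entropy_var U (u0 x))"
    and "SCDG_solution f U D q N tt \<T> c\<^sub>1 c\<^sub>2 \<alpha>\<^sub>1 \<alpha>\<^sub>2 \<theta> v0 v"
    and "supported_inside \<Omega> {0..<T} (\<lambda>x t. cons_var U (v x t))"
  shows "let u\<^sub>0 = (\<lambda>x. cons_var U (sol_below tt v0 v 0 x));
             u\<^sub>N = (\<lambda>x. cons_var U (sol_below tt v0 v N x));
             ustar = (1 / measure lebesgue \<Omega>) *\<^sub>R (LINT x:\<Omega>|lebesgue. u\<^sub>0 x)
         in (LINT x:\<Omega>|lebesgue. u\<^sub>N x) = (LINT x:\<Omega>|lebesgue. u\<^sub>0 x) \<and>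
            (LINT x:\<Omega>|lebesgue. U ustar) \<le> (LINT x:\<Omega>|lebesgue. U (u\<^sub>N x)) \<and>
            (LINT x:\<Omega>|lebesgue. U (u\<^sub>N x)) \<le> (LINT x:\<Omega>|lebesgue. U (u\<^sub>0 x))"
proof -
  have P: "v0 \<in> spatial_DG_space q (\<T> 0)"
    using assms(23,24) unfolding projection_onto_DG_def by blast
  have v: "v \<in> DG_space q N tt \<T>"
    and eq: "\<And>w. w \<in> DG_space q N tt \<T> \<Longrightarrow> B_DG f U D N tt \<T> v0 v w + B_SC f U D N tt \<T> c\<^sub>1 c\<^sub>2 \<alpha>\<^sub>1 \<alpha>\<^sub>2 \<theta> v0 v w = 0"
    using assms(25) unfolding SCDG_solution_def by blast+
  interpret scdg f U F D \<Omega> T N tt \<T> \<sigma> q v v0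
    by unfold_locales (use assms P v in \<open>blast+\<close>)
  have const: "(\<lambda>_ _. e) \<in> DG_space q N tt \<T>" for e :: "real^'m"
    unfolding DG_space_def
    by (intro CollectI allI impI ballI bexI[of _ "\<lambda>_. e"]) (auto intro: const_polys)
  have m: "measure lebesgue \<Omega> \<noteq> 0"
    using open_not_negligible[OF open_domain nonempty_domain] lmeasurable_open[OF bounded_domain open_domain]
    by (auto simp: negligible_iff_measure)
  have cons: "(LINT x:\<Omega>|lebesgue. cv (sol N x)) = (LINT x:\<Omega>|lebesgue. cv (sol 0 x))"
    by (rule conservation[OF eq[OF const]])
  have stab: "energy N \<le> energy 0"
    by (rule entropy_stable[OF assms(14,15) eq[OF v]])
  \<comment> \<open>By \<open>cons\<close> the initial mean is also the mean of the final state, as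
    \<open>jensen\<close> requires; \<open>m\<close> allows the volume to be cancelled.\<close>
  show ?thesis
    unfolding Let_def sol_def[symmetric]
    using cons stab jensen[of "(1 / measure lebesgue \<Omega>) *\<^sub>R (LINT x:\<Omega>|lebesgue. cv (sol 0 x))"] m
    by (simp add: energy_def)
qed

end
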